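(* (i) $A\neq\emptyset$ if and only if there exists $\nu\in\mathcal M_{i,0}^*$ such that $(1+x^2)^{-\delta}d\nu(x)\in\mathcal M_d^*$ for every $\delta>0$. (ii) $B\neq\emptyset$ if and only if there exists $\nu\in\mathcal M_d^*$ such that $(1+x^2)^{\delta}d\nu(x)\in\mathcal M_i^*$ for every $\delta>0$.
   Context: $\mathcal M^*$ denotes the set of positive Borel measures on $\mathbb R$ with infinite support and finite moments of every order. A measure $\mu\in\mathcal M^*$ is determinate if it is the only measure in $\mathcal M^*$ with the moments $s_n=\int x^n\,d\mu(x)$, $n\ge 0$; otherwise it is indeterminate. $\mathcal M_d^*$ and $\mathcal M_i^*$ denote the sets of determinate, respectively indeterminate, measures in $\mathcal M^*$. An indeterminate measure $\mu$ is called N-extremal if (after normalization to mass 1) it is one of the solutions of its moment problem corresponding to a constant parameter $t\in\mathbb R\cup\{\infty\}$ in the Nevanlinna parametrization; by a theorem of M. Riesz this is equivalent to $\mathbb C[x]$ being dense in $L^2(\mu)$. $\mathcal M_{i,0}^*$ denotes the set of measures in $\mathcal M^*$ that are indeterminate and N-extremal. For $0\le\alpha\le 1$ put $$A(\alpha)=\{\mu\in\mathcal M_i^*\mid (1+x^2)^{-\alpha}d\mu(x)\in\mathcal M_i^*\},\qquad B(\alpha)=\{\mu\in\mathcal M_i^*\mid (1+x^2)^{-\alpha}d\mu(x)\in\mathcal M_d^*\}.$$ For $\mu\in\mathcal M_{i,0}^*$ define $$a(\mu)=\sup\{\alpha\in[0,1]\mid \mu\in A(\alpha)\}=\inf\{\beta\in[0,1]\mid\mu\in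 B(\beta)\}$$ (the two expressions coincide). Finally put $$A=\{\mu\in\mathcal M_{i,0}^*\mid (1+x^2)^{-a(\mu)}d\mu(x)\in\mathcal M_i^*\},\qquad B=\{\mu\in\mathcal M_{i,0}^*\mid (1+x^2)^{-a(\mu)}d\mu(x)\in\mathcal M_d^*\}.$$ *)

theory Defs
  imports "HOL-Analysis.Analysis" "HOL-Computational_Algebra.Polynomial"
begin

section \<open>Determinate and indeterminate measures\<close>

definition measure_support :: "real measure \<Rightarrow> real set" where
  "measure_support \<mu> = {x. \<forall>U. open U \<longrightarrow> x \<in> U \<longrightarrow> emeasure \<mu> U > 0}"

definition Mstar :: "real measure set" where
  "Mstar = {\<mu>. sets \<mu> = sets borel \<and> infinite (measure_support \<mu>) \<and>
                (\<forall>n::nat. integrable \<mu> (\<lambda>x. x ^ n))}"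

definition moment :: "real measure \<Rightarrow> nat \<Rightarrow> real" where
  "moment \<mu> n = (LINT x|\<mu>. x ^ n)"

definition Mstar_d :: "real measure set" where
  "Mstar_d = {\<mu> \<in> Mstar. \<forall>\<nu> \<in> Mstar. (\<forall>n. moment \<nu> n = moment \<mu> n) \<longrightarrow> \<nu> = \<mu>}"

definition Mstar_i :: "real measure set" where
  "Mstar_i = Mstar - Mstar_d"

section \<open>The Nevanlinna functions of a moment problem\<close>

definition orthonormal_polys :: "real measure \<Rightarrow> (nat \<Rightarrow> real poly) \<Rightarrow> bool" where
  "orthonormal_polys \<sigma> P \<longleftrightarrow>
     (\<forall>n. degree (P n) = n \<and> lead_coeff (P n) > 0) \<and>
     (\<forall>m n. (LINT x|\<sigma>. poly (P m) x * poly (P n) x) = (if m = n then 1 else 0))"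

text \<open>On \<^const>\<open>Mstar\<close> there is exactly one orthonormal sequence, so the description is proper.\<close>

definition orthonormal_poly :: "real measure \<Rightarrow> nat \<Rightarrow> real poly" where
  "orthonormal_poly \<sigma> = (THE P. orthonormal_polys \<sigma> P)"

definition P_fun :: "real measure \<Rightarrow> nat \<Rightarrow> complex \<Rightarrow> complex" where
  "P_fun \<sigma> n z = poly (map_poly of_real (orthonormal_poly \<sigma> n)) z"

text \<open>
  Polynomials of the second kind, \<open>Q\<^sub>n(z) = \<integral> (P\<^sub>n(z) - P\<^sub>n(x)) / (z - x) d\<sigma>(x)\<close>.
  The difference quotient is a polynomial in \<open>x\<close>, namely the synthetic division of \<open>P\<^sub>n\<close>
  at \<open>z\<close>. Writing it with field division would give the wrong value \<open>0\<close> at \<open>x = z\<close>, which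
  matters when \<open>\<sigma>\<close> has an atom at a real \<open>z\<close>.
\<close>

definition Q_fun :: "real measure \<Rightarrow> nat \<Rightarrow> complex \<Rightarrow> complex" where
  "Q_fun \<sigma> n z =
     (LINT x|\<sigma>. poly (synthetic_div (map_poly of_real (orthonormal_poly \<sigma> n)) z) (of_real x))"

text \<open>
  The four entire functions of the Nevanlinna parametrization, in the standard normalization
  (\<open>A D - B C = 1\<close>). The series converge when \<open>\<sigma>\<close> is indeterminate of total mass \<open>1\<close>.
\<close>

definition nevanlinna_A :: "real measure \<Rightarrow> complex \<Rightarrow> complex" where
  "nevanlinna_A \<sigma> z = z * (\<Sum>n. Q_fun \<sigma> n 0 * Q_fun \<sigma> n z)"

definition nevanlinna_B :: "real measure \<Rightarrow> complex \<Rightarrow> complex" where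
  "nevanlinna_B \<sigma> z = - 1 + z * (\<Sum>n. Q_fun \<sigma> n 0 * P_fun \<sigma> n z)"

definition nevanlinna_C :: "real measure \<Rightarrow> complex \<Rightarrow> complex" where
  "nevanlinna_C \<sigma> z = 1 + z * (\<Sum>n. P_fun \<sigma> n 0 * Q_fun \<sigma> n z)"

definition nevanlinna_D :: "real measure \<Rightarrow> complex \<Rightarrow> complex" where
  "nevanlinna_D \<sigma> z = z * (\<Sum>n. P_fun \<sigma> n 0 * P_fun \<sigma> n z)"

section \<open>N-extremal measures\<close>

definition stieltjes_transform :: "real measure \<Rightarrow> complex \<Rightarrow> complex" where
  "stieltjes_transform \<sigma> z = (LINT x|\<sigma>. 1 / (of_real x - z))"

definition normalize_mass :: "real measure \<Rightarrow> real measure" where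
  "normalize_mass \<mu> = scale_measure (1 / emeasure \<mu> UNIV) \<mu>"

text \<open>
  In the Nevanlinna parametrization the solution with parameter \<open>\<phi>\<close> has Stieltjes transform
  \<open>- (A \<phi> - C) / (B \<phi> - D)\<close> off the real line, which is to be read as \<open>- A / B\<close> for \<open>\<phi> = \<infinity>\<close>.
  The second disjunct below is the parameter \<open>\<infinity>\<close>.
\<close>

definition N_extremal :: "real measure \<Rightarrow> bool" where
  "N_extremal \<mu> \<longleftrightarrow>
     (let \<sigma> = normalize_mass \<mu> in
       (\<exists>t::real. \<forall>z. z \<notin> \<real> \<longrightarrow>
          stieltjes_transform \<sigma> z =
            - (nevanlinna_A \<sigma> z * of_real t - nevanlinna_C \<sigma> z)
              / (nevanlinna_B \<sigma> z * of_real t - nevanlinna_D \<sigma> z)) \<or>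
       (\<forall>z. z \<notin> \<real> \<longrightarrow>
          stieltjes_transform \<sigma> z = - nevanlinna_A \<sigma> z / nevanlinna_B \<sigma> z))"

definition Mstar_i0 :: "real measure set" where
  "Mstar_i0 = {\<mu> \<in> Mstar_i. N_extremal \<mu>}"

section \<open>The sets A and B\<close>

text \<open>The measure \<open>(1 + x\<^sup>2)\<^sup>r d\<mu>(x)\<close>, for a real exponent \<open>r\<close> of either sign.\<close>

definition weighted :: "real \<Rightarrow> real measure \<Rightarrow> real measure" where
  "weighted r \<mu> = density \<mu> (\<lambda>x. ennreal ((1 + x\<^sup>2) powr r))"

definition A_at :: "real \<Rightarrow> real measure set" where
  "A_at \<alpha> = {\<mu> \<in> Mstar_i. weighted (- \<alpha>) \<mu> \<in> Mstar_i}"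

definition B_at :: "real \<Rightarrow> real measure set" where
  "B_at \<alpha> = {\<mu> \<in> Mstar_i. weighted (- \<alpha>) \<mu> \<in> Mstar_d}"

text \<open>
  For \<open>\<mu>\<close> in \<^const>\<open>Mstar_i0\<close> this supremum is also the infimum of the \<open>\<beta> \<in> [0, 1]\<close> with
  \<open>\<mu> \<in> B_at \<beta>\<close>. The set contains \<open>0\<close> and is bounded by \<open>1\<close>.
\<close>

definition a_index :: "real measure \<Rightarrow> real" where
  "a_index \<mu> = Sup {\<alpha> \<in> {0..1}. \<mu> \<in> A_at \<alpha>}"

definition A_set :: "real measure set" where
  "A_set = {\<mu> \<in> Mstar_i0. weighted (- a_index \<mu>) \<mu> \<in> Mstar_i}"

definition B_set :: "real measure set" where
  "B_set = {\<mu> \<in> Mstar_i0. weighted (- a_index \<mu>) \<mu> \<in> Mstar_d}"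

end

theory Submission
  imports Defs "HOL-Probability.Probability" "HOL-Computational_Algebra.Fundamental_Theorem_Algebra"
begin

text \<open>
  Write \<open>f\<^sub>z(x) = 1 / (x - z)\<close>. Two facts drive the argument, for \<open>z\<close> ranging over the nonreal numbers.

  A measure \<open>\<mu>\<close> is determinate iff for all \<open>z\<close> the infimum of \<open>\<integral> |r|\<^sup>2 d\<mu>\<close> over the polynomials with
  \<open>r(z) = 1\<close> vanishes. If it does, the moments determine \<open>\<integral> f\<^sub>z d\<mu>\<close>, hence \<open>\<mu>\<close>. If it does not for
  some \<open>z\<close>, the orthonormal polynomials are square summable at every point, and weak limits of the
  quadratures at the zeros of the partial sums of \<open>B\<close> and of \<open>D\<close> give two different solutions.

  An indeterminate \<open>\<mu>\<close> is N-extremal iff for all \<open>z\<close> the function \<open>f\<^sub>z\<close> is in the closure of the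
  polynomials in \<open>L\<^sup>2(\<mu>)\<close>: with \<open>F(z) = \<integral> f\<^sub>z d\<mu>\<close>, \<open>u = C + F D\<close> and \<open>v = A + F B\<close>, Parseval's identity
  for \<open>f\<^sub>z\<close> and \<open>f\<^sub>w\<close> is equivalent to \<open>u(z) v(w) = v(z) u(w)\<close>.

  Both conditions are inherited by \<open>(1 + x\<^sup>2)\<^sup>-\<^sup>\<delta> d\<mu>\<close>, and the first for \<open>\<mu>\<close> is the second for
  \<open>(1 + x\<^sup>2) d\<mu>\<close>. So \<open>(1 + x\<^sup>2)\<^bsup>-a(\<mu>)\<^esup> d\<mu>\<close> works in the forward directions, and
  in the converse directions \<open>\<nu>\<close> has \<open>a(\<nu>) = 0\<close> and \<open>(1 + x\<^sup>2) d\<nu>\<close> has index \<open>1\<close>.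
\<close>

section \<open>Integrals of polynomials and resolvents\<close>

text \<open>The bridge between the two conditions is algebraic. For \<open>r = 1 - (x - z) p\<close>
  one has \<open>r(z) = 1\<close> and \<open>f_z - p = r / (x - z)\<close>, and for nonreal
  \<open>z\<close> the factor \<open>1 / |x - z|^2\<close> is comparable to
  \<open>1 / (1 + x^2)\<close>. This is why the exponent \<open>1\<close> bounds the index. Both
  conditions pass to smaller weights because \<open>(1 + x^2)\<close> to a negative power is at most
  \<open>1\<close>, while the competing polynomials stay the same.

  Indeterminacy first gives square summability at one nonreal point only. It spreads to all points
  because the values at \<open>z\<close> solve a discrete Volterra equation whose data are the
  values at the first point, so a Gronwall estimate applies.

  Solved for the parameter, the Nevanlinna formula reads \<open>u = t v\<close>, or
  \<open>v = 0\<close> for the parameter at infinity. Parseval's identity for the pair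
  \<open>z\<close>, \<open>\<i>\<close> makes the ratio of \<open>u\<close> and \<open>v\<close>
  independent of \<open>z\<close>; the pair \<open>\<i>\<close>, \<open>- \<i>\<close> makes it
  real.

  N-extremality and the quadratures refer to total mass \<open>1\<close>, so measures are scaled by
  a constant on the way in and out.\<close>

lemma Cauchy_Schwarz_LINT:
  fixes f g :: "'a \<Rightarrow> complex"
  assumes [measurable]: "f \<in> borel_measurable M" "g \<in> borel_measurable M"
    and f: "integrable M (\<lambda>x. (cmod (f x))\<^sup>2)" and g: "integrable M (\<lambda>x. (cmod (g x))\<^sup>2)"
  shows "integrable M (\<lambda>x. f x * g x)"
    and "(cmod (LINT x|M. f x * g x))\<^sup>2 \<le> (LINT x|M. (cmod (f x))\<^sup>2) * (LINT x|M. (cmod (g x))\<^sup>2)"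
proof -
  have le: "2 * l * (cmod (f x) * cmod (g x)) \<le> l\<^sup>2 * (cmod (f x))\<^sup>2 + (cmod (g x))\<^sup>2" for l x
    using zero_le_power2[of "l * cmod (f x) - cmod (g x)"]
    by (simp add: power2_diff power_mult_distrib algebra_simps)
  show int: "integrable M (\<lambda>x. f x * g x)"
  proof (rule Bochner_Integration.integrable_bound)
    show "integrable M (\<lambda>x. (cmod (f x))\<^sup>2 + (cmod (g x))\<^sup>2)" using f g by auto
    have "cmod (f x) * cmod (g x) \<le> (cmod (f x))\<^sup>2 + (cmod (g x))\<^sup>2" for x
    proof -
      have "0 \<le> cmod (f x) * cmod (g x)" by simp
      then show ?thesis using le[of 1 x] by (simp only: mult_1_right mult_1_left one_power2)
    qed
    then show "AE x in M. norm (f x * g x) \<le> norm ((cmod (f x))\<^sup>2 + (cmod (g x))\<^sup>2)"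
      by (simp add: norm_mult)
  qed simp
  let ?X = "LINT x|M. (cmod (f x))\<^sup>2" and ?Y = "LINT x|M. (cmod (g x))\<^sup>2"
  define a where "a = (LINT x|M. cmod (f x) * cmod (g x))"
  have inta: "integrable M (\<lambda>x. cmod (f x) * cmod (g x))"
    using integrable_norm[OF int] by (simp add: norm_mult)
  have a0: "0 \<le> a" unfolding a_def by (rule integral_nonneg_AE) simp
  have norm_le: "cmod (LINT x|M. f x * g x) \<le> a"
    unfolding a_def using integral_norm_bound[of M "\<lambda>x. f x * g x"] by (simp add: norm_mult)
  \<comment> \<open>A quadratic in \<open>l\<close> bounded from below; \<open>l = a / ?X\<close>
    gives the inequality, and if \<open>?X = 0\<close> a large \<open>l\<close> forces
    \<open>a = 0\<close>.\<close>
  have quad: "2 * l * a \<le> l\<^sup>2 * ?X + ?Y" for l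
  proof -
    have "(LINT x|M. 2 * l * (cmod (f x) * cmod (g x))) \<le> (LINT x|M. l\<^sup>2 * (cmod (f x))\<^sup>2 + (cmod (g x))\<^sup>2)"
      using f g inta le by (intro integral_mono) auto
    then show ?thesis unfolding a_def using f g inta by simp
  qed
  have X0: "0 \<le> ?X" and Y0: "0 \<le> ?Y" by (auto intro!: integral_nonneg_AE)
  have "a\<^sup>2 \<le> ?X * ?Y"
  proof (cases "?X = 0")
    case True
    have "a = 0"
    proof (rule ccontr)
      assume "a \<noteq> 0"
      then have "a > 0" using a0 by simp
      then show False using quad[of "(?Y + 1) / (2 * a)"] True Y0 by (simp add: field_simps)
    qed
    then show ?thesis using True by simp
  next
    case False
    then have "?X > 0" using X0 by linarith
    then show ?thesis using quad[of "a / ?X"] by (simp add: field_simps power2_eq_square)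
  qed
  moreover have "(cmod (LINT x|M. f x * g x))\<^sup>2 \<le> a\<^sup>2"
    using norm_le by (intro power_mono) auto
  ultimately show "(cmod (LINT x|M. f x * g x))\<^sup>2 \<le> ?X * ?Y" by simp
qed

lemma nonreal_dist_ge:
  "\<bar>Im z\<bar> \<le> cmod (complex_of_real x - z)"
  using abs_Im_le_cmod[of "complex_of_real x - z"] by simp

lemma nonreal_neq: "z \<notin> \<real> \<Longrightarrow> complex_of_real x - z \<noteq> 0"
  by auto

lemma nonreal_Im: "z \<notin> \<real> \<Longrightarrow> Im z \<noteq> 0"
  using complex_is_Real_iff by auto

section \<open>The moment functional and the resolvents of a fixed measure\<close>

locale mstar =
  fixes \<mu> :: "real measure"
  assumes Mstar: "\<mu> \<in> Mstar"
begin

lemma sets_mu [measurable_cong]: "sets \<mu> = sets borel"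
  using Mstar by (simp add: Mstar_def)

lemma space_mu [simp]: "space \<mu> = UNIV"
  using sets_eq_imp_space_eq[OF sets_mu] by simp

lemma integrable_power: "integrable \<mu> (\<lambda>x. x ^ n)"
  using Mstar by (simp add: Mstar_def)

sublocale finite_measure \<mu>
proof
  have "integrable \<mu> (\<lambda>x::real. 1::real)" using integrable_power[of 0] by simp
  then show "emeasure \<mu> (space \<mu>) \<noteq> \<infinity>"
    by (auto simp: integrable_iff_bounded)
qed

lemma integrable_poly: "integrable \<mu> (\<lambda>x. poly p (complex_of_real x))"
proof -
  have "integrable \<mu> (\<lambda>x. complex_of_real (x ^ n))" for n
    by (rule integrable_of_real[OF integrable_power])
  then have "integrable \<mu> (\<lambda>x. coeff p n * complex_of_real x ^ n)" for n
    by simp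
  then show ?thesis unfolding poly_altdef by (intro Bochner_Integration.integrable_sum) auto
qed

lemma measurable_poly [measurable]: "(\<lambda>x. poly p (complex_of_real x)) \<in> borel_measurable \<mu>"
  using integrable_poly by auto

definition L :: "complex poly \<Rightarrow> complex" where
  "L p = (LINT x|\<mu>. poly p (complex_of_real x))"

lemma L_add: "L (p + q) = L p + L q"
  by (simp add: L_def integrable_poly)

lemma L_smult: "L (smult c p) = c * L p"
  by (simp add: L_def integrable_poly)

lemma L_0 [simp]: "L 0 = 0"
  by (simp add: L_def)

lemma L_diff: "L (p - q) = L p - L q"
  by (simp add: L_def integrable_poly)

lemma L_sum: "L (sum f A) = (\<Sum>i\<in>A. L (f i))"
  by (simp add: L_def integrable_poly poly_sum)

text \<open>On the real line \<open>map_poly cnj p\<close> takes the conjugate values of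
  \<open>p\<close>. So the integral of the squared modulus is a value of \<open>L\<close>, hence
  determined by the moments.\<close>

lemma poly_mult_cnj:
  "poly (p * map_poly cnj p) (complex_of_real x) = complex_of_real ((cmod (poly p (complex_of_real x)))\<^sup>2)"
  using complex_norm_square[of "poly p (complex_of_real x)"] by simp

lemma integrable_cmod2: "integrable \<mu> (\<lambda>x. (cmod (poly p (complex_of_real x)))\<^sup>2)"
proof -
  have "integrable \<mu> (\<lambda>x. Re (poly (p * map_poly cnj p) (complex_of_real x)))"
    by (rule integrable_Re[OF integrable_poly])
  then show ?thesis by (simp only: poly_mult_cnj Re_complex_of_real)
qed

lemma L_mult_cnj:
  "L (p * map_poly cnj p) = complex_of_real (LINT x|\<mu>. (cmod (poly p (complex_of_real x)))\<^sup>2)"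
  unfolding L_def poly_mult_cnj by (rule integral_complex_of_real)

lemma measurable_resolvent [measurable]: "(\<lambda>x. 1 / (complex_of_real x - z)) \<in> borel_measurable \<mu>"
  by measurable

lemma cmod_div_resolvent_le:
  assumes "z \<notin> \<real>"
  shows "cmod (w / (complex_of_real x - z)) \<le> cmod w / \<bar>Im z\<bar>"
  using nonreal_dist_ge[of z x] nonreal_Im[OF assms]
  by (simp add: norm_divide frac_le)

lemma integrable_poly_resolvent:
  assumes "z \<notin> \<real>"
  shows "integrable \<mu> (\<lambda>x. poly p (complex_of_real x) / (complex_of_real x - z))"
proof (rule Bochner_Integration.integrable_bound)
  show "integrable \<mu> (\<lambda>x. cmod (poly p (complex_of_real x)) / \<bar>Im z\<bar>)"
    by (intro integrable_divide integrable_norm integrable_poly)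
  show "AE x in \<mu>. norm (poly p (complex_of_real x) / (complex_of_real x - z))
      \<le> norm (cmod (poly p (complex_of_real x)) / \<bar>Im z\<bar>)"
    using cmod_div_resolvent_le[OF assms] by auto
qed measurable

lemma integrable_resolvent:
  assumes "z \<notin> \<real>" shows "integrable \<mu> (\<lambda>x. 1 / (complex_of_real x - z))"
  using integrable_poly_resolvent[OF assms, of 1] by simp

lemma integrable_cmod2_poly_resolvent:
  assumes "z \<notin> \<real>"
  shows "integrable \<mu> (\<lambda>x. (cmod (poly p (complex_of_real x) / (complex_of_real x - z)))\<^sup>2)"
proof (rule Bochner_Integration.integrable_bound)
  show "integrable \<mu> (\<lambda>x. (cmod (poly p (complex_of_real x)))\<^sup>2 / \<bar>Im z\<bar>\<^sup>2)"
    by (intro integrable_divide integrable_cmod2)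
  have "(cmod (poly p (complex_of_real x) / (complex_of_real x - z)))\<^sup>2
      \<le> (cmod (poly p (complex_of_real x)) / \<bar>Im z\<bar>)\<^sup>2" for x
    using cmod_div_resolvent_le[OF assms] by (intro power_mono) auto
  then show "AE x in \<mu>. norm ((cmod (poly p (complex_of_real x) / (complex_of_real x - z)))\<^sup>2)
      \<le> norm ((cmod (poly p (complex_of_real x)))\<^sup>2 / \<bar>Im z\<bar>\<^sup>2)"
    by (auto simp: power_divide)
qed measurable

lemma resolvent_minus_poly:
  assumes "z \<notin> \<real>"
  shows "1 / (complex_of_real x - z) - poly p (complex_of_real x)
    = poly (1 - [:- z, 1:] * p) (complex_of_real x) / (complex_of_real x - z)"
  using nonreal_neq[OF assms, of x] by (simp add: field_simps)

lemma integrable_cmod2_resolvent: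
  assumes "z \<notin> \<real>" shows "integrable \<mu> (\<lambda>x. (cmod (1 / (complex_of_real x - z)))\<^sup>2)"
  using integrable_cmod2_poly_resolvent[OF assms, of 1] by simp

lemma integrable_cmod2_resolvent_minus_poly:
  assumes "z \<notin> \<real>"
  shows "integrable \<mu> (\<lambda>x. (cmod (1 / (complex_of_real x - z) - poly p (complex_of_real x)))\<^sup>2)"
  unfolding resolvent_minus_poly[OF assms] by (rule integrable_cmod2_poly_resolvent[OF assms])

text \<open>Infinite support enters here: a vanishing integral confines the support to the finitely
  many real zeros of \<open>p\<close>.\<close>

lemma cmod2_poly_eq_0:
  assumes "(LINT x|\<mu>. (cmod (poly p (complex_of_real x)))\<^sup>2) = 0"
  shows "p = 0"
proof (rule ccontr)
  assume "p \<noteq> 0"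
  define Z where "Z = {x::real. poly p (complex_of_real x) = 0}"
  have "finite {z. poly p z = 0}" using \<open>p \<noteq> 0\<close> by (rule poly_roots_finite)
  then have "finite (complex_of_real -` {z. poly p z = 0})"
    by (rule finite_vimageI) (simp add: inj_of_real)
  then have fin: "finite Z" by (simp add: Z_def vimage_def)
  have "AE x in \<mu>. (cmod (poly p (complex_of_real x)))\<^sup>2 = 0"
    using integral_nonneg_eq_0_iff_AE[OF integrable_cmod2] assms by simp
  then have AE: "AE x in \<mu>. x \<notin> - Z" by (auto simp: Z_def)
  have "open (- Z)" using fin by (simp add: finite_imp_closed open_Compl)
  then have m: "- Z \<in> sets \<mu>" by (simp add: sets_mu)
  have null: "emeasure \<mu> (- Z) = 0"
    using AE_iff_null_sets[OF m] AE by auto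
  have "measure_support \<mu> \<subseteq> Z"
    using \<open>open (- Z)\<close> null by (fastforce simp: measure_support_def)
  then show False using fin Mstar finite_subset by (auto simp: Mstar_def)
qed

text \<open>Separates a part known from the moments from a remainder that is small when
  \<open>r\<close> is small in the square norm.\<close>

lemma stieltjes_split:
  assumes "z \<notin> \<real>" "poly r z = 1"
  shows "stieltjes_transform \<mu> z
    = L (- synthetic_div r z) + (LINT x|\<mu>. poly r (complex_of_real x) / (complex_of_real x - z))"
proof -
  have "1 / (complex_of_real x - z) = poly (- synthetic_div r z) (complex_of_real x)
      + poly r (complex_of_real x) / (complex_of_real x - z)" for x
  proof -
    have "poly r (complex_of_real x) = (complex_of_real x - z) * poly (synthetic_div r z) (complex_of_real x) + 1"
      using arg_cong[OF synthetic_div_correct'[of z r], of "\<lambda>p. poly p (complex_of_real x)"] assms(2)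
      by (simp add: algebra_simps)
    then show ?thesis using nonreal_neq[OF assms(1), of x] by (simp add: field_simps)
  qed
  then show ?thesis
    unfolding stieltjes_transform_def L_def
    using integrable_poly integrable_poly_resolvent[OF assms(1)]
    by (simp only:) (rule Bochner_Integration.integral_add)
qed

end

section \<open>Stieltjes transforms and determinacy\<close>

lemma tendsto_exp_limit_complex:
  fixes w :: complex
  shows "(\<lambda>n. (1 + w / of_nat n) ^ n) \<longlonglongrightarrow> exp w"
proof -
  have "((\<lambda>y. Ln (1 + w * y)) has_field_derivative w) (at 0)"
    by (auto intro!: derivative_eq_intros)
  then have "((\<lambda>h. Ln (1 + w * h) / h) \<longlongrightarrow> w) (at 0)"
    by (simp add: DERIV_def)
  moreover have "filterlim (\<lambda>n. 1 / of_nat n :: complex) (at 0) sequentially"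
    unfolding filterlim_at using lim_1_over_n[where 'a=complex]
    by (auto intro!: eventually_sequentiallyI[of 1])
  ultimately have "(\<lambda>n. Ln (1 + w * (1 / of_nat n)) / (1 / of_nat n)) \<longlonglongrightarrow> w"
    by (rule filterlim_compose)
  then have "(\<lambda>n. exp (of_nat n * Ln (1 + w / of_nat n))) \<longlonglongrightarrow> exp w"
    by (intro tendsto_exp) (simp add: mult.commute)
  moreover have "\<forall>\<^sub>F n in sequentially. exp (of_nat n * Ln (1 + w / of_nat n)) = (1 + w / of_nat n) ^ n"
  proof -
    have "(\<lambda>n. 1 + w / of_nat n) \<longlonglongrightarrow> 1 + 0"
      by (intro tendsto_intros lim_const_over_n)
    then have "\<forall>\<^sub>F n in sequentially. 1 + w / of_nat n \<noteq> 0"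
      using tendsto_imp_eventually_ne[of "\<lambda>n. 1 + w / of_nat n" 1 sequentially 0] by simp
    then show ?thesis by eventually_elim (simp add: exp_of_nat_mult)
  qed
  ultimately show ?thesis by (rule Lim_transform_eventually)
qed

lemma stieltjes_transform_cnj:
  "stieltjes_transform \<sigma> (cnj z) = cnj (stieltjes_transform \<sigma> z)"
  unfolding stieltjes_transform_def using Bochner_Integration.integral_cnj[of \<sigma> "\<lambda>x. 1 / (complex_of_real x - z)"] by simp

lemma (in real_distribution) integrable_resolvent_powers:
  assumes "w \<notin> \<real>" "z \<notin> \<real>"
  shows "integrable M (\<lambda>x. 1 / (complex_of_real x - w) * (1 / (complex_of_real x - z)) ^ n)"
    and "integrable M (\<lambda>x. (1 / (complex_of_real x - z)) ^ n)"
proof -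
  have b: "cmod (1 / (complex_of_real x - w)) \<le> 1 / \<bar>Im w\<bar>" if "w \<notin> \<real>" for x w
    using nonreal_dist_ge[of w x] nonreal_Im[OF that] by (simp add: norm_divide frac_le)
  have p: "cmod ((1 / (complex_of_real x - z)) ^ n) \<le> (1 / \<bar>Im z\<bar>) ^ n" for x
    unfolding norm_power using b[OF assms(2)] by (intro power_mono) auto
  show "integrable M (\<lambda>x. 1 / (complex_of_real x - w) * (1 / (complex_of_real x - z)) ^ n)"
  proof (rule integrable_const_bound)
    show "AE x in M. norm (1 / (complex_of_real x - w) * (1 / (complex_of_real x - z)) ^ n)
        \<le> 1 / \<bar>Im w\<bar> * (1 / \<bar>Im z\<bar>) ^ n"
      unfolding norm_mult by (intro AE_I2 mult_mono b[OF assms(1)] p) auto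
  qed simp
  show "integrable M (\<lambda>x. (1 / (complex_of_real x - z)) ^ n)"
    by (rule integrable_const_bound[of _ "(1 / \<bar>Im z\<bar>) ^ n"]) (use p in auto)
qed

text \<open>The resolvent identity and a limit \<open>w \<rightarrow> z\<close> give the integrals of all powers of resolvents;
  the powers \<open>(1 - itx/n)\<^sup>-\<^sup>n\<close> then approximate the characters.\<close>

lemma stieltjes_transform_inject:
  assumes "real_distribution M" "real_distribution N"
    and eq: "\<And>z. z \<notin> \<real> \<Longrightarrow> stieltjes_transform M z = stieltjes_transform N z"
  shows "M = N"
proof -
  interpret M: real_distribution M by fact
  interpret N: real_distribution N by fact
  let ?f = "\<lambda>z x. 1 / (complex_of_real x - z)"
  \<comment> \<open>One induction carries both claims because each feeds the other: mixed integrals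
    at \<open>n\<close> and the power \<open>Suc n\<close> give the mixed integrals at
    \<open>Suc n\<close>, and these give the next power.\<close>
  have pow: "(\<forall>w. w \<notin> \<real> \<longrightarrow> w \<noteq> z \<longrightarrow> (LINT x|M. ?f w x * ?f z x ^ n) = (LINT x|N. ?f w x * ?f z x ^ n)) \<and>
      (LINT x|M. ?f z x ^ Suc n) = (LINT x|N. ?f z x ^ Suc n)" if z: "z \<notin> \<real>" for z n
  proof (induction n)
    case 0
    then show ?case using eq z by (simp add: stieltjes_transform_def)
  next
    case (Suc n)
    have A: "(LINT x|M. ?f w x * ?f z x ^ Suc n) = (LINT x|N. ?f w x * ?f z x ^ Suc n)"
      if w: "w \<notin> \<real>" "w \<noteq> z" for w
    proof -
      have id: "?f w x * ?f z x ^ Suc n = (?f w x * ?f z x ^ n - ?f z x ^ Suc n) / (w - z)" for x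
      proof -
        have "?f w x * ?f z x = (?f w x - ?f z x) / (w - z)"
          using nonreal_neq[OF w(1), of x] nonreal_neq[OF z, of x] w(2)
          by (simp add: divide_simps)
        then have "?f w x * ?f z x * ?f z x ^ n = (?f w x - ?f z x) / (w - z) * ?f z x ^ n" by simp
        then show ?thesis by (simp add: algebra_simps diff_divide_distrib)
      qed
      show ?thesis unfolding id
        using Suc w M.integrable_resolvent_powers[OF w(1) z] N.integrable_resolvent_powers[OF w(1) z]
        by (simp del: power_Suc add: Bochner_Integration.integral_diff)
    qed
    \<comment> \<open>The horizontal approach keeps \<open>Im (W k) = Im z\<close>, so one constant
      dominates all integrands.\<close>
    define W where "W k = z + complex_of_real (1 / real (Suc k))" for k
    have ImW: "Im (W k) = Im z" and WR: "W k \<notin> \<real>" and Wz: "W k \<noteq> z" for k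
      using nonreal_Im[OF z] by (auto simp: W_def complex_is_Real_iff simp del: of_real_divide)
    have Wlim: "W \<longlonglongrightarrow> z"
    proof -
      have "(\<lambda>k. z + complex_of_real (1 / real (Suc k))) \<longlonglongrightarrow> z + complex_of_real 0"
        by (intro tendsto_intros LIMSEQ_Suc lim_1_over_n)
      then show ?thesis by (simp add: W_def[abs_def])
    qed
    have lim: "(\<lambda>k. LINT x|R. ?f (W k) x * ?f z x ^ Suc n) \<longlonglongrightarrow> (LINT x|R. ?f z x * ?f z x ^ Suc n)"
      if "real_distribution R" for R
    proof -
      interpret R: real_distribution R by fact
      show ?thesis
      proof (rule integral_dominated_convergence[where w="\<lambda>x. (1 / \<bar>Im z\<bar>) * (1 / \<bar>Im z\<bar>) ^ Suc n"])
        show "AE x in R. (\<lambda>k. ?f (W k) x * ?f z x ^ Suc n) \<longlonglongrightarrow> ?f z x * ?f z x ^ Suc n"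
          using nonreal_neq[OF z] by (intro AE_I2 tendsto_intros Wlim) auto
        have "cmod (?f (W k) x) \<le> 1 / \<bar>Im z\<bar>" "cmod (?f z x) \<le> 1 / \<bar>Im z\<bar>" for k x
          using nonreal_dist_ge[of "W k" x] nonreal_dist_ge[of z x] nonreal_Im[OF z]
          by (auto simp: norm_divide frac_le ImW)
        then show "\<And>k. AE x in R. norm (?f (W k) x * ?f z x ^ Suc n) \<le> (1 / \<bar>Im z\<bar>) * (1 / \<bar>Im z\<bar>) ^ Suc n"
          unfolding norm_mult norm_power by (intro AE_I2 mult_mono power_mono) auto
      qed auto
    qed
    have "(LINT x|M. ?f z x * ?f z x ^ Suc n) = (LINT x|N. ?f z x * ?f z x ^ Suc n)"
      using lim[OF assms(1)] lim[OF assms(2)] A[OF WR Wz] by (simp only:) (rule LIMSEQ_unique)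
    then show ?case using A by simp
  qed
  have char_eq: "char M t = char N t" for t
  proof (cases "t = 0")
    case True
    then show ?thesis by (simp add: char_def M.prob_space[simplified] N.prob_space[simplified])
  next
    case False
    let ?g = "\<lambda>n x. inverse ((1 + (- \<i> * of_real (t * x)) / of_nat n) ^ n)"
    \<comment> \<open>As a function of \<open>x\<close>, \<open>1 - \<i> t x / n\<close> vanishes at
      \<open>- \<i> n / t\<close>. This point is nonreal only for \<open>n > 0\<close>, hence the
      index \<open>Suc n\<close>.\<close>
    have g_eq: "?g (Suc n) x = (\<i> * of_nat (Suc n) / of_real t) ^ Suc n * ?f (- \<i> * of_nat (Suc n) / of_real t) x ^ Suc n"
      for n x
    proof -
      have "1 + (- \<i> * of_real (t * x)) / of_nat (Suc n)
          = (- \<i> * of_real t / of_nat (Suc n)) * (of_real x - (- \<i> * of_nat (Suc n) / of_real t))"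
        using False by (simp add: field_simps del: of_nat_Suc)
      then have "inverse (1 + (- \<i> * of_real (t * x)) / of_nat (Suc n))
          = inverse (- \<i> * of_real t / of_nat (Suc n)) * (1 / (of_real x - (- \<i> * of_nat (Suc n) / of_real t)))"
        by (simp only: inverse_mult_distrib divide_inverse mult_1_left)
      moreover have "inverse (- \<i> * of_real t / of_nat (Suc n)) = \<i> * of_nat (Suc n) / of_real t"
        using False by (simp add: divide_simps del: of_nat_Suc)
      ultimately show ?thesis
        by (simp only: power_mult_distrib power_inverse[symmetric])
    qed
    have nr: "- \<i> * of_nat (Suc n) / of_real t \<notin> \<real>" for n
      using False by (simp add: complex_is_Real_iff Im_divide_of_real del: of_nat_Suc)
    have eqn: "(LINT x|M. ?g (Suc n) x) = (LINT x|N. ?g (Suc n) x)" for n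
      unfolding g_eq integral_mult_right_zero using pow[OF nr[of n], of n, THEN conjunct2] by (simp only:)
    have lim: "(\<lambda>n. LINT x|R. ?g (Suc n) x) \<longlonglongrightarrow> char R t" if "real_distribution R" for R
    proof -
      interpret R: real_distribution R by fact
      \<comment> \<open>The real part is \<open>1\<close>, so all approximants of the character are
        bounded by \<open>1\<close>.\<close>
      have one: "1 \<le> cmod (1 + (- \<i> * of_real (t * x)) / of_nat n)" for n x
        using abs_Re_le_cmod[of "1 + (- \<i> * of_real (t * x)) / of_nat n"] by (cases n) (auto simp: Re_divide_of_nat simp del: of_nat_Suc)
      show ?thesis unfolding char_def
      proof (rule integral_dominated_convergence[where w="\<lambda>x. 1"])
        have "(\<lambda>n. ?g n x) \<longlonglongrightarrow> inverse (exp (- \<i> * of_real (t * x)))" for x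
          by (intro tendsto_inverse tendsto_exp_limit_complex) simp
        then have "(\<lambda>n. ?g n x) \<longlonglongrightarrow> iexp (t * x)" for x
          by (simp add: exp_minus)
        then show "AE x in R. (\<lambda>n. ?g (Suc n) x) \<longlonglongrightarrow> iexp (t * x)"
          by (intro AE_I2 LIMSEQ_Suc)
        show "AE x in R. norm (?g (Suc n) x) \<le> 1" for n
          unfolding norm_inverse norm_power using one[of _ "Suc n"]
          by (intro AE_I2 inverse_le_1_iff[THEN iffD2] disjI2 one_le_power)
      qed auto
    qed
    show ?thesis using lim[OF assms(1)] lim[OF assms(2)] unfolding eqn by (rule LIMSEQ_unique)
  qed
  then show ?thesis by (intro Levy_uniqueness assms(1,2) ext)
qed

section \<open>The two extremal problems and the sufficient condition for determinacy\<close>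

definition resolvent_approx :: "real measure \<Rightarrow> complex \<Rightarrow> bool" where
  "resolvent_approx \<mu> z \<longleftrightarrow> (\<forall>e>0. \<exists>p.
     (LINT x|\<mu>. (cmod (1 / (complex_of_real x - z) - poly p (complex_of_real x)))\<^sup>2) < e)"

text \<open>The infimum of these integrals is the Christoffel function at \<open>z\<close>, the
  reciprocal of the sum of the squared moduli of the orthonormal polynomials at
  \<open>z\<close>.\<close>

definition christoffel_zero :: "real measure \<Rightarrow> complex \<Rightarrow> bool" where
  "christoffel_zero \<mu> z \<longleftrightarrow> (\<forall>e>0. \<exists>r. poly r z = 1 \<and>
     (LINT x|\<mu>. (cmod (poly r (complex_of_real x)))\<^sup>2) < e)"

lemma (in mstar) L_altdef: "L p = (\<Sum>i\<le>degree p. coeff p i * complex_of_real (moment \<mu> i))"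
proof -
  have "complex_of_real (moment \<mu> i) = (LINT x|\<mu>. complex_of_real x ^ i)" for i
    unfolding moment_def by (subst integral_complex_of_real[symmetric]) simp
  moreover have "integrable \<mu> (\<lambda>x. complex_of_real x ^ i)" for i
    using integrable_of_real[OF integrable_power, of i, where 'a=complex] by simp
  ultimately show ?thesis
    unfolding L_def poly_altdef by (subst Bochner_Integration.integral_sum) auto
qed

lemma L_cong_moments:
  assumes "\<mu> \<in> Mstar" "\<nu> \<in> Mstar" "\<And>n. moment \<mu> n = moment \<nu> n"
  shows "mstar.L \<mu> p = mstar.L \<nu> p"
  using assms by (simp add: mstar.L_altdef mstar_def)

lemma (in mstar) cmod_poly_resolvent_le:
  assumes "z \<notin> \<real>"
  shows "(cmod (LINT x|\<mu>. poly r (complex_of_real x) / (complex_of_real x - z)))\<^sup>2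
    \<le> (LINT x|\<mu>. (cmod (poly r (complex_of_real x)))\<^sup>2) * (LINT x|\<mu>. (cmod (1 / (complex_of_real x - z)))\<^sup>2)"
  using Cauchy_Schwarz_LINT(2)[of "\<lambda>x. poly r (complex_of_real x)" \<mu> "\<lambda>x. 1 / (complex_of_real x - z)"]
    integrable_cmod2[of r] integrable_cmod2_resolvent[OF assms] by simp

text \<open>\<open>stieltjes_split\<close> is applied to both measures with the same
  \<open>r\<close>. The parts in \<open>L\<close> cancel, and the square norm of \<open>r\<close> is
  a function of the moments, so both remainders are small together.\<close>

lemma stieltjes_eq_if_christoffel_zero:
  assumes \<mu>: "\<mu> \<in> Mstar" and \<nu>: "\<nu> \<in> Mstar" and mom: "\<And>n. moment \<nu> n = moment \<mu> n"
    and z: "z \<notin> \<real>" and c: "christoffel_zero \<mu> z"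
  shows "stieltjes_transform \<nu> z = stieltjes_transform \<mu> z"
proof -
  interpret M: mstar \<mu> by standard fact
  interpret N: mstar \<nu> by standard fact
  define X where "X = (LINT x|\<mu>. (cmod (1 / (complex_of_real x - z)))\<^sup>2)"
  define Y where "Y = (LINT x|\<nu>. (cmod (1 / (complex_of_real x - z)))\<^sup>2)"
  have XY: "0 \<le> X" "0 \<le> Y" by (auto simp: X_def Y_def intro!: integral_nonneg_AE)
  have le: "cmod (stieltjes_transform \<nu> z - stieltjes_transform \<mu> z) \<le> sqrt (e * X) + sqrt (e * Y)" if "e > 0" for e
  proof -
    obtain r where r: "poly r z = 1" "(LINT x|\<mu>. (cmod (poly r (complex_of_real x)))\<^sup>2) < e"
      using c \<open>e > 0\<close> unfolding christoffel_zero_def by blast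
    have "M.L p = N.L p" for p using L_cong_moments[OF \<mu> \<nu>] mom by simp
    then have eq: "(LINT x|\<nu>. (cmod (poly r (complex_of_real x)))\<^sup>2) = (LINT x|\<mu>. (cmod (poly r (complex_of_real x)))\<^sup>2)"
      using M.L_mult_cnj[of r] N.L_mult_cnj[of r] by simp
    have "stieltjes_transform \<nu> z - stieltjes_transform \<mu> z
      = (LINT x|\<nu>. poly r (complex_of_real x) / (complex_of_real x - z))
        - (LINT x|\<mu>. poly r (complex_of_real x) / (complex_of_real x - z))"
      unfolding M.stieltjes_split[OF z r(1)] N.stieltjes_split[OF z r(1)]
      using \<open>\<And>p. M.L p = N.L p\<close> by simp
    moreover have "cmod (LINT x|\<mu>. poly r (complex_of_real x) / (complex_of_real x - z)) \<le> sqrt (e * X)"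
      using M.cmod_poly_resolvent_le[OF z, of r] r(2) XY
      by (intro real_le_rsqrt order.trans[OF M.cmod_poly_resolvent_le[OF z, of r]])
        (auto simp: X_def intro!: mult_right_mono)
    moreover have "cmod (LINT x|\<nu>. poly r (complex_of_real x) / (complex_of_real x - z)) \<le> sqrt (e * Y)"
      using r(2) XY eq
      by (intro real_le_rsqrt order.trans[OF N.cmod_poly_resolvent_le[OF z, of r]])
        (auto simp: Y_def intro!: mult_right_mono)
    ultimately show ?thesis
      using norm_triangle_ineq4[of "LINT x|\<nu>. poly r (complex_of_real x) / (complex_of_real x - z)"
          "LINT x|\<mu>. poly r (complex_of_real x) / (complex_of_real x - z)"] by simp
  qed
  have "((\<lambda>e. sqrt (e * X) + sqrt (e * Y)) \<longlongrightarrow> sqrt (0 * X) + sqrt (0 * Y)) (at_right 0)"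
    by (intro tendsto_intros)
  then have "cmod (stieltjes_transform \<nu> z - stieltjes_transform \<mu> z) \<le> 0"
    using le by (intro tendsto_lowerbound[where F="at_right (0::real)" and f="\<lambda>e. sqrt (e * X) + sqrt (e * Y)"])
      (auto simp: eventually_at_right_less eventually_at_filter)
  then show ?thesis by simp
qed

section \<open>Scaling to total mass one\<close>

lemma (in mstar) mass_pos: "0 < measure \<mu> UNIV"
proof (rule ccontr)
  assume "\<not> 0 < measure \<mu> UNIV"
  then have "measure \<mu> UNIV = 0" using measure_nonneg[of \<mu> UNIV] by linarith
  then have "(LINT x|\<mu>. (cmod (poly 1 (complex_of_real x)))\<^sup>2) = 0" by simp
  from cmod2_poly_eq_0[OF this] show False by simp
qed

text \<open>The extended quotient is a real number because the mass is positive and finite; as a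
  density the scaling falls under the usual integral rules.\<close>

lemma normalize_mass_density:
  assumes "\<mu> \<in> Mstar"
  shows "normalize_mass \<mu> = density \<mu> (\<lambda>_. ennreal (1 / measure \<mu> UNIV))"
proof -
  interpret mstar \<mu> by standard fact
  have "1 / emeasure \<mu> UNIV = ennreal (1 / measure \<mu> UNIV)"
    using mass_pos emeasure_eq_measure[of UNIV] divide_ennreal[of 1 "measure \<mu> UNIV"] by simp
  then show ?thesis unfolding normalize_mass_def
    by (intro measure_eqI) (auto simp: emeasure_density_const)
qed

text \<open>For nonmeasurable \<open>f\<close> both integrals have the default value
  \<open>0\<close>, so no measurability has to be checked where this is used.\<close>

lemma integral_density_const:
  fixes f :: "real \<Rightarrow> 'b::{banach, second_countable_topology}"
  assumes "c > 0"
  shows "(LINT x|density \<mu> (\<lambda>_. ennreal c). f x) = c *\<^sub>R (LINT x|\<mu>. f x)"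
proof (cases "f \<in> borel_measurable \<mu>")
  case True
  then show ?thesis using assms by (simp add: integral_density)
next
  case False
  then have "\<not> integrable \<mu> f" "\<not> integrable (density \<mu> (\<lambda>_. ennreal c)) f"
    by auto
  then show ?thesis by (simp add: not_integrable_integral_eq)
qed

lemma density_const_Mstar:
  assumes "\<mu> \<in> Mstar" "c > 0"
  shows "density \<mu> (\<lambda>_. ennreal c) \<in> Mstar"
proof -
  interpret mstar \<mu> by standard fact
  have "measure_support (density \<mu> (\<lambda>_. ennreal c)) = measure_support \<mu>"
    using \<open>c > 0\<close> by (auto simp: measure_support_def emeasure_density_const ennreal_zero_less_mult_iff sets_mu)
  then show ?thesis
    using Mstar \<open>c > 0\<close> by (auto simp: Mstar_def integrable_density)
qed

lemma moment_density_const: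
  "c > 0 \<Longrightarrow> moment (density \<mu> (\<lambda>_. ennreal c)) n = c * moment \<mu> n"
  by (simp add: moment_def integral_density_const)

lemma resolvent_approx_density_const:
  assumes "c > 0"
  shows "resolvent_approx (density \<mu> (\<lambda>_. ennreal c)) z \<longleftrightarrow> resolvent_approx \<mu> z"
proof -
  have 1: "(\<forall>e>0. \<exists>p. I p < e) \<longleftrightarrow> (\<forall>e>0. \<exists>p. c * I p < e)" for I :: "complex poly \<Rightarrow> real"
  proof safe
    fix e :: real assume "\<forall>e>0. \<exists>p. I p < e" "e > 0"
    then obtain p where "I p < e / c" using assms by (meson divide_pos_pos)
    then show "\<exists>p. c * I p < e" using assms by (auto simp: field_simps)
  next
    fix e :: real assume "\<forall>e>0. \<exists>p. c * I p < e" "e > 0"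
    then obtain p where "c * I p < c * e" using assms by (meson mult_pos_pos)
    then show "\<exists>p. I p < e" using assms by auto
  qed
  show ?thesis
    unfolding resolvent_approx_def integral_density_const[OF assms] real_scaleR_def
    using 1 by simp
qed

lemma christoffel_zero_density_const:
  assumes "c > 0"
  shows "christoffel_zero (density \<mu> (\<lambda>_. ennreal c)) z \<longleftrightarrow> christoffel_zero \<mu> z"
proof -
  have 1: "(\<forall>e>0. \<exists>p. Q p \<and> I p < e) \<longleftrightarrow> (\<forall>e>0. \<exists>p. Q p \<and> c * I p < e)"
    for I :: "complex poly \<Rightarrow> real" and Q
  proof safe
    fix e :: real assume "\<forall>e>0. \<exists>p. Q p \<and> I p < e" "e > 0"
    then obtain p where "Q p" "I p < e / c" using assms by (meson divide_pos_pos)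
    then show "\<exists>p. Q p \<and> c * I p < e" using assms by (auto simp: field_simps)
  next
    fix e :: real assume "\<forall>e>0. \<exists>p. Q p \<and> c * I p < e" "e > 0"
    then obtain p where "Q p" "c * I p < c * e" using assms by (meson mult_pos_pos)
    then show "\<exists>p. Q p \<and> I p < e" using assms by auto
  qed
  show ?thesis
    unfolding christoffel_zero_def integral_density_const[OF assms] real_scaleR_def
    using 1 by simp
qed

lemma density_const_inject:
  assumes "c > 0" "density \<mu> (\<lambda>_. ennreal c) = density \<nu> (\<lambda>_. ennreal c)"
  shows "\<mu> = \<nu>"
proof (rule measure_eqI)
  show "sets \<mu> = sets \<nu>" using arg_cong[OF assms(2), of sets] by simp
  fix A assume A: "A \<in> sets \<mu>"
  then have "ennreal c * emeasure \<mu> A = ennreal c * emeasure \<nu> A"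
    using arg_cong[OF assms(2), of "\<lambda>M. emeasure M A"] \<open>sets \<mu> = sets \<nu>\<close>
    by (simp add: emeasure_density_const)
  then show "emeasure \<mu> A = emeasure \<nu> A"
    using \<open>c > 0\<close> by (simp add: ennreal_mult_cancel_left)
qed

text \<open>Equal zeroth moments let one constant \<open>c\<close> turn both measures into
  probability measures, to which \<open>stieltjes_transform_inject\<close> applies.\<close>

lemma stieltjes_transform_inject_Mstar:
  assumes \<mu>: "\<mu> \<in> Mstar" and \<nu>: "\<nu> \<in> Mstar" and mom: "moment \<nu> 0 = moment \<mu> 0"
    and eq: "\<And>z. z \<notin> \<real> \<Longrightarrow> stieltjes_transform \<nu> z = stieltjes_transform \<mu> z"
  shows "\<nu> = \<mu>"
proof -
  interpret M: mstar \<mu> by standard fact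
  interpret N: mstar \<nu> by standard fact
  have mass: "measure \<nu> UNIV = measure \<mu> UNIV" using mom by (simp add: moment_def)
  define c where "c = 1 / measure \<mu> UNIV"
  have c: "c > 0" using M.mass_pos by (simp add: c_def)
  have rd: "real_distribution (density \<rho> (\<lambda>_. ennreal c))"
    if "mstar \<rho>" "measure \<rho> UNIV = measure \<mu> UNIV" for \<rho>
  proof -
    interpret R: mstar \<rho> by fact
    have "emeasure (density \<rho> (\<lambda>_. ennreal c)) UNIV = 1"
      using that(2) c M.mass_pos R.emeasure_eq_measure[of UNIV]
      by (simp add: emeasure_density_const R.sets_mu ennreal_mult[symmetric] c_def)
    then show ?thesis
      by (auto simp: real_distribution_def real_distribution_axioms_def R.sets_mu intro!: prob_spaceI)
  qed
  have "density \<nu> (\<lambda>_. ennreal c) = density \<mu> (\<lambda>_. ennreal c)"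
  proof (rule stieltjes_transform_inject)
    fix z :: complex assume "z \<notin> \<real>"
    then show "stieltjes_transform (density \<nu> (\<lambda>_. ennreal c)) z = stieltjes_transform (density \<mu> (\<lambda>_. ennreal c)) z"
      using eq[of z] by (simp add: stieltjes_transform_def integral_density_const[OF c])
  qed (use mass rd M.mstar_axioms N.mstar_axioms in auto)
  then show ?thesis using density_const_inject[OF c] by blast
qed

theorem determinate_if_christoffel_zero:
  assumes "\<mu> \<in> Mstar" "\<And>z. z \<notin> \<real> \<Longrightarrow> christoffel_zero \<mu> z"
  shows "\<mu> \<in> Mstar_d"
  unfolding Mstar_d_def
  using assms stieltjes_transform_inject_Mstar[of \<mu>] stieltjes_eq_if_christoffel_zero[of \<mu>] by blast

section \<open>Measures with a power weight\<close>

lemma sets_weighted [simp]: "sets (weighted r \<mu>) = sets \<mu>"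
  by (simp add: weighted_def)

context mstar
begin

lemma measurable_weight [measurable]: "(\<lambda>x. (1 + x\<^sup>2) powr r) \<in> borel_measurable \<mu>"
  by measurable

lemma weight_pos: "0 < (1 + x\<^sup>2) powr r" for x :: real
  using zero_le_power2[of x] by (smt (verit) powr_gt_zero)

lemma integral_weighted:
  fixes h :: "real \<Rightarrow> real"
  assumes [measurable]: "h \<in> borel_measurable \<mu>"
  shows "(LINT x|weighted r \<mu>. h x) = (LINT x|\<mu>. (1 + x\<^sup>2) powr r * h x)"
  unfolding weighted_def by (subst integral_density) (auto simp: less_imp_le[OF weight_pos])

lemma integrable_weighted_iff:
  fixes h :: "real \<Rightarrow> real"
  assumes [measurable]: "h \<in> borel_measurable \<mu>"
  shows "integrable (weighted r \<mu>) h \<longleftrightarrow> integrable \<mu> (\<lambda>x. (1 + x\<^sup>2) powr r * h x)"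
  unfolding weighted_def by (subst integrable_density) (auto simp: less_imp_le[OF weight_pos])

lemma weighted_Mstar: "weighted r \<mu> \<in> Mstar"
proof -
  have "emeasure (weighted r \<mu>) U = 0 \<longleftrightarrow> emeasure \<mu> U = 0" if "open U" for U
  proof -
    have U: "U \<in> sets \<mu>" using that by (simp add: sets_mu)
    have "U \<in> null_sets (weighted r \<mu>) \<longleftrightarrow> U \<in> null_sets \<mu>"
      unfolding weighted_def using U weight_pos AE_iff_null_sets[OF U]
      by (subst null_sets_density_iff) auto
    then show ?thesis using U by (auto simp: null_sets_def)
  qed
  then have "measure_support (weighted r \<mu>) = measure_support \<mu>"
    by (auto simp: measure_support_def zero_less_iff_neq_zero)
  moreover have "integrable (weighted r \<mu>) (\<lambda>x. x ^ n)" for n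
  proof -
    \<comment> \<open>For negative \<open>r\<close> this is \<open>0\<close>, and the weight is then
      bounded by \<open>1\<close>.\<close>
    define k where "k = nat \<lceil>r\<rceil>"
    have k: "r \<le> real k" unfolding k_def by linarith
    define p :: "complex poly" where "p = [:1, 0, 1:] ^ k * [:0, 1:] ^ n"
    have p: "cmod (poly p (complex_of_real x)) = (1 + x\<^sup>2) ^ k * \<bar>x\<bar> ^ n" for x
    proof -
      have "poly [:1, 0, 1:] (complex_of_real x) = complex_of_real (1 + x\<^sup>2)"
        by (simp add: power2_eq_square)
      then show ?thesis
        by (simp only: p_def poly_mult poly_power norm_mult norm_power norm_of_real) simp
    qed
    have "integrable \<mu> (\<lambda>x. (1 + x\<^sup>2) powr r * x ^ n)"
    proof (rule Bochner_Integration.integrable_bound)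
      show "integrable \<mu> (\<lambda>x. cmod (poly p (complex_of_real x)))"
        by (intro integrable_norm integrable_poly)
      have "(1 + x\<^sup>2) powr r \<le> (1 + x\<^sup>2) ^ k" for x
        using powr_mono[OF k, of "1 + x\<^sup>2"] powr_realpow[of "1 + x\<^sup>2" k] by (simp add: add_pos_nonneg)
      then show "AE x in \<mu>. norm ((1 + x\<^sup>2) powr r * x ^ n) \<le> norm (cmod (poly p (complex_of_real x)))"
        unfolding p by (auto simp: abs_mult power_abs intro!: mult_right_mono)
    qed measurable
    then show ?thesis by (subst integrable_weighted_iff) auto
  qed
  ultimately show ?thesis using Mstar by (auto simp: Mstar_def)
qed

lemma weighted_weighted: "weighted r (weighted s \<mu>) = weighted (r + s) \<mu>"
proof -
  have "ennreal ((1 + x\<^sup>2) powr s) * ennreal ((1 + x\<^sup>2) powr r) = ennreal ((1 + x\<^sup>2) powr (r + s))" for x :: real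
    by (simp add: ennreal_mult[symmetric] powr_add mult.commute)
  then show ?thesis
    unfolding weighted_def by (subst density_density_eq) auto
qed

lemma weighted_0: "weighted 0 \<mu> = \<mu>"
proof -
  \<comment> \<open>\<open>0 powr 0\<close> is \<open>0\<close>, so the base has to be
    nonzero.\<close>
  have "1 + x\<^sup>2 \<noteq> 0" for x :: real using zero_le_power2[of x] by linarith
  then show ?thesis by (simp add: weighted_def density_1)
qed

lemma integral_weighted_le:
  fixes h :: "real \<Rightarrow> real"
  assumes "integrable \<mu> h" "\<And>x. 0 \<le> h x" "\<delta> \<ge> 0"
  shows "(LINT x|weighted (- \<delta>) \<mu>. h x) \<le> (LINT x|\<mu>. h x)"
proof -
  have [measurable]: "h \<in> borel_measurable \<mu>" using assms(1) by auto
  have le: "(1 + x\<^sup>2) powr (- \<delta>) * h x \<le> h x" for x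
  proof -
    have "(1 + x\<^sup>2) powr (- \<delta>) \<le> (1 + x\<^sup>2) powr 0" using assms(3) by (intro powr_mono) auto
    also have "\<dots> \<le> 1" by simp
    finally show ?thesis
      using assms(2)[of x] weight_pos[of x "- \<delta>"] by (intro mult_left_le_one_le) auto
  qed
  have "integrable \<mu> (\<lambda>x. (1 + x\<^sup>2) powr (- \<delta>) * h x)"
    by (rule Bochner_Integration.integrable_bound[OF assms(1)])
      (use le assms(2) weight_pos in \<open>auto simp: abs_mult\<close>)
  then show ?thesis
    unfolding integral_weighted[OF \<open>h \<in> borel_measurable \<mu>\<close>] using assms(1) le by (intro integral_mono) auto
qed

lemma christoffel_zero_weighted:
  assumes "christoffel_zero \<mu> z" "\<delta> \<ge> 0"
  shows "christoffel_zero (weighted (- \<delta>) \<mu>) z"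
  using assms integral_weighted_le[OF integrable_cmod2 _ assms(2)]
  unfolding christoffel_zero_def by (meson order.strict_trans1 zero_le_power2)

lemma resolvent_approx_weighted:
  assumes "resolvent_approx \<mu> z" "\<delta> \<ge> 0" "z \<notin> \<real>"
  shows "resolvent_approx (weighted (- \<delta>) \<mu>) z"
  using assms integral_weighted_le[OF integrable_cmod2_resolvent_minus_poly[OF assms(3)] _ assms(2)]
  unfolding resolvent_approx_def by (meson order.strict_trans1 zero_le_power2)

text \<open>The integrands differ by the factor \<open>(1 + x^2) / |x - z|^2\<close>, which lies
  between \<open>1 / K\<close> and \<open>K'\<close>. The substitution \<open>?r\<close> is inverted
  by \<open>- synthetic_div r z\<close>.\<close>

lemma resolvent_approx_iff_christoffel_zero:
  assumes z: "z \<notin> \<real>"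
  shows "resolvent_approx (weighted 1 \<mu>) z \<longleftrightarrow> christoffel_zero \<mu> z"
proof -
  interpret W: mstar "weighted 1 \<mu>" using weighted_Mstar by unfold_locales
  let ?I = "\<lambda>p. LINT x|weighted 1 \<mu>. (cmod (1 / (complex_of_real x - z) - poly p (complex_of_real x)))\<^sup>2"
  let ?J = "\<lambda>r. LINT x|\<mu>. (cmod (poly r (complex_of_real x)))\<^sup>2"
  let ?r = "\<lambda>p. 1 - [:- z, 1:] * p"
  have pos: "0 < 1 + x\<^sup>2" for x :: real using zero_le_power2[of x] by linarith
  have powr1: "(1 + x\<^sup>2) powr 1 = 1 + x\<^sup>2" for x :: real using pos[of x] by simp
  have int: "integrable \<mu> (\<lambda>x. (1 + x\<^sup>2) * (cmod (poly (?r p) (complex_of_real x) / (complex_of_real x - z)))\<^sup>2)" for p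
    using W.integrable_cmod2_poly_resolvent[OF z, of "?r p"]
    by (subst (asm) integrable_weighted_iff) (auto simp: powr1 simp del: poly_diff poly_mult)
  have I: "?I p = (LINT x|\<mu>. (1 + x\<^sup>2) * (cmod (poly (?r p) (complex_of_real x) / (complex_of_real x - z)))\<^sup>2)" for p
    unfolding resolvent_minus_poly[OF z]
    by (subst integral_weighted) (auto simp: powr1 simp del: poly_diff poly_mult)
  define K where "K = 2 * (1 + (cmod z)\<^sup>2)"
  have K: "K > 0" by (simp add: K_def add_pos_nonneg)
  \<comment> \<open>The \<open>2\<close> comes from \<open>x^2 \<le> 2 |x - z|^2 + 2 |z|^2\<close>;
    the quotient absorbs the rest, \<open>1 + 2 |z|^2\<close>, through
    \<open>|x - z| \<ge> |Im z|\<close>.\<close>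
  define K' where "K' = 2 + (1 + 2 * (cmod z)\<^sup>2) / (Im z)\<^sup>2"
  have K': "K' > 0" unfolding K'_def by (intro add_pos_nonneg divide_nonneg_nonneg) auto
  have sq: "(a + b)\<^sup>2 \<le> 2 * a\<^sup>2 + 2 * b\<^sup>2" for a b :: real
    using zero_le_power2[of "a - b"] by (simp add: power2_eq_square algebra_simps)
  have d1: "(cmod (complex_of_real x - z))\<^sup>2 \<le> K * (1 + x\<^sup>2)" for x
  proof -
    have "(cmod (complex_of_real x - z))\<^sup>2 \<le> (\<bar>x\<bar> + cmod z)\<^sup>2"
      using norm_triangle_ineq4[of "complex_of_real x" z] by (intro power_mono) auto
    also have "\<dots> \<le> 2 * x\<^sup>2 + 2 * (cmod z)\<^sup>2" using sq[of "\<bar>x\<bar>" "cmod z"] by simp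
    also have "\<dots> \<le> K * (1 + x\<^sup>2)" by (simp add: K_def algebra_simps)
    finally show ?thesis .
  qed
  have d2: "1 + x\<^sup>2 \<le> K' * (cmod (complex_of_real x - z))\<^sup>2" for x
  proof -
    have "\<bar>x\<bar> \<le> cmod (complex_of_real x - z) + cmod z"
      using norm_triangle_ineq[of "complex_of_real x - z" z] by simp
    then have "\<bar>x\<bar>\<^sup>2 \<le> (cmod (complex_of_real x - z) + cmod z)\<^sup>2" by (intro power_mono) auto
    then have "x\<^sup>2 \<le> 2 * (cmod (complex_of_real x - z))\<^sup>2 + 2 * (cmod z)\<^sup>2"
      using sq[of "cmod (complex_of_real x - z)" "cmod z"] by simp
    moreover have "1 + 2 * (cmod z)\<^sup>2 \<le> (1 + 2 * (cmod z)\<^sup>2) / (Im z)\<^sup>2 * (cmod (complex_of_real x - z))\<^sup>2"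
    proof -
      have "\<bar>Im z\<bar>\<^sup>2 \<le> (cmod (complex_of_real x - z))\<^sup>2" by (intro power_mono nonreal_dist_ge) auto
      then have "(Im z)\<^sup>2 * (1 + 2 * (cmod z)\<^sup>2) \<le> (cmod (complex_of_real x - z))\<^sup>2 * (1 + 2 * (cmod z)\<^sup>2)"
        by (intro mult_right_mono) auto
      then show ?thesis using nonreal_Im[OF z] by (simp add: field_simps)
    qed
    ultimately show ?thesis by (simp add: K'_def distrib_right)
  qed
  have J_le: "?J (?r p) \<le> K * ?I p" for p
  proof -
    have "?J (?r p) \<le> (LINT x|\<mu>. K * ((1 + x\<^sup>2) * (cmod (poly (?r p) (complex_of_real x) / (complex_of_real x - z)))\<^sup>2))"
    proof (rule integral_mono)
      show "integrable \<mu> (\<lambda>x. (cmod (poly (?r p) (complex_of_real x)))\<^sup>2)" by (rule integrable_cmod2)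
      show "integrable \<mu> (\<lambda>x. K * ((1 + x\<^sup>2) * (cmod (poly (?r p) (complex_of_real x) / (complex_of_real x - z)))\<^sup>2))"
        using int by (rule integrable_mult_right)
      fix x
      let ?d = "(cmod (complex_of_real x - z))\<^sup>2" and ?q = "(cmod (poly (?r p) (complex_of_real x)))\<^sup>2"
      have "?q * ?d \<le> ?q * (K * (1 + x\<^sup>2))" by (intro mult_left_mono d1) auto
      moreover have "0 < ?d" using nonreal_neq[OF z, of x] by simp
      ultimately show "?q \<le> K * ((1 + x\<^sup>2) * (cmod (poly (?r p) (complex_of_real x) / (complex_of_real x - z)))\<^sup>2)"
        unfolding norm_divide power_divide by (simp add: field_simps del: poly_diff poly_mult)
    qed
    then show ?thesis unfolding I by simp
  qed
  have I_le: "?I p \<le> K' * ?J (?r p)" for p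
  proof -
    have "?I p \<le> (LINT x|\<mu>. K' * (cmod (poly (?r p) (complex_of_real x)))\<^sup>2)"
      unfolding I
    proof (rule integral_mono)
      show "integrable \<mu> (\<lambda>x. K' * (cmod (poly (?r p) (complex_of_real x)))\<^sup>2)"
        using integrable_cmod2 by (rule integrable_mult_right)
      show "integrable \<mu> (\<lambda>x. (1 + x\<^sup>2) * (cmod (poly (?r p) (complex_of_real x) / (complex_of_real x - z)))\<^sup>2)"
        by (rule int)
      fix x
      let ?d = "(cmod (complex_of_real x - z))\<^sup>2" and ?q = "(cmod (poly (?r p) (complex_of_real x)))\<^sup>2"
      have "?q * (1 + x\<^sup>2) \<le> ?q * (K' * ?d)" by (intro mult_left_mono d2) auto
      moreover have "0 < ?d" using nonreal_neq[OF z, of x] by simp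
      ultimately show "(1 + x\<^sup>2) * (cmod (poly (?r p) (complex_of_real x) / (complex_of_real x - z)))\<^sup>2 \<le> K' * ?q"
        unfolding norm_divide power_divide by (simp add: field_simps del: poly_diff poly_mult)
    qed
    then show ?thesis by simp
  qed
  show ?thesis
  proof
    assume a: "resolvent_approx (weighted 1 \<mu>) z"
    show "christoffel_zero \<mu> z"
      unfolding christoffel_zero_def
    proof (intro allI impI)
      fix e :: real assume "e > 0"
      then obtain p where "?I p < e / K" using a K unfolding resolvent_approx_def by (meson divide_pos_pos)
      then have "K * ?I p < e" using K by (simp add: field_simps)
      then have "?J (?r p) < e" using J_le[of p] by (rule le_less_trans[rotated])
      moreover have "poly (?r p) z = 1" by simp
      ultimately show "\<exists>r. poly r z = 1 \<and> ?J r < e" by blast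
    qed
  next
    assume a: "christoffel_zero \<mu> z"
    show "resolvent_approx (weighted 1 \<mu>) z"
      unfolding resolvent_approx_def
    proof (intro allI impI)
      fix e :: real assume "e > 0"
      then obtain r where r: "poly r z = 1" "?J r < e / K'"
        using a K' unfolding christoffel_zero_def by (meson divide_pos_pos)
      have "?r (- synthetic_div r z) = r"
        using synthetic_div_correct'[of z r] r(1)
        by (simp only: mult_minus_right diff_minus_eq_add one_pCons add.commute[of "[:1:]"])
      then have "?I (- synthetic_div r z) \<le> K' * ?J r" using I_le[of "- synthetic_div r z"] by simp
      moreover have "K' * ?J r < e" using r(2) K' by (simp add: field_simps)
      ultimately have "?I (- synthetic_div r z) < e" by (rule le_less_trans)
      then show "\<exists>p. ?I p < e" by blast
    qed
  qed
qed

end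

section \<open>Orthonormal polynomials\<close>

lemma synthetic_div_unique':
  fixes p :: "'a::comm_ring_1 poly"
  assumes "p = [:- c, 1:] * q + [:r:]"
  shows "synthetic_div p c = q"
proof -
  have "p + smult c q = pCons r q" using assms by (simp add: algebra_simps)
  from synthetic_div_unique[OF this] show ?thesis by simp
qed

lemma synthetic_div_add:
  fixes p q :: "'a::comm_ring_1 poly"
  shows "synthetic_div (p + q) c = synthetic_div p c + synthetic_div q c"
proof (rule synthetic_div_unique'[where r = "poly p c + poly q c"])
  have "p + q = ([:- c, 1:] * synthetic_div p c + [:poly p c:]) + ([:- c, 1:] * synthetic_div q c + [:poly q c:])"
    unfolding synthetic_div_correct' ..
  also have "\<dots> = [:- c, 1:] * (synthetic_div p c + synthetic_div q c) + ([:poly p c:] + [:poly q c:])"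
    by (simp only: distrib_left ac_simps)
  finally show "p + q = [:- c, 1:] * (synthetic_div p c + synthetic_div q c) + [:poly p c + poly q c:]"
    by (simp only: add_pCons add_0_left)
qed

lemma synthetic_div_smult:
  fixes p :: "'a::comm_ring_1 poly"
  shows "synthetic_div (smult a p) c = smult a (synthetic_div p c)"
proof (rule synthetic_div_unique'[where r = "a * poly p c"])
  have "smult a p = smult a ([:- c, 1:] * synthetic_div p c + [:poly p c:])"
    unfolding synthetic_div_correct' ..
  then show "smult a p = [:- c, 1:] * smult a (synthetic_div p c) + [:a * poly p c:]"
    by (simp only: smult_add_right mult_smult_right smult_pCons smult_0_right)
qed

lemma synthetic_div_sum:
  fixes f :: "'b \<Rightarrow> 'a::comm_ring_1 poly"
  shows "synthetic_div (sum f A) c = (\<Sum>i\<in>A. synthetic_div (f i) c)"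
  by (induction A rule: infinite_finite_induct) (auto simp: synthetic_div_add)

text \<open>From \<open>X - a = (X - c) + (c - a)\<close>. It moves a quotient from the base point
  \<open>a\<close> to \<open>c\<close>; with \<open>a = 0\<close> it handles multiplication by the
  variable.\<close>

lemma synthetic_div_linear_mult:
  fixes T :: "'a::comm_ring_1 poly"
  shows "synthetic_div ([:- a, 1:] * T + [:b:]) c = T + smult (c - a) (synthetic_div T c)"
proof (rule synthetic_div_unique'[where r = "(c - a) * poly T c + b"])
  have T: "[:- c, 1:] * synthetic_div T c = T - [:poly T c:]"
    using synthetic_div_correct'[of c T] by (metis add_diff_cancel_right')
  have "[:- c, 1:] * (T + smult (c - a) (synthetic_div T c)) + [:(c - a) * poly T c + b:]
      = [:- c, 1:] * T + smult (c - a) ([:- c, 1:] * synthetic_div T c) + [:(c - a) * poly T c + b:]"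
    by (simp only: distrib_left mult_smult_right)
  also have "\<dots> = [:- a, 1:] * T + [:b:]"
    unfolding T by (simp add: algebra_simps smult_diff_left smult_diff_right)
  finally show "[:- a, 1:] * T + [:b:]
      = [:- c, 1:] * (T + smult (c - a) (synthetic_div T c)) + [:(c - a) * poly T c + b:]" ..
qed

lemma coeff_synthetic_div_eq_0:
  fixes p :: "'a::comm_ring_1 poly"
  assumes "\<And>i. i > n \<Longrightarrow> coeff p i = 0" "i \<ge> n"
  shows "coeff (synthetic_div p c) i = 0"
proof (cases "degree p = 0")
  case True
  then show ?thesis using synthetic_div_eq_0_iff[of p c] by simp
next
  case False
  have "degree p \<le> n" using assms(1) by (intro degree_le) auto
  then have "degree (synthetic_div p c) < i"
    using False assms(2) by (simp add: degree_synthetic_div)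
  then show ?thesis by (rule coeff_eq_0)
qed

text \<open>The condition on coefficients replaces \<open>degree p < N\<close> because it also
  covers the zero polynomial at \<open>N = 0\<close>, where the induction starts.\<close>

lemma poly_span_degree_basis:
  fixes P :: "nat \<Rightarrow> 'a::field poly"
  assumes P: "\<And>n. degree (P n) = n" "\<And>n. P n \<noteq> 0"
    and "\<And>i. i \<ge> N \<Longrightarrow> coeff p i = 0"
  shows "\<exists>c. p = (\<Sum>k<N. smult (c k) (P k))"
  using assms(3)
proof (induction N arbitrary: p)
  case 0
  then have "p = 0" by (intro poly_eqI) simp
  then show ?case by simp
next
  case (Suc N)
  define a where "a = coeff p N / coeff (P N) N"
  have nz: "coeff (P N) N \<noteq> 0" using P[of N] by (metis leading_coeff_0_iff)
  have "coeff (p - smult a (P N)) i = 0" if "i \<ge> N" for i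
  proof (cases "i = N")
    case True
    then show ?thesis using nz by (simp add: a_def)
  next
    case False
    then have "i \<ge> Suc N" using that by simp
    then show ?thesis using Suc.prems[of i] P(1)[of N] by (simp add: coeff_eq_0)
  qed
  from Suc.IH[OF this] obtain c where c: "p - smult a (P N) = (\<Sum>k<N. smult (c k) (P k))" by blast
  then have "p = (\<Sum>k<N. smult ((c(N := a)) k) (P k)) + smult ((c(N := a)) N) (P N)"
    by (simp add: algebra_simps)
  then show ?case by (intro exI[of _ "c(N := a)"]) simp
qed

section \<open>Gram-Schmidt and uniqueness of the orthonormal sequence\<close>

context mstar
begin

definition ip :: "real poly \<Rightarrow> real poly \<Rightarrow> real" where
  "ip p q = (LINT x|\<mu>. poly p x * poly q x)"

lemma integrable_real_poly: "integrable \<mu> (\<lambda>x. poly p x)"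
  unfolding poly_altdef
  by (intro Bochner_Integration.integrable_sum integrable_mult_right integrable_power)

lemma integrable_real_poly_mult: "integrable \<mu> (\<lambda>x. poly p x * poly q x)"
  using integrable_real_poly[of "p * q"] by simp

lemma ip_diff_left: "ip (p - q) r = ip p r - ip q r"
  unfolding ip_def by (simp add: left_diff_distrib integrable_real_poly_mult)

lemma ip_smult_left: "ip (smult c p) r = c * ip p r"
  unfolding ip_def by (simp add: mult.assoc)

lemma ip_commute: "ip p q = ip q p"
  unfolding ip_def by (simp add: mult.commute)

lemma ip_sum_left: "ip (sum f A) r = (\<Sum>i\<in>A. ip (f i) r)"
  unfolding ip_def by (simp add: poly_sum sum_distrib_right integrable_real_poly_mult)

lemma of_real_poly_map: "poly (map_poly complex_of_real p) (complex_of_real x) = complex_of_real (poly p x)"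
  by (simp add: poly_altdef degree_map_poly coeff_map_poly)

lemma ip_self_pos:
  assumes "p \<noteq> 0" shows "ip p p > 0"
proof -
  have eq: "(cmod (poly (map_poly complex_of_real p) (complex_of_real x)))\<^sup>2 = poly p x * poly p x" for x
    by (simp add: of_real_poly_map power2_eq_square)
  have "map_poly complex_of_real p \<noteq> 0" using assms by (simp add: map_poly_eq_0_iff)
  then have "ip p p \<noteq> 0" using cmod2_poly_eq_0[of "map_poly complex_of_real p"] unfolding eq ip_def by blast
  moreover have "ip p p \<ge> 0" unfolding ip_def by (intro integral_nonneg_AE) simp
  ultimately show ?thesis by simp
qed

lemma orthonormal_ip:
  "orthonormal_polys \<mu> P \<longleftrightarrow> (\<forall>n. degree (P n) = n \<and> lead_coeff (P n) > 0) \<and>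
     (\<forall>m n. ip (P m) (P n) = (if m = n then 1 else 0))"
  by (simp add: orthonormal_polys_def ip_def)

context
  notes sum.cong [fundef_cong]
begin

fun gram_schmidt :: "nat \<Rightarrow> real poly" where
  "gram_schmidt n =
    (let g = monom 1 n - (\<Sum>k<n. smult (ip (monom 1 n) (gram_schmidt k)) (gram_schmidt k))
     in smult (1 / sqrt (ip g g)) g)"

end

declare gram_schmidt.simps [simp del]

lemma gram_schmidt:
  "degree (gram_schmidt n) = n \<and> lead_coeff (gram_schmidt n) > 0 \<and> ip (gram_schmidt n) (gram_schmidt n) = 1 \<and>
    (\<forall>k<n. ip (gram_schmidt n) (gram_schmidt k) = 0)"
proof (induction n rule: less_induct)
  case (less n)
  define S where "S = (\<Sum>k<n. smult (ip (monom 1 n) (gram_schmidt k)) (gram_schmidt k))"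
  define g where "g = monom 1 n - S"
  have gs: "gram_schmidt n = smult (1 / sqrt (ip g g)) g"
    by (subst gram_schmidt.simps) (simp add: g_def S_def Let_def)
  have S0: "coeff S i = 0" if "i \<ge> n" for i
  proof -
    have "coeff (gram_schmidt k) i = 0" if "k < n" for k
      using less[OF that] that \<open>i \<ge> n\<close> by (intro coeff_eq_0) auto
    then show ?thesis by (simp add: S_def coeff_sum)
  qed
  have gn: "coeff g n = 1" using S0[of n] by (simp add: g_def)
  then have g0: "g \<noteq> 0" by auto
  have "coeff g i = 0" if "i > n" for i using S0[of i] that by (simp add: g_def)
  then have "degree g \<le> n" by (intro degree_le) auto
  then have deg: "degree g = n" using gn by (metis le_antisym le_degree zero_neq_one)
  have pos: "ip g g > 0" using ip_self_pos[OF g0] .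
  have orth: "ip g (gram_schmidt k) = 0" if "k < n" for k
  proof -
    have "ip (gram_schmidt j) (gram_schmidt k) = (if j = k then 1 else 0)" if "j < n" for j
      using less[OF that] less[OF \<open>k < n\<close>] ip_commute[of "gram_schmidt j" "gram_schmidt k"]
      by (metis nat_neq_iff)
    then have "ip S (gram_schmidt k) = (\<Sum>j<n. if j = k then ip (monom 1 n) (gram_schmidt j) else 0)"
      unfolding S_def ip_sum_left ip_smult_left by (intro sum.cong) auto
    then show ?thesis using \<open>k < n\<close> by (simp add: g_def ip_diff_left)
  qed
  have "ip (gram_schmidt n) (gram_schmidt n) = (1 / sqrt (ip g g)) * ((1 / sqrt (ip g g)) * ip g g)"
    unfolding gs using ip_commute[of g "smult (1 / sqrt (ip g g)) g"] by (simp only: ip_smult_left)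
  also have "\<dots> = 1" using pos by (simp add: field_simps)
  finally have one: "ip (gram_schmidt n) (gram_schmidt n) = 1" .
  have "degree (gram_schmidt n) = n" "lead_coeff (gram_schmidt n) > 0" using gs deg gn pos by auto
  moreover have "ip (gram_schmidt n) (gram_schmidt k) = 0" if "k < n" for k
    unfolding gs ip_smult_left orth[OF that] by simp
  ultimately show ?case using one by blast
qed

lemma gram_schmidt_orthonormal: "orthonormal_polys \<mu> gram_schmidt"
  unfolding orthonormal_ip
proof safe
  fix m n
  show "ip (gram_schmidt m) (gram_schmidt n) = (if m = n then 1 else 0)"
    using gram_schmidt[of m] gram_schmidt[of n] ip_commute[of "gram_schmidt m" "gram_schmidt n"]
    by (metis nat_neq_iff)
qed (use gram_schmidt in blast)+

text \<open>Justifies the definite description in \<open>orthonormal_poly\<close>. After matching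
  leading coefficients the difference \<open>d\<close> lies in the span of the earlier polynomials,
  which agree by induction, and is orthogonal to them. Norm \<open>1\<close> and the positive sign
  then force \<open>c = 1\<close>.\<close>

lemma orthonormal_polys_unique:
  assumes P: "orthonormal_polys \<mu> P" and R: "orthonormal_polys \<mu> R"
  shows "P n = R n"
proof (induction n rule: less_induct)
  case (less n)
  have degP: "degree (P m) = m" and degR: "degree (R m) = m"
    and leadP: "lead_coeff (P m) > 0" and leadR: "lead_coeff (R m) > 0"
    and ipP: "ip (P m) (P k) = (if m = k then 1 else 0)"
    and ipR: "ip (R m) (R k) = (if m = k then 1 else 0)" for m k
    using P R unfolding orthonormal_ip by blast+
  define c where "c = lead_coeff (R n) / lead_coeff (P n)"
  have c: "c > 0" using leadP leadR by (simp add: c_def)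
  define d where "d = R n - smult c (P n)"
  have "coeff d i = 0" if "i \<ge> n" for i
  proof (cases "i = n")
    case True
    then show ?thesis using leadP[of n] by (simp add: d_def c_def degP degR)
  next
    case False
    then show ?thesis using that degP[of n] degR[of n] by (simp add: d_def coeff_eq_0)
  qed
  moreover have "P m \<noteq> 0" for m using leadP[of m] by auto
  ultimately obtain e where e: "d = (\<Sum>k<n. smult (e k) (P k))"
    using poly_span_degree_basis[of P n d] degP by blast
  have orth: "ip d (P k) = 0" if "k < n" for k
    using ipP[of n k] ipR[of n k] less[OF that] that by (simp add: d_def ip_diff_left ip_smult_left)
  have "ip d d = (\<Sum>k<n. e k * ip (P k) d)"
    by (subst (1) e) (simp add: ip_sum_left ip_smult_left)
  also have "\<dots> = 0" using orth by (simp add: ip_commute[of _ d])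
  finally have "d = 0" using ip_self_pos[of d] by auto
  then have Rn: "R n = smult c (P n)" by (simp add: d_def)
  have "1 = c * (c * ip (P n) (P n))"
    using ipR[of n n] unfolding Rn ip_smult_left by (metis ip_commute ip_smult_left)
  then have "c * c = 1" using ipP[of n n] by simp
  then have "c = 1" using c by (metis abs_of_pos abs_square_eq_1 power2_eq_square)
  then show ?case using Rn by simp
qed

lemma orthonormal_poly: "orthonormal_polys \<mu> (orthonormal_poly \<mu>)"
  unfolding orthonormal_poly_def
  by (rule theI[of _ gram_schmidt]) (use gram_schmidt_orthonormal orthonormal_polys_unique in auto)

abbreviation P :: "nat \<Rightarrow> complex poly" where
  "P n \<equiv> map_poly complex_of_real (orthonormal_poly \<mu> n)"

lemma degree_P [simp]: "degree (P n) = n"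
  using orthonormal_poly by (simp add: orthonormal_ip degree_map_poly)

lemma P_nonzero: "P n \<noteq> 0"
proof -
  have "lead_coeff (orthonormal_poly \<mu> n) > 0" using orthonormal_poly unfolding orthonormal_ip by blast
  then have "orthonormal_poly \<mu> n \<noteq> 0" by auto
  then show ?thesis by (simp add: map_poly_eq_0_iff)
qed

lemma L_P_P: "L (P m * P n) = (if m = n then 1 else 0)"
proof -
  have "L (P m * P n) = complex_of_real (ip (orthonormal_poly \<mu> m) (orthonormal_poly \<mu> n))"
    unfolding L_def ip_def poly_mult of_real_poly_map
    by (subst integral_complex_of_real[symmetric]) simp
  then show ?thesis using orthonormal_poly by (simp add: orthonormal_ip)
qed

text \<open>The coefficients are bilinear in \<open>p\<close> and \<open>P k\<close>, without a
  conjugation, because the \<open>P k\<close> have real coefficients.\<close>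

lemma P_expansion:
  assumes "\<And>i. i \<ge> N \<Longrightarrow> coeff p i = 0"
  shows "p = (\<Sum>k<N. smult (L (p * P k)) (P k))"
proof -
  obtain c where c: "p = (\<Sum>k<N. smult (c k) (P k))"
    using poly_span_degree_basis[of P N p] assms P_nonzero by auto
  have "L (p * P j) = c j" if "j < N" for j
  proof -
    have "L (p * P j) = (\<Sum>k<N. c k * (if k = j then 1 else 0))"
      by (subst c) (simp only: sum_distrib_right L_sum L_smult L_P_P mult_smult_left)
    also have "\<dots> = (\<Sum>k<N. if k = j then c k else 0)" by (intro sum.cong) auto
    finally show ?thesis using that by simp
  qed
  then show ?thesis using c by simp
qed

lemma L_mult_P_eq_0:
  assumes "\<And>i. i \<ge> n \<Longrightarrow> coeff p i = 0"
  shows "L (p * P n) = 0"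
  by (subst P_expansion[OF assms]) (auto simp: sum_distrib_right L_sum L_smult L_P_P)

section \<open>Polynomials of the second kind and the change of base point\<close>

abbreviation Pf where "Pf \<equiv> P_fun \<mu>"
abbreviation Qf where "Qf \<equiv> Q_fun \<mu>"

lemma Pf_eq: "Pf n z = poly (P n) z"
  by (simp add: P_fun_def)

lemma Qf_eq: "Qf n z = L (synthetic_div (P n) z)"
  by (simp add: Q_fun_def L_def)

lemma coeff_synthetic_div_P: "i \<ge> n \<Longrightarrow> coeff (synthetic_div (P n) z) i = 0"
  by (rule coeff_synthetic_div_eq_0[where n=n]) (auto intro: coeff_eq_0)

text \<open>Writing \<open>P k\<close> as \<open>(X - z)\<close> times its quotient plus its value
  at \<open>z\<close> moves the factor \<open>X - z\<close> to the other quotient. The leftover term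
  vanishes because the quotient of \<open>P k\<close> has degree below
  \<open>k \<le> n\<close>.\<close>

lemma L_synthetic_div_P:
  assumes "k \<le> n"
  shows "L (synthetic_div (P n) z * P k) = Pf k z * Qf n z - Pf n z * Qf k z"
proof -
  let ?s = "\<lambda>n. synthetic_div (P n) z"
  have s: "[:- z, 1:] * ?s n = P n - [:Pf n z:]" for n
    using synthetic_div_correct'[of z "P n"] unfolding Pf_eq by (metis add_diff_cancel_right')
  have "?s n * P k = ?s n * ([:- z, 1:] * ?s k + [:Pf k z:])"
    unfolding Pf_eq synthetic_div_correct' ..
  also have "\<dots> = ([:- z, 1:] * ?s n) * ?s k + smult (Pf k z) (?s n)"
    by (simp add: algebra_simps)
  also have "\<dots> = ?s k * P n - smult (Pf n z) (?s k) + smult (Pf k z) (?s n)"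
    unfolding s by (simp add: algebra_simps)
  finally have "L (?s n * P k) = L (?s k * P n) - Pf n z * L (?s k) + Pf k z * L (?s n)"
    by (simp only: L_add L_diff L_smult)
  moreover have "L (?s k * P n) = 0"
    using assms by (intro L_mult_P_eq_0 coeff_synthetic_div_P) auto
  ultimately show ?thesis unfolding Qf_eq by simp
qed

text \<open>Antisymmetric in \<open>n\<close> and \<open>k\<close>. Its entries with
  \<open>k < n\<close> form the kernel of the two discrete Volterra equations \<open>P_shift\<close>
  and \<open>Q_shift\<close>.\<close>

definition kern :: "complex \<Rightarrow> nat \<Rightarrow> nat \<Rightarrow> complex" where
  "kern a n k = Pf k a * Qf n a - Pf n a * Qf k a"

lemma synthetic_div_P_expansion:
  "synthetic_div (P n) a = (\<Sum>k<n. smult (kern a n k) (P k))"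
proof -
  have "synthetic_div (P n) a = (\<Sum>k<n. smult (L (synthetic_div (P n) a * P k)) (P k))"
    by (rule P_expansion[OF coeff_synthetic_div_P])
  also have "\<dots> = (\<Sum>k<n. smult (kern a n k) (P k))"
    by (intro sum.cong) (auto simp: L_synthetic_div_P kern_def)
  finally show ?thesis .
qed

text \<open>Variation of constants: the values at \<open>z\<close> solve a Volterra equation in
  which only the values at \<open>a\<close> enter as data.\<close>

lemma P_shift: "Pf n z = Pf n a + (z - a) * (\<Sum>k<n. kern a n k * Pf k z)"
proof -
  have "Pf n z = poly ([:- a, 1:] * synthetic_div (P n) a + [:Pf n a:]) z"
    unfolding Pf_eq synthetic_div_correct' ..
  then show ?thesis
    unfolding synthetic_div_P_expansion by (simp add: poly_sum Pf_eq algebra_simps)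
qed

lemma Qf_0 [simp]: "Qf 0 z = 0"
  using synthetic_div_eq_0_iff[of "P 0" z] by (simp add: Qf_eq)

text \<open>Orthogonality to the constant \<open>P 0\<close>. For a mass other than \<open>1\<close>
  this constant is not \<open>1\<close>, hence the factor \<open>Pf 0 a\<close>.\<close>

lemma L_P: "L (P n) * Pf 0 a = (if n = 0 then 1 else 0)"
proof -
  have "P 0 = [:Pf 0 a:]" unfolding Pf_eq by (metis degree_P degree_eq_zeroE poly_const_conv)
  then have "L (P n * P 0) = Pf 0 a * L (P n)" by (simp add: L_smult)
  then show ?thesis using L_P_P[of n 0] by (simp add: mult.commute)
qed

text \<open>The kernel is that of \<open>P_shift\<close>: \<open>synthetic_div_linear_mult\<close>
  reduces the quotient at \<open>z\<close> to quotients of the quotient at \<open>a\<close>.\<close>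

lemma Q_shift: "Qf n z = Qf n a + (z - a) * (\<Sum>k<n. kern a n k * Qf k z)"
proof -
  let ?T = "synthetic_div (P n) a"
  have "Qf n z = L (synthetic_div ([:- a, 1:] * ?T + [:Pf n a:]) z)"
    unfolding Qf_eq Pf_eq synthetic_div_correct' ..
  also have "\<dots> = L ?T + (z - a) * L (synthetic_div ?T z)"
    unfolding synthetic_div_linear_mult by (simp add: L_add L_smult)
  also have "L (synthetic_div ?T z) = (\<Sum>k<n. kern a n k * Qf k z)"
    unfolding synthetic_div_P_expansion synthetic_div_sum synthetic_div_smult L_sum L_smult Qf_eq ..
  finally show ?thesis by (simp add: Qf_eq)
qed

end

section \<open>Square summability and Parseval's identity\<close>

lemma summable_cmod2_add:
  fixes a b :: "nat \<Rightarrow> complex"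
  assumes "summable (\<lambda>n. (cmod (a n))\<^sup>2)" "summable (\<lambda>n. (cmod (b n))\<^sup>2)"
  shows "summable (\<lambda>n. (cmod (a n + b n))\<^sup>2)"
proof (rule summable_comparison_test')
  show "summable (\<lambda>n. 2 * (cmod (a n))\<^sup>2 + 2 * (cmod (b n))\<^sup>2)"
    by (intro summable_add summable_mult assms)
  fix n
  have "(cmod (a n + b n))\<^sup>2 \<le> (cmod (a n) + cmod (b n))\<^sup>2"
    by (intro power_mono norm_triangle_ineq) auto
  also have "\<dots> \<le> 2 * (cmod (a n))\<^sup>2 + 2 * (cmod (b n))\<^sup>2"
    using zero_le_power2[of "cmod (a n) - cmod (b n)"] by (simp add: power2_eq_square algebra_simps)
  finally show "norm ((cmod (a n + b n))\<^sup>2) \<le> 2 * (cmod (a n))\<^sup>2 + 2 * (cmod (b n))\<^sup>2" by simp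
qed

lemma summable_cmod2_mult:
  fixes a :: "nat \<Rightarrow> complex"
  assumes "summable (\<lambda>n. (cmod (a n))\<^sup>2)"
  shows "summable (\<lambda>n. (cmod (c * a n))\<^sup>2)"
  using summable_mult[OF assms, of "(cmod c)\<^sup>2"] by (simp add: norm_mult power_mult_distrib)

lemma summable_l2_mult:
  fixes a b :: "nat \<Rightarrow> complex"
  assumes "summable (\<lambda>n. (cmod (a n))\<^sup>2)" "summable (\<lambda>n. (cmod (b n))\<^sup>2)"
  shows "summable (\<lambda>n. a n * b n)"
proof (rule summable_comparison_test')
  show "summable (\<lambda>n. (cmod (a n))\<^sup>2 + (cmod (b n))\<^sup>2)"
    by (intro summable_add assms)
  fix n
  have "cmod (a n) * cmod (b n) \<ge> 0" by simp
  then show "norm (a n * b n) \<le> (cmod (a n))\<^sup>2 + (cmod (b n))\<^sup>2"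
    using zero_le_power2[of "cmod (a n) - cmod (b n)"]
    unfolding norm_mult power2_diff by linarith
qed

text \<open>Unrolling the recursion bounds \<open>T n\<close> by the sum of the \<open>d k\<close>
  times the product of the \<open>1 + e k\<close>, and
  \<open>1 + e k \<le> exp (e k)\<close>.\<close>

lemma discrete_Gronwall:
  fixes T d e :: "nat \<Rightarrow> real"
  assumes T0: "T 0 = 0" and step: "\<And>n. T (Suc n) \<le> (1 + e n) * T n + d n"
    and d: "\<And>n. 0 \<le> d n" "summable d" and e: "\<And>n. 0 \<le> e n" "summable e"
  shows "T n \<le> suminf d * exp (suminf e)"
proof -
  have "T n \<le> (\<Sum>k<n. d k) * (\<Prod>k<n. 1 + e k)" for n
  proof (induction n)
    case 0
    then show ?case by (simp add: T0)
  next
    case (Suc n)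
    have p: "1 \<le> (\<Prod>k<Suc n. 1 + e k)" by (intro prod_ge_1) (simp add: e)
    have "T (Suc n) \<le> (1 + e n) * ((\<Sum>k<n. d k) * (\<Prod>k<n. 1 + e k)) + d n"
      using step[of n] mult_left_mono[OF Suc, of "1 + e n"] e(1)[of n] by linarith
    also have "\<dots> = (\<Sum>k<n. d k) * (\<Prod>k<Suc n. 1 + e k) + d n * 1" by simp
    also have "\<dots> \<le> (\<Sum>k<n. d k) * (\<Prod>k<Suc n. 1 + e k) + d n * (\<Prod>k<Suc n. 1 + e k)"
      using p d(1)[of n] by (intro add_left_mono mult_left_mono) auto
    finally show ?case by (simp add: algebra_simps)
  qed
  also have "(\<Sum>k<n. d k) * (\<Prod>k<n. 1 + e k) \<le> suminf d * exp (suminf e)"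
  proof (rule mult_mono)
    show "(\<Sum>k<n. d k) \<le> suminf d" by (intro sum_le_suminf d) auto
    have "(\<Prod>k<n. 1 + e k) \<le> (\<Prod>k<n. exp (e k))"
      using e(1) by (intro prod_mono) (auto simp: add_nonneg_nonneg)
    also have "\<dots> = exp (\<Sum>k<n. e k)" by (simp add: exp_sum)
    also have "\<dots> \<le> exp (suminf e)" using e by (simp add: sum_le_suminf)
    finally show "(\<Prod>k<n. 1 + e k) \<le> exp (suminf e)" .
    show "0 \<le> suminf d" by (intro suminf_nonneg d)
    show "0 \<le> (\<Prod>k<n. 1 + e k)" using e(1) by (intro prod_nonneg) (auto simp: add_nonneg_nonneg)
  qed
  finally show ?thesis .
qed

lemma cmod_sum_mult_le:
  fixes a b :: "nat \<Rightarrow> complex"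
  shows "(cmod (\<Sum>k<n. a k * b k))\<^sup>2 \<le> (\<Sum>k<n. (cmod (a k))\<^sup>2) * (\<Sum>k<n. (cmod (b k))\<^sup>2)"
proof -
  have "cmod (\<Sum>k<n. a k * b k) \<le> (\<Sum>k<n. cmod (a k) * cmod (b k))"
    using norm_sum[of "\<lambda>k. a k * b k" "{..<n}"] by (simp add: norm_mult)
  then have "(cmod (\<Sum>k<n. a k * b k))\<^sup>2 \<le> (\<Sum>k<n. cmod (a k) * cmod (b k))\<^sup>2"
    by (intro power_mono) auto
  also have "\<dots> \<le> (\<Sum>k<n. (cmod (a k))\<^sup>2) * (\<Sum>k<n. (cmod (b k))\<^sup>2)"
    by (rule Cauchy_Schwarz_ineq_sum)
  finally show ?thesis .
qed

text \<open>The kernel has rank two: the sum is \<open>q n\<close> times one running sum minus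
  \<open>p n\<close> times another, and Cauchy-Schwarz bounds both by the partial sums of the
  squared moduli of \<open>y\<close>. These obey a Gronwall recursion with summable
  coefficients.\<close>

lemma summable_l2_Volterra:
  fixes p q x y :: "nat \<Rightarrow> complex"
  assumes p: "summable (\<lambda>n. (cmod (p n))\<^sup>2)" and q: "summable (\<lambda>n. (cmod (q n))\<^sup>2)"
    and x: "summable (\<lambda>n. (cmod (x n))\<^sup>2)"
    and y: "\<And>n. y n = x n + c * (\<Sum>k<n. (p k * q n - p n * q k) * y k)"
  shows "summable (\<lambda>n. (cmod (y n))\<^sup>2)"
proof -
  define Sp where "Sp = (\<Sum>n. (cmod (p n))\<^sup>2)"
  define Sq where "Sq = (\<Sum>n. (cmod (q n))\<^sup>2)"
  define T where "T n = (\<Sum>k<n. (cmod (y k))\<^sup>2)" for n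
  \<comment> \<open>The \<open>4\<close> collects two uses of
    \<open>(a + b)^2 \<le> 2 a^2 + 2 b^2\<close>: one splits off \<open>x n\<close>, the other
    separates the two terms of the kernel.\<close>
  define e where "e n = 4 * (cmod c)\<^sup>2 * (Sp * (cmod (q n))\<^sup>2 + Sq * (cmod (p n))\<^sup>2)" for n
  define d where "d n = 2 * (cmod (x n))\<^sup>2" for n
  have Sp0: "0 \<le> Sp" and Sq0: "0 \<le> Sq" using p q by (auto simp: Sp_def Sq_def intro!: suminf_nonneg)
  have T0: "0 \<le> T n" for n by (simp add: T_def sum_nonneg)
  have sq: "(a + b)\<^sup>2 \<le> 2 * a\<^sup>2 + 2 * b\<^sup>2" for a b :: real
    using zero_le_power2[of "a - b"] by (simp add: power2_eq_square algebra_simps)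
  have cs: "(cmod (\<Sum>k<n. r k * y k))\<^sup>2 \<le> (\<Sum>k. (cmod (r k))\<^sup>2) * T n"
    if "summable (\<lambda>k. (cmod (r k))\<^sup>2)" for r n
  proof -
    have "(\<Sum>k<n. (cmod (r k))\<^sup>2) * T n \<le> (\<Sum>k. (cmod (r k))\<^sup>2) * T n"
      using that T0 by (intro mult_right_mono sum_le_suminf) auto
    then show ?thesis using cmod_sum_mult_le[of r y n] unfolding T_def by linarith
  qed
  have step: "(cmod (y n))\<^sup>2 \<le> e n * T n + d n" for n
  proof -
    let ?A = "\<Sum>k<n. p k * y k" and ?B = "\<Sum>k<n. q k * y k"
    have "(\<Sum>k<n. (p k * q n - p n * q k) * y k) = q n * ?A - p n * ?B"
      by (simp add: sum_distrib_left sum_subtractf algebra_simps)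
    then have yn: "y n = x n + c * (q n * ?A - p n * ?B)" using y[of n] by simp
    have "cmod (y n) \<le> cmod (x n) + cmod c * cmod (q n * ?A - p n * ?B)"
      unfolding yn norm_mult[symmetric] by (rule norm_triangle_ineq)
    then have "(cmod (y n))\<^sup>2 \<le> (cmod (x n) + cmod c * cmod (q n * ?A - p n * ?B))\<^sup>2"
      by (intro power_mono) auto
    also have "\<dots> \<le> d n + 2 * (cmod c)\<^sup>2 * (cmod (q n * ?A - p n * ?B))\<^sup>2"
      using sq[of "cmod (x n)" "cmod c * cmod (q n * ?A - p n * ?B)"] by (simp add: d_def power_mult_distrib)
    finally have le: "(cmod (y n))\<^sup>2 \<le> d n + 2 * (cmod c)\<^sup>2 * (cmod (q n * ?A - p n * ?B))\<^sup>2" .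
    have "(cmod (q n * ?A - p n * ?B))\<^sup>2 \<le> 2 * ((Sp * (cmod (q n))\<^sup>2 + Sq * (cmod (p n))\<^sup>2) * T n)"
    proof -
      have "(cmod (q n * ?A - p n * ?B))\<^sup>2 \<le> (cmod (q n) * cmod ?A + cmod (p n) * cmod ?B)\<^sup>2"
        unfolding norm_mult[symmetric] by (intro power_mono norm_triangle_ineq4) auto
      also have "\<dots> \<le> 2 * ((cmod (q n))\<^sup>2 * (cmod ?A)\<^sup>2) + 2 * ((cmod (p n))\<^sup>2 * (cmod ?B)\<^sup>2)"
        using sq[of "cmod (q n) * cmod ?A" "cmod (p n) * cmod ?B"] by (simp add: power_mult_distrib)
      also have "\<dots> \<le> 2 * ((cmod (q n))\<^sup>2 * (Sp * T n)) + 2 * ((cmod (p n))\<^sup>2 * (Sq * T n))"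
        using cs[OF p, of n] cs[OF q, of n] unfolding Sp_def Sq_def
        by (intro add_mono mult_left_mono) auto
      finally show ?thesis by (simp add: algebra_simps)
    qed
    from mult_left_mono[OF this, of "2 * (cmod c)\<^sup>2"] le show ?thesis
      unfolding e_def by (simp add: algebra_simps)
  qed
  have "T n \<le> suminf d * exp (suminf e)" for n
  proof (rule discrete_Gronwall)
    show "T 0 = 0" by (simp add: T_def)
    show "T (Suc n) \<le> (1 + e n) * T n + d n" for n
      using step[of n] by (simp add: T_def algebra_simps)
    show "summable d" unfolding d_def by (intro summable_mult x)
    show "summable e" unfolding e_def by (intro summable_mult summable_add p q)
  qed (use Sp0 Sq0 in \<open>auto simp: d_def e_def\<close>)
  then show ?thesis unfolding T_def by (intro summableI_nonneg_bounded) auto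
qed

section \<open>Fourier coefficients of the resolvents\<close>

context mstar
begin

lemma integral_cmod2_P_sum:
  "(LINT x|\<mu>. (cmod (poly (\<Sum>k<N. smult (c k) (P k)) (complex_of_real x)))\<^sup>2) = (\<Sum>k<N. (cmod (c k))\<^sup>2)"
proof -
  let ?p = "\<Sum>k<N. smult (c k) (P k)" and ?q = "\<Sum>k<N. smult (cnj (c k)) (P k)"
  have q: "poly ?q (complex_of_real x) = cnj (poly ?p (complex_of_real x))" for x
    by (simp add: poly_sum of_real_poly_map)
  have "complex_of_real (LINT x|\<mu>. (cmod (poly ?p (complex_of_real x)))\<^sup>2) = L (?p * ?q)"
    unfolding L_def poly_mult q
    by (subst integral_complex_of_real[symmetric]) (simp add: complex_norm_square del: of_real_power)
  also have "\<dots> = (\<Sum>k<N. \<Sum>j<N. c k * (cnj (c j) * (if k = j then 1 else 0)))"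
    by (simp only: sum_product L_sum mult_smult_left mult_smult_right L_smult L_P_P) (simp add: mult.left_commute)
  also have "\<dots> = (\<Sum>k<N. \<Sum>j<N. if k = j then c k * cnj (c j) else 0)"
    by (intro sum.cong) auto
  also have "\<dots> = (\<Sum>k<N. c k * cnj (c k))" by simp
  also have "\<dots> = complex_of_real (\<Sum>k<N. (cmod (c k))\<^sup>2)"
    by (simp add: complex_norm_square del: of_real_power)
  finally show ?thesis by (simp only: of_real_eq_iff)
qed

lemma Pf_0_nonzero: "Pf 0 z \<noteq> 0"
  using L_P[of 0 z] by auto

text \<open>The reproducing kernel at \<open>z\<close>, scaled to the value \<open>1\<close> there,
  has square norm \<open>1 / S\<close>. A lower bound \<open>e\<close> for all such norms therefore
  bounds the partial sum \<open>S\<close> by \<open>1 / e\<close>.\<close>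

lemma summable_Pf_if_not_christoffel_zero:
  assumes "\<not> christoffel_zero \<mu> z"
  shows "summable (\<lambda>n. (cmod (Pf n z))\<^sup>2)"
proof -
  obtain e where e: "e > 0" "\<And>r. poly r z = 1 \<Longrightarrow> e \<le> (LINT x|\<mu>. (cmod (poly r (complex_of_real x)))\<^sup>2)"
    using assms unfolding christoffel_zero_def by (meson not_less)
  have "(\<Sum>k<N. (cmod (Pf k z))\<^sup>2) \<le> 1 / e" for N
  proof -
    define S where "S = (\<Sum>k<N. (cmod (Pf k z))\<^sup>2)"
    show ?thesis
    proof (cases "S > 0")
      case False
      moreover have "0 \<le> 1 / e" using e(1) by simp
      ultimately show ?thesis unfolding S_def[symmetric] by linarith
    next
      case True
      let ?r = "\<Sum>k<N. smult (cnj (Pf k z) / S) (P k)"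
      have "poly ?r z = (\<Sum>k<N. cnj (Pf k z) / S * Pf k z)" by (simp add: poly_sum Pf_eq)
      also have "\<dots> = (\<Sum>k<N. of_real ((cmod (Pf k z))\<^sup>2) / of_real S)"
        by (intro sum.cong) (simp_all add: complex_norm_square mult.commute del: of_real_power)
      also have "\<dots> = 1" using True by (simp only: sum_divide_distrib[symmetric] of_real_sum[symmetric] S_def[symmetric]) simp
      finally have "e \<le> (LINT x|\<mu>. (cmod (poly ?r (complex_of_real x)))\<^sup>2)" by (rule e(2))
      also have "\<dots> = (\<Sum>k<N. (cmod (Pf k z))\<^sup>2 / S\<^sup>2)"
        unfolding integral_cmod2_P_sum using True by (simp add: norm_divide power_divide)
      also have "\<dots> = 1 / S" using True
        by (simp only: sum_divide_distrib[symmetric] S_def[symmetric]) (simp add: power2_eq_square)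
      finally show ?thesis using True e(1) unfolding S_def[symmetric] by (simp add: field_simps)
    qed
  qed
  then show ?thesis by (intro summableI_nonneg_bounded) auto
qed

abbreviation F where "F \<equiv> stieltjes_transform \<mu>"

text \<open>The Weyl solution; for nonreal \<open>z\<close> these are the Fourier coefficients of
  the resolvent, by \<open>integral_P_resolvent\<close>.\<close>

definition y :: "complex \<Rightarrow> nat \<Rightarrow> complex" where
  "y z n = Qf n z + F z * Pf n z"

lemma integral_P_resolvent:
  assumes "z \<notin> \<real>"
  shows "(LINT x|\<mu>. poly (P n) (complex_of_real x) / (complex_of_real x - z)) = y z n"
proof -
  have "poly (P n) (complex_of_real x) / (complex_of_real x - z)
    = poly (synthetic_div (P n) z) (complex_of_real x) + Pf n z * (1 / (complex_of_real x - z))" for x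
  proof -
    have "poly (P n) (complex_of_real x) = poly ([:- z, 1:] * synthetic_div (P n) z + [:Pf n z:]) (complex_of_real x)"
      unfolding Pf_eq synthetic_div_correct' ..
    then show ?thesis using nonreal_neq[OF assms, of x] by (simp add: field_simps)
  qed
  then have "(LINT x|\<mu>. poly (P n) (complex_of_real x) / (complex_of_real x - z))
    = (LINT x|\<mu>. poly (synthetic_div (P n) z) (complex_of_real x) + Pf n z * (1 / (complex_of_real x - z)))"
    by simp
  also have "\<dots> = L (synthetic_div (P n) z) + Pf n z * F z"
    unfolding L_def stieltjes_transform_def
    using integrable_poly integrable_resolvent[OF assms]
    by (subst Bochner_Integration.integral_add) (auto simp del: times_divide_eq_right)
  finally show ?thesis by (simp add: y_def Qf_eq)
qed

definition R2 :: "complex \<Rightarrow> real" where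
  "R2 z = (LINT x|\<mu>. (cmod (1 / (complex_of_real x - z)))\<^sup>2)"

text \<open>Completing the square in the coefficients. The choice \<open>c = y z\<close> is optimal,
  which gives Bessel's inequality and the approximation criterion at once.\<close>

lemma integral_resolvent_minus_P_sum:
  assumes z: "z \<notin> \<real>"
  shows "(LINT x|\<mu>. (cmod (1 / (complex_of_real x - z) - poly (\<Sum>k<N. smult (c k) (P k)) (complex_of_real x)))\<^sup>2)
    = R2 z - (\<Sum>k<N. (cmod (y z k))\<^sup>2) + (\<Sum>k<N. (cmod (c k - y z k))\<^sup>2)"
proof -
  let ?p = "\<Sum>k<N. smult (c k) (P k)" and ?q = "\<Sum>k<N. smult (cnj (c k)) (P k)"
  let ?f = "\<lambda>x. 1 / (complex_of_real x - z)"
  have q: "cnj (poly ?p (complex_of_real x)) = poly ?q (complex_of_real x)" for x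
    by (simp add: poly_sum of_real_poly_map)
  have cm: "(cmod (a - b))\<^sup>2 = (cmod a)\<^sup>2 - 2 * Re (cnj b * a) + (cmod b)\<^sup>2" for a b
    by (simp add: cmod_power2 power2_diff algebra_simps)
  have int: "integrable \<mu> (\<lambda>x. poly ?q (complex_of_real x) / (complex_of_real x - z))"
    by (rule integrable_poly_resolvent[OF z])
  have "(LINT x|\<mu>. (cmod (?f x - poly ?p (complex_of_real x)))\<^sup>2)
    = (LINT x|\<mu>. (cmod (?f x))\<^sup>2 - 2 * Re (poly ?q (complex_of_real x) / (complex_of_real x - z))
        + (cmod (poly ?p (complex_of_real x)))\<^sup>2)"
    unfolding cm q by simp
  also have "\<dots> = R2 z - 2 * Re (LINT x|\<mu>. poly ?q (complex_of_real x) / (complex_of_real x - z))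
        + (LINT x|\<mu>. (cmod (poly ?p (complex_of_real x)))\<^sup>2)"
    unfolding R2_def
    using integrable_cmod2_resolvent[OF z] integrable_cmod2[of ?p] int integrable_Re[OF int]
    by (simp del: poly_sum)
  also have "(LINT x|\<mu>. poly ?q (complex_of_real x) / (complex_of_real x - z)) = (\<Sum>k<N. cnj (c k) * y z k)"
  proof -
    have "(LINT x|\<mu>. poly ?q (complex_of_real x) / (complex_of_real x - z))
      = (LINT x|\<mu>. (\<Sum>k<N. cnj (c k) * (poly (P k) (complex_of_real x) / (complex_of_real x - z))))"
      by (simp add: poly_sum sum_divide_distrib)
    also have "\<dots> = (\<Sum>k<N. cnj (c k) * y z k)"
      using integrable_poly_resolvent[OF z]
      by (subst Bochner_Integration.integral_sum)
        (auto simp: integral_P_resolvent[OF z] simp del: times_divide_eq_right)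
    finally show ?thesis .
  qed
  also have "(LINT x|\<mu>. (cmod (poly ?p (complex_of_real x)))\<^sup>2) = (\<Sum>k<N. (cmod (c k))\<^sup>2)"
    by (rule integral_cmod2_P_sum)
  also have "R2 z - 2 * Re (\<Sum>k<N. cnj (c k) * y z k) + (\<Sum>k<N. (cmod (c k))\<^sup>2)
    = R2 z + (\<Sum>k<N. (cmod (c k))\<^sup>2 - 2 * Re (cnj (c k) * y z k))"
    by (simp add: sum_subtractf sum_distrib_left)
  also have "(\<Sum>k<N. (cmod (c k))\<^sup>2 - 2 * Re (cnj (c k) * y z k)) = (\<Sum>k<N. (cmod (c k - y z k))\<^sup>2 - (cmod (y z k))\<^sup>2)"
    by (intro sum.cong refl) (simp add: cm algebra_simps)
  finally show ?thesis by (simp add: sum_subtractf)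
qed

lemma Bessel_resolvent:
  assumes "z \<notin> \<real>"
  shows "(\<Sum>k<N. (cmod (y z k))\<^sup>2) \<le> R2 z"
proof -
  have "0 \<le> (LINT x|\<mu>. (cmod (1 / (complex_of_real x - z) - poly (\<Sum>k<N. smult (y z k) (P k)) (complex_of_real x)))\<^sup>2)"
    by (intro integral_nonneg_AE) simp
  then show ?thesis unfolding integral_resolvent_minus_P_sum[OF assms] by simp
qed

lemma summable_y: "z \<notin> \<real> \<Longrightarrow> summable (\<lambda>n. (cmod (y z n))\<^sup>2)"
  using Bessel_resolvent by (intro summableI_nonneg_bounded) auto

text \<open>At \<open>a\<close> the second-kind values are \<open>y a n - F a * Pf n a\<close>, a
  difference of square summable sequences; the Volterra equations carry both summabilities to every
  \<open>z\<close>.\<close>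

lemma summable_PQ_if_not_christoffel_zero:
  assumes "a \<notin> \<real>" "\<not> christoffel_zero \<mu> a"
  shows "summable (\<lambda>n. (cmod (Pf n z))\<^sup>2)" "summable (\<lambda>n. (cmod (Qf n z))\<^sup>2)"
proof -
  have P: "summable (\<lambda>n. (cmod (Pf n a))\<^sup>2)"
    by (rule summable_Pf_if_not_christoffel_zero[OF assms(2)])
  have "Qf n a = y a n + (- F a) * Pf n a" for n by (simp add: y_def)
  then have Q: "summable (\<lambda>n. (cmod (Qf n a))\<^sup>2)"
    by (simp only:) (intro summable_cmod2_add summable_cmod2_mult summable_y assms P)
  show "summable (\<lambda>n. (cmod (Pf n z))\<^sup>2)"
    by (rule summable_l2_Volterra[OF P Q P P_shift[unfolded kern_def]])
  show "summable (\<lambda>n. (cmod (Qf n z))\<^sup>2)"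
    by (rule summable_l2_Volterra[OF P Q Q Q_shift[unfolded kern_def]])
qed

text \<open>The best approximation of degree below \<open>N\<close> is the partial Fourier sum, with
  error \<open>R2 z\<close> minus the partial sum of the squared coefficients.\<close>

lemma resolvent_approx_iff_Parseval:
  assumes z: "z \<notin> \<real>"
  shows "resolvent_approx \<mu> z \<longleftrightarrow> (\<lambda>N. \<Sum>k<N. (cmod (y z k))\<^sup>2) \<longlonglongrightarrow> R2 z"
proof
  assume a: "resolvent_approx \<mu> z"
  show "(\<lambda>N. \<Sum>k<N. (cmod (y z k))\<^sup>2) \<longlonglongrightarrow> R2 z"
  proof (rule LIMSEQ_I)
    fix e :: real assume "e > 0"
    then obtain p where p: "(LINT x|\<mu>. (cmod (1 / (complex_of_real x - z) - poly p (complex_of_real x)))\<^sup>2) < e"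
      using a unfolding resolvent_approx_def by blast
    let ?N = "Suc (degree p)"
    have "p = (\<Sum>k<?N. smult (L (p * P k)) (P k))" by (rule P_expansion) (simp add: coeff_eq_0)
    then have "R2 z - (\<Sum>k<?N. (cmod (y z k))\<^sup>2) + (\<Sum>k<?N. (cmod (L (p * P k) - y z k))\<^sup>2) < e"
      using p integral_resolvent_minus_P_sum[OF z, where N = ?N and c = "\<lambda>k. L (p * P k)"] by simp
    moreover have "0 \<le> (\<Sum>k<?N. (cmod (L (p * P k) - y z k))\<^sup>2)" by (simp add: sum_nonneg)
    ultimately have N: "R2 z - (\<Sum>k<?N. (cmod (y z k))\<^sup>2) < e" by linarith
    show "\<exists>no. \<forall>n\<ge>no. norm ((\<Sum>k<n. (cmod (y z k))\<^sup>2) - R2 z) < e"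
    proof (intro exI[of _ ?N] allI impI)
      fix n assume "?N \<le> n"
      then have "(\<Sum>k<?N. (cmod (y z k))\<^sup>2) \<le> (\<Sum>k<n. (cmod (y z k))\<^sup>2)"
        by (intro sum_mono2) auto
      then show "norm ((\<Sum>k<n. (cmod (y z k))\<^sup>2) - R2 z) < e"
        using N Bessel_resolvent[OF z, of n] by simp
    qed
  qed
next
  assume lim: "(\<lambda>N. \<Sum>k<N. (cmod (y z k))\<^sup>2) \<longlonglongrightarrow> R2 z"
  show "resolvent_approx \<mu> z"
    unfolding resolvent_approx_def
  proof (intro allI impI)
    fix e :: real assume "e > 0"
    then obtain N where "norm ((\<Sum>k<N. (cmod (y z k))\<^sup>2) - R2 z) < e"
      using LIMSEQ_D[OF lim, of e] by auto
    then have "R2 z - (\<Sum>k<N. (cmod (y z k))\<^sup>2) < e" using Bessel_resolvent[OF z, of N] by simp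
    then show "\<exists>p. (LINT x|\<mu>. (cmod (1 / (complex_of_real x - z) - poly p (complex_of_real x)))\<^sup>2) < e"
      using integral_resolvent_minus_P_sum[OF z, where N = N and c = "y z"]
      by (intro exI[of _ "\<Sum>k<N. smult (y z k) (P k)"]) simp
  qed
qed

lemma resolvent_product:
  assumes z: "z \<notin> \<real>" and w: "w \<notin> \<real>"
  shows "(z - w) * (LINT x|\<mu>. 1 / (complex_of_real x - z) * (1 / (complex_of_real x - w))) = F z - F w"
proof -
  have "(z - w) * (1 / (complex_of_real x - z) * (1 / (complex_of_real x - w)))
    = 1 / (complex_of_real x - z) - 1 / (complex_of_real x - w)" for x
    using nonreal_neq[OF z, of x] nonreal_neq[OF w, of x] by (simp add: divide_simps)
  then show ?thesis
    unfolding stieltjes_transform_def integral_mult_right_zero[symmetric]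
    using integrable_resolvent[OF z] integrable_resolvent[OF w]
    by (simp only:) (rule Bochner_Integration.integral_diff)
qed

text \<open>On the real line the conjugate of the resolvent at \<open>z\<close> is the resolvent at
  \<open>cnj z\<close>, so this is \<open>resolvent_product\<close> with
  \<open>w = cnj z\<close>.\<close>

lemma R2_eq:
  assumes z: "z \<notin> \<real>"
  shows "(z - cnj z) * of_real (R2 z) = F z - cnj (F z)"
proof -
  have "of_real (R2 z) = (LINT x|\<mu>. 1 / (complex_of_real x - z) * (1 / (complex_of_real x - cnj z)))"
    unfolding R2_def
    by (subst integral_complex_of_real[symmetric]) (simp add: complex_norm_square del: of_real_power)
  moreover have "cnj z \<notin> \<real>" using z by (simp add: complex_is_Real_iff)
  ultimately show ?thesis
    using resolvent_product[OF z, of "cnj z"] by (simp add: stieltjes_transform_cnj)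
qed

text \<open>Approximability at \<open>z\<close> alone suffices: the error of its partial Fourier sum
  is paired with the resolvent at \<open>w\<close> by Cauchy-Schwarz.\<close>

lemma Parseval_bilinear:
  assumes z: "z \<notin> \<real>" and w: "w \<notin> \<real>" and a: "resolvent_approx \<mu> z"
  shows "(\<lambda>N. (z - w) * (\<Sum>k<N. y z k * y w k)) \<longlonglongrightarrow> F z - F w"
proof -
  let ?I = "LINT x|\<mu>. 1 / (complex_of_real x - z) * (1 / (complex_of_real x - w))"
  let ?p = "\<lambda>N. \<Sum>k<N. smult (y z k) (P k)"
  have le: "(cmod (?I - (\<Sum>k<N. y z k * y w k)))\<^sup>2 \<le> (R2 z - (\<Sum>k<N. (cmod (y z k))\<^sup>2)) * R2 w" for N
  proof -
    have i1: "integrable \<mu> (\<lambda>x. 1 / (complex_of_real x - z) * (1 / (complex_of_real x - w)))"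
      using Cauchy_Schwarz_LINT(1)[OF _ _ integrable_cmod2_resolvent[OF z] integrable_cmod2_resolvent[OF w]] by simp
    have i2: "integrable \<mu> (\<lambda>x. poly (?p N) (complex_of_real x) * (1 / (complex_of_real x - w)))"
      using integrable_poly_resolvent[OF w, of "?p N"] by simp
    have "(LINT x|\<mu>. poly (?p N) (complex_of_real x) * (1 / (complex_of_real x - w)))
      = (LINT x|\<mu>. (\<Sum>k<N. y z k * (poly (P k) (complex_of_real x) / (complex_of_real x - w))))"
      by (simp add: poly_sum sum_divide_distrib)
    also have "\<dots> = (\<Sum>k<N. y z k * y w k)"
      using integrable_poly_resolvent[OF w]
      by (subst Bochner_Integration.integral_sum)
        (auto simp: integral_P_resolvent[OF w] simp del: times_divide_eq_right)
    finally have "?I - (\<Sum>k<N. y z k * y w k)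
      = (LINT x|\<mu>. (1 / (complex_of_real x - z) - poly (?p N) (complex_of_real x)) * (1 / (complex_of_real x - w)))"
      using i1 i2 by (simp only: left_diff_distrib Bochner_Integration.integral_diff)
    then have "(cmod (?I - (\<Sum>k<N. y z k * y w k)))\<^sup>2
      \<le> (LINT x|\<mu>. (cmod (1 / (complex_of_real x - z) - poly (?p N) (complex_of_real x)))\<^sup>2) * R2 w"
      unfolding R2_def
      using Cauchy_Schwarz_LINT(2)[OF _ _ integrable_cmod2_resolvent_minus_poly[OF z, of "?p N"] integrable_cmod2_resolvent[OF w]]
      by (simp del: poly_sum)
    then show ?thesis unfolding integral_resolvent_minus_P_sum[OF z] by simp
  qed
  define D where "D N = ?I - (\<Sum>k<N. y z k * y w k)" for N
  define G where "G N = (R2 z - (\<Sum>k<N. (cmod (y z k))\<^sup>2)) * R2 w" for N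
  have "G \<longlonglongrightarrow> (R2 z - R2 z) * R2 w"
    using a unfolding resolvent_approx_iff_Parseval[OF z] G_def by (intro tendsto_intros)
  then have "G \<longlonglongrightarrow> 0" by simp
  moreover have "\<forall>\<^sub>F N in sequentially. norm ((cmod (D N))\<^sup>2) \<le> G N"
    using le unfolding D_def G_def by (intro always_eventually allI) (simp only: real_norm_def abs_power2)
  ultimately have "(\<lambda>N. (cmod (D N))\<^sup>2) \<longlonglongrightarrow> 0"
    by (rule Lim_null_comparison[rotated])
  then have "(\<lambda>N. cmod (D N)) \<longlonglongrightarrow> 0" by (simp only: power_tendsto_0_iff zero_less_numeral)
  then have "D \<longlonglongrightarrow> 0" by (rule tendsto_norm_zero_cancel)
  from tendsto_diff[OF tendsto_const[of ?I] this] have "(\<lambda>N. \<Sum>k<N. y z k * y w k) \<longlonglongrightarrow> ?I"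
    unfolding D_def by (simp only: diff_diff_eq2 add_diff_cancel_left' diff_zero)
  from tendsto_mult[OF tendsto_const[of "z - w"] this] show ?thesis
    unfolding resolvent_product[OF z w] .
qed

end

section \<open>N-extremality\<close>

context mstar
begin

lemma cnj_poly_P: "cnj (poly (P n) z) = poly (P n) (cnj z)"
  by (simp add: poly_cnj_real coeff_map_poly)

lemma cnj_Pf: "Pf n (cnj z) = cnj (Pf n z)"
  by (simp add: Pf_eq cnj_poly_P)

lemma cnj_Qf: "Qf n (cnj z) = cnj (Qf n z)"
proof -
  let ?s = "synthetic_div (P n) z"
  have "poly (P n) w = poly ([:- cnj z, 1:] * map_poly cnj ?s + [:cnj (Pf n z):]) w" for w
  proof -
    have "cnj (poly (P n) (cnj w)) = cnj (poly ([:- z, 1:] * ?s + [:Pf n z:]) (cnj w))"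
      unfolding Pf_eq synthetic_div_correct' ..
    then show ?thesis by (simp add: cnj_poly_P)
  qed
  then have "P n = [:- cnj z, 1:] * map_poly cnj ?s + [:cnj (Pf n z):]"
    by (intro poly_eq_poly_eq_iff[THEN iffD1] ext)
  then have "synthetic_div (P n) (cnj z) = map_poly cnj ?s" by (rule synthetic_div_unique')
  then show ?thesis by (simp add: Qf_eq L_def)
qed

lemma cnj_Pf_0: "cnj (Pf n 0) = Pf n 0" and cnj_Qf_0: "cnj (Qf n 0) = Qf n 0"
  using cnj_Pf[of n 0] cnj_Qf[of n 0] by simp_all

definition An where "An N z = z * (\<Sum>n<N. Qf n 0 * Qf n z)"
definition Bn where "Bn N z = - 1 + z * (\<Sum>n<N. Qf n 0 * Pf n z)"
definition Cn where "Cn N z = 1 + z * (\<Sum>n<N. Pf n 0 * Qf n z)"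
definition Dn where "Dn N z = z * (\<Sum>n<N. Pf n 0 * Pf n z)"

lemmas ABCDn_def = An_def Bn_def Cn_def Dn_def

lemma sum_kern: "(\<Sum>k<n. kern 0 n k * g k) = Qf n 0 * (\<Sum>k<n. Pf k 0 * g k) - Pf n 0 * (\<Sum>k<n. Qf k 0 * g k)"
  by (simp add: kern_def sum_distrib_left sum_subtractf algebra_simps)

text \<open>The Volterra equation with base point \<open>0\<close>. Together with
  \<open>Qf_rep\<close> it plays the part of the three-term recurrence in the induction
  below.\<close>

lemma Pf_rep: "Pf n z = Qf n 0 * Dn n z - Pf n 0 * Bn n z"
proof -
  have "Pf n z = Pf n 0 + z * (\<Sum>k<n. kern 0 n k * Pf k z)" using P_shift[of n z 0] by simp
  then show ?thesis unfolding sum_kern by (simp add: Dn_def Bn_def algebra_simps)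
qed

lemma Qf_rep: "Qf n z = Qf n 0 * Cn n z - Pf n 0 * An n z"
proof -
  have "Qf n z = Qf n 0 + z * (\<Sum>k<n. kern 0 n k * Qf k z)" using Q_shift[of n z 0] by simp
  then show ?thesis unfolding sum_kern by (simp add: Cn_def An_def algebra_simps)
qed

text \<open>A Christoffel-Darboux formula for the solutions \<open>Q + f P\<close> and
  \<open>Q + g P\<close>. Free \<open>f\<close> and \<open>g\<close> let one induction yield both
  the determinant identity and, with the values of \<open>F\<close>, the defect in Parseval's
  identity.\<close>

lemma two_variable_identity:
  "(z - w) * (\<Sum>n<N. (Qf n z + f * Pf n z) * (Qf n w + g * Pf n w))
    = f - g - ((Cn N z + f * Dn N z) * (An N w + g * Bn N w) - (An N z + f * Bn N z) * (Cn N w + g * Dn N w))"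
proof (induction N)
  case 0
  then show ?case by (simp add: ABCDn_def)
next
  case (Suc N)
  define U V U' V' where "U = Cn N z + f * Dn N z" and "V = An N z + f * Bn N z"
    and "U' = Cn N w + g * Dn N w" and "V' = An N w + g * Bn N w"
  define a b where "a = Qf N z + f * Pf N z" and "b = Qf N w + g * Pf N w"
  define p q where "p = Pf N 0" and "q = Qf N 0"
  have a: "a = q * U - p * V" and b: "b = q * U' - p * V'"
    unfolding a_def b_def p_def q_def U_def V_def U'_def V'_def
      Pf_rep[of N z] Qf_rep[of N z] Pf_rep[of N w] Qf_rep[of N w]
    by (simp_all add: algebra_simps)
  have S: "Cn (Suc N) z + f * Dn (Suc N) z = U + z * p * a"
    "An (Suc N) z + f * Bn (Suc N) z = V + z * q * a"
    "Cn (Suc N) w + g * Dn (Suc N) w = U' + w * p * b"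
    "An (Suc N) w + g * Bn (Suc N) w = V' + w * q * b"
    by (simp_all add: ABCDn_def U_def V_def U'_def V'_def a_def b_def p_def q_def algebra_simps)
  have "(z - w) * (\<Sum>n<Suc N. (Qf n z + f * Pf n z) * (Qf n w + g * Pf n w))
    = f - g - (U * V' - V * U') + (z - w) * (a * b)"
    using Suc by (simp add: U_def V_def U'_def V'_def a_def b_def distrib_left)
  also have "\<dots> = f - g - ((U + z * p * a) * (V' + w * q * b) - (V + z * q * a) * (U' + w * p * b))"
  proof -
    \<comment> \<open>The terms with the factor \<open>z * w\<close> cancel; the remaining ones
      contain exactly the combinations that equal \<open>a\<close> and \<open>b\<close>.\<close>
    have "(U + z * p * a) * (V' + w * q * b) - (V + z * q * a) * (U' + w * p * b)
      = U * V' - V * U' + w * b * (q * U - p * V) - z * a * (q * U' - p * V')"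
      by (simp add: algebra_simps)
    also have "\<dots> = U * V' - V * U' - (z - w) * (a * b)"
      unfolding a[symmetric] b[symmetric] by (simp add: algebra_simps)
    finally show ?thesis by simp
  qed
  finally show ?case unfolding S .
qed

text \<open>At \<open>z = w\<close> the left side of the identity vanishes.\<close>

lemma det_n: "An N z * Dn N z - Bn N z * Cn N z = 1"
  using two_variable_identity[where z = z and w = z and N = N and f = 0 and g = 1] by (simp add: algebra_simps)

end

section \<open>The Nevanlinna functions and constant parameters\<close>

locale mstar_l2 = mstar +
  assumes l2_P: "\<And>z. summable (\<lambda>n. (cmod (Pf n z))\<^sup>2)"
    and l2_Q: "\<And>z. summable (\<lambda>n. (cmod (Qf n z))\<^sup>2)"
begin

lemma ABCD_lims:
  "(\<lambda>N. An N z) \<longlonglongrightarrow> nevanlinna_A \<mu> z" "(\<lambda>N. Bn N z) \<longlonglongrightarrow> nevanlinna_B \<mu> z"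
  "(\<lambda>N. Cn N z) \<longlonglongrightarrow> nevanlinna_C \<mu> z" "(\<lambda>N. Dn N z) \<longlonglongrightarrow> nevanlinna_D \<mu> z"
  unfolding ABCDn_def nevanlinna_A_def nevanlinna_B_def nevanlinna_C_def nevanlinna_D_def
  by (intro tendsto_intros summable_LIMSEQ summable_l2_mult l2_P l2_Q)+

abbreviation "NA \<equiv> nevanlinna_A \<mu>"
abbreviation "NB \<equiv> nevanlinna_B \<mu>"
abbreviation "NC \<equiv> nevanlinna_C \<mu>"
abbreviation "ND \<equiv> nevanlinna_D \<mu>"

lemma det: "NA z * ND z - NB z * NC z = 1"
proof -
  have "(\<lambda>N. An N z * Dn N z - Bn N z * Cn N z) \<longlonglongrightarrow> NA z * ND z - NB z * NC z"
    by (intro tendsto_intros ABCD_lims)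
  then show ?thesis unfolding det_n by (simp add: LIMSEQ_const_iff)
qed

text \<open>Clearing denominators, the Nevanlinna formula with constant \<open>t\<close> reads
  \<open>u z = t * v z\<close>, and with the parameter at infinity \<open>v z = 0\<close>.\<close>

definition u where "u z = NC z + F z * ND z"
definition v where "v z = NA z + F z * NB z"

lemma uv_nonzero: "u z \<noteq> 0 \<or> v z \<noteq> 0"
proof (rule ccontr)
  assume "\<not> ?thesis"
  then have "NC z = - F z * ND z" "NA z = - F z * NB z"
    unfolding u_def v_def by (auto simp: eq_neg_iff_add_eq_0)
  then show False using det[of z] by simp
qed

lemma two_variable_limit:
  "(\<lambda>N. (z - w) * (\<Sum>n<N. y z n * y w n)) \<longlonglongrightarrow> F z - F w - (u z * v w - v z * u w)"
  unfolding y_def two_variable_identity u_def v_def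
  by (intro tendsto_intros ABCD_lims)

lemma cnj_Nevanlinna:
  "NA (cnj z) = cnj (NA z)" "NB (cnj z) = cnj (NB z)"
  "NC (cnj z) = cnj (NC z)" "ND (cnj z) = cnj (ND z)"
proof -
  have "(\<lambda>N. cnj (An N z)) \<longlonglongrightarrow> cnj (NA z)" "(\<lambda>N. cnj (Bn N z)) \<longlonglongrightarrow> cnj (NB z)"
    "(\<lambda>N. cnj (Cn N z)) \<longlonglongrightarrow> cnj (NC z)" "(\<lambda>N. cnj (Dn N z)) \<longlonglongrightarrow> cnj (ND z)"
    by (intro tendsto_cnj ABCD_lims)+
  moreover have "cnj (An N z) = An N (cnj z)" "cnj (Bn N z) = Bn N (cnj z)"
    "cnj (Cn N z) = Cn N (cnj z)" "cnj (Dn N z) = Dn N (cnj z)" for N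
    by (simp_all add: ABCDn_def cnj_Pf cnj_Qf cnj_Pf_0 cnj_Qf_0)
  ultimately show "NA (cnj z) = cnj (NA z)" "NB (cnj z) = cnj (NB z)"
    "NC (cnj z) = cnj (NC z)" "ND (cnj z) = cnj (ND z)"
    using ABCD_lims[of "cnj z"] by (auto intro: LIMSEQ_unique)
qed

lemma cnj_uv: "u (cnj z) = cnj (u z)" "v (cnj z) = cnj (v z)"
  by (simp_all add: u_def v_def cnj_Nevanlinna stieltjes_transform_cnj)

lemma cnj_y: "y (cnj z) n = cnj (y z n)"
  by (simp add: y_def cnj_Pf cnj_Qf stieltjes_transform_cnj)

text \<open>Excludes zero denominators in the Nevanlinna formulas: division by \<open>0\<close>
  would make the right side, hence \<open>F z\<close>, equal to \<open>0\<close>.\<close>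

lemma F_nonzero:
  assumes z: "z \<notin> \<real>" shows "F z \<noteq> 0"
proof
  assume "F z = 0"
  moreover have "z - cnj z \<noteq> 0" using nonreal_Im[OF z] by (simp add: complex_eq_iff)
  ultimately have "R2 z = 0" using R2_eq[OF z] by simp
  then have "AE x in \<mu>. (cmod (1 / (complex_of_real x - z)))\<^sup>2 = 0"
    unfolding R2_def using integral_nonneg_eq_0_iff_AE[OF integrable_cmod2_resolvent[OF z]] by simp
  then have "AE x in \<mu>. False" using nonreal_neq[OF z] by simp
  then have "AE x in \<mu>. x \<notin> space \<mu>" by simp
  then have "emeasure \<mu> (space \<mu>) = 0" using AE_iff_null_sets[OF sets.top, of \<mu>] by auto
  then show False using mass_pos by (simp add: measure_def)
qed

text \<open>The case \<open>w = cnj z\<close> of \<open>two_variable_limit\<close>: there the sums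
  become those of Parseval's identity, and the defect is the antisymmetric expression in
  \<open>u\<close> and \<open>v\<close>.\<close>

lemma resolvent_approx_iff_uv:
  assumes z: "z \<notin> \<real>"
  shows "resolvent_approx \<mu> z \<longleftrightarrow> u z * cnj (v z) = v z * cnj (u z)"
proof -
  have nz: "z - cnj z \<noteq> 0" using nonreal_Im[OF z] by (simp add: complex_eq_iff)
  have eq: "(\<Sum>n<N. y z n * y (cnj z) n) = of_real (\<Sum>n<N. (cmod (y z n))\<^sup>2)" for N
    by (simp add: cnj_y complex_norm_square del: of_real_power)
  have lim: "(\<lambda>N. (z - cnj z) * of_real (\<Sum>n<N. (cmod (y z n))\<^sup>2))
      \<longlonglongrightarrow> (z - cnj z) * of_real (R2 z) - (u z * cnj (v z) - v z * cnj (u z))"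
    using two_variable_limit[of z "cnj z"] unfolding eq R2_eq[OF z] cnj_uv stieltjes_transform_cnj .
  show ?thesis
  proof
    assume "resolvent_approx \<mu> z"
    then have "(\<lambda>N. \<Sum>k<N. (cmod (y z k))\<^sup>2) \<longlonglongrightarrow> R2 z"
      unfolding resolvent_approx_iff_Parseval[OF z] .
    then have "(\<lambda>N. (z - cnj z) * of_real (\<Sum>n<N. (cmod (y z n))\<^sup>2)) \<longlonglongrightarrow> (z - cnj z) * of_real (R2 z)"
      by (intro tendsto_mult tendsto_const tendsto_of_real)
    from LIMSEQ_unique[OF lim this] show "u z * cnj (v z) = v z * cnj (u z)" by simp
  next
    assume "u z * cnj (v z) = v z * cnj (u z)"
    then have "(\<lambda>N. (z - cnj z) * of_real (\<Sum>n<N. (cmod (y z n))\<^sup>2)) \<longlonglongrightarrow> (z - cnj z) * of_real (R2 z)"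
      using lim by simp
    from tendsto_divide[OF this tendsto_const nz]
    have "(\<lambda>N. complex_of_real (\<Sum>n<N. (cmod (y z n))\<^sup>2)) \<longlonglongrightarrow> complex_of_real (R2 z)"
      unfolding nonzero_mult_div_cancel_left[OF nz] .
    then have "(\<lambda>N. \<Sum>n<N. (cmod (y z n))\<^sup>2) \<longlonglongrightarrow> R2 z"
      using tendsto_of_real_iff[where 'a = complex] by blast
    then show "resolvent_approx \<mu> z" unfolding resolvent_approx_iff_Parseval[OF z] .
  qed
qed

lemma Nevanlinna_constant_iff_resolvent_approx:
  "((\<exists>t::real. \<forall>z. z \<notin> \<real> \<longrightarrow> F z = - (NA z * of_real t - NC z) / (NB z * of_real t - ND z)) \<or>
    (\<forall>z. z \<notin> \<real> \<longrightarrow> F z = - NA z / NB z)) \<longleftrightarrow> (\<forall>z. z \<notin> \<real> \<longrightarrow> resolvent_approx \<mu> z)"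
  (is "?l1 \<or> ?l2 \<longleftrightarrow> ?r")
proof
  assume "?l1 \<or> ?l2"
  then show ?r
  proof
    assume ?l1
    then obtain t :: real where t: "\<And>z. z \<notin> \<real> \<Longrightarrow> F z = - (NA z * of_real t - NC z) / (NB z * of_real t - ND z)"
      by blast
    show ?r
    proof (intro allI impI)
      fix z :: complex assume z: "z \<notin> \<real>"
      \<comment> \<open>A vanishing denominator would give \<open>F z = 0\<close> through the value
        of division by \<open>0\<close>.\<close>
      have "NB z * of_real t - ND z \<noteq> 0" using F_nonzero[OF z] t[OF z] by auto
      then have "F z * (NB z * of_real t - ND z) = - (NA z * of_real t - NC z)"
        using t[OF z] by (simp add: nonzero_eq_divide_eq)
      then have "u z = of_real t * v z" by (simp add: u_def v_def algebra_simps)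
      then show "resolvent_approx \<mu> z" unfolding resolvent_approx_iff_uv[OF z] by simp
    qed
  next
    assume l: ?l2
    show ?r
    proof (intro allI impI)
      fix z :: complex assume z: "z \<notin> \<real>"
      have F: "F z = - NA z / NB z" using l z by blast
      then have "NB z \<noteq> 0" using F_nonzero[OF z] by auto
      then have "F z * NB z = - NA z" using F by simp
      then have "v z = 0" by (simp add: v_def)
      then show "resolvent_approx \<mu> z" unfolding resolvent_approx_iff_uv[OF z] by simp
    qed
  qed
next
  assume r: ?r
  have i: "\<i> \<notin> \<real>" by (simp add: complex_is_Real_iff)
  \<comment> \<open>Two computations of the same limit: one from the Nevanlinna functions, one from
    Parseval. Fixing \<open>w = \<i>\<close> makes the ratio of \<open>u\<close> and
    \<open>v\<close> independent of \<open>z\<close>.\<close>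
  have proportional: "u z * v \<i> = v z * u \<i>" if z: "z \<notin> \<real>" for z
    using LIMSEQ_unique[OF two_variable_limit[of z \<i>] Parseval_bilinear[OF z i]] r z by simp
  have real: "u \<i> * cnj (v \<i>) = v \<i> * cnj (u \<i>)"
    using r i resolvent_approx_iff_uv[OF i] by blast
  show "?l1 \<or> ?l2"
  \<comment> \<open>Here \<open>v \<i> = 0\<close> is the parameter at infinity; otherwise the
    parameter is \<open>u \<i> / v \<i>\<close>.\<close>
  proof (cases "v \<i> = 0")
    case True
    have ?l2
    proof (intro allI impI)
      fix z :: complex assume z: "z \<notin> \<real>"
      have "v z = 0" using proportional[OF z] True uv_nonzero[of \<i>] by simp
      then have v: "NA z = - F z * NB z" unfolding v_def by (simp add: eq_neg_iff_add_eq_0)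
      then have "NB z \<noteq> 0" using det[of z] by auto
      then show "F z = - NA z / NB z" using v by simp
    qed
    then show ?thesis ..
  next
    case False
    define c where "c = u \<i> / v \<i>"
    have "cnj c = c" using real False by (simp add: c_def field_simps)
    then have c: "c = of_real (Re c)" by (metis Reals_cnj_iff of_real_Re)
    have "\<forall>z. z \<notin> \<real> \<longrightarrow> F z = - (NA z * of_real (Re c) - NC z) / (NB z * of_real (Re c) - ND z)"
    proof (intro allI impI)
      fix z :: complex assume z: "z \<notin> \<real>"
      have "u z = c * v z" using proportional[OF z] False by (simp add: c_def field_simps)
      then have uv: "F z * (NB z * c - ND z) = - (NA z * c - NC z)"
        by (simp add: u_def v_def algebra_simps)
      \<comment> \<open>If it vanished, \<open>uv\<close> would make the numerator vanish too, and
        then the determinant would be \<open>0\<close> instead of \<open>1\<close>.\<close>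
      have "NB z * c - ND z \<noteq> 0"
      proof
        assume "NB z * c - ND z = 0"
        then have "ND z = NB z * c" "NC z = NA z * c" using uv by simp_all
        then show False using det[of z] by simp
      qed
      then have "F z = - (NA z * c - NC z) / (NB z * c - ND z)"
        using uv by (simp add: nonzero_eq_divide_eq)
      then show "F z = - (NA z * of_real (Re c) - NC z) / (NB z * of_real (Re c) - ND z)"
        unfolding c[symmetric] .
    qed
    then show ?thesis by blast
  qed
qed

end

section \<open>Transfer to the normalized measure\<close>

lemma Mstar_d_density_const_iff:
  assumes "\<mu> \<in> Mstar" "c > 0"
  shows "density \<mu> (\<lambda>_. ennreal c) \<in> Mstar_d \<longleftrightarrow> \<mu> \<in> Mstar_d"
proof -
  have imp: "density \<mu> (\<lambda>_. ennreal c) \<in> Mstar_d" if "\<mu> \<in> Mstar_d" "c > 0" for \<mu> c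
    unfolding Mstar_d_def
  proof (intro CollectI conjI ballI impI)
    have \<mu>: "\<mu> \<in> Mstar" using that(1) by (simp add: Mstar_d_def)
    show "density \<mu> (\<lambda>_. ennreal c) \<in> Mstar" by (rule density_const_Mstar[OF \<mu> that(2)])
    fix \<nu> assume \<nu>: "\<nu> \<in> Mstar" "\<forall>n. moment \<nu> n = moment (density \<mu> (\<lambda>_. ennreal c)) n"
    have ic: "1 / c > 0" using that(2) by simp
    have "density \<nu> (\<lambda>_. ennreal (1 / c)) \<in> Mstar" by (rule density_const_Mstar[OF \<nu>(1) ic])
    moreover have "moment (density \<nu> (\<lambda>_. ennreal (1 / c))) n = moment \<mu> n" for n
      using \<nu>(2) that(2) by (simp only: moment_density_const[OF ic] moment_density_const) simp
    ultimately have "density \<nu> (\<lambda>_. ennreal (1 / c)) = \<mu>" using that(1) by (simp add: Mstar_d_def)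
    then have "density \<mu> (\<lambda>_. ennreal c) = density (density \<nu> (\<lambda>_. ennreal (1 / c))) (\<lambda>_. ennreal c)" by simp
    also have "\<dots> = \<nu>"
      using that(2) ic by (subst density_density_eq) (auto simp: ennreal_mult[symmetric] density_1)
    finally show "\<nu> = density \<mu> (\<lambda>_. ennreal c)" ..
  qed
  have "density (density \<mu> (\<lambda>_. ennreal c)) (\<lambda>_. ennreal (1 / c)) = \<mu>"
    using assms(2) by (subst density_density_eq) (auto simp: ennreal_mult[symmetric] density_1)
  then show ?thesis using imp[of \<mu> c] imp[of "density \<mu> (\<lambda>_. ennreal c)" "1 / c"] assms(2) by auto
qed

lemma mstar_l2I:
  assumes "\<mu> \<in> Mstar" "a \<notin> \<real>" "\<not> christoffel_zero \<mu> a"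
  shows "mstar_l2 \<mu>"
proof -
  interpret mstar \<mu> by standard fact
  show ?thesis using summable_PQ_if_not_christoffel_zero[OF assms(2,3)] by unfold_locales auto
qed

text \<open>N-extremality speaks of the normalized measure, whereas approximability is invariant
  under scaling; indeterminacy supplies the point needed for square summability.\<close>

theorem N_extremal_iff_resolvent_approx:
  assumes "\<mu> \<in> Mstar_i"
  shows "N_extremal \<mu> \<longleftrightarrow> (\<forall>z. z \<notin> \<real> \<longrightarrow> resolvent_approx \<mu> z)"
proof -
  have \<mu>: "\<mu> \<in> Mstar" "\<mu> \<notin> Mstar_d" using assms by (auto simp: Mstar_i_def)
  interpret mstar \<mu> by standard fact
  define c where "c = 1 / measure \<mu> UNIV"
  have c: "c > 0" using mass_pos by (simp add: c_def)
  define \<sigma> where "\<sigma> = density \<mu> (\<lambda>_. ennreal c)"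
  have \<sigma>: "\<sigma> \<in> Mstar" "\<sigma> \<notin> Mstar_d"
    using density_const_Mstar[OF \<mu>(1) c] Mstar_d_density_const_iff[OF \<mu>(1) c] \<mu>(2) by (auto simp: \<sigma>_def)
  obtain a where "a \<notin> \<real>" "\<not> christoffel_zero \<sigma> a"
    using determinate_if_christoffel_zero[OF \<sigma>(1)] \<sigma>(2) by blast
  then interpret S: mstar_l2 \<sigma> using \<sigma>(1) by (intro mstar_l2I)
  have "normalize_mass \<mu> = \<sigma>" using normalize_mass_density[OF \<mu>(1)] by (simp add: \<sigma>_def c_def)
  then have "N_extremal \<mu> \<longleftrightarrow> (\<forall>z. z \<notin> \<real> \<longrightarrow> resolvent_approx \<sigma> z)"
    unfolding N_extremal_def Let_def using S.Nevanlinna_constant_iff_resolvent_approx by simp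
  then show ?thesis unfolding \<sigma>_def resolvent_approx_density_const[OF c] .
qed

section \<open>Gaussian quadrature\<close>

text \<open>Orthogonality is one degree short of that of an orthogonal polynomial of degree
  \<open>N\<close>. This is what the partial sums of \<open>B\<close> and \<open>D\<close> satisfy,
  and their degree may be \<open>N\<close> or \<open>N - 1\<close>.\<close>

locale quasi_orthogonal = mstar +
  fixes q :: "complex poly" and N :: nat
  assumes N: "2 \<le> N" and q_nonzero: "q \<noteq> 0" and degree_q_le: "degree q \<le> N"
    and q_real: "\<And>z. cnj (poly q z) = poly q (cnj z)"
    and q_orth: "\<And>p. degree p + 2 \<le> N \<Longrightarrow> L (q * p) = 0"
    and mass1: "measure \<mu> UNIV = 1"
begin

lemma degree_map_cnj: "degree (map_poly cnj p) = degree p"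
  by (rule degree_map_poly) simp

text \<open>With a smaller degree, \<open>q\<close> could be tested against its own conjugate and
  would have norm \<open>0\<close>.\<close>

lemma degree_q_ge: "N \<le> degree q + 1"
proof (rule ccontr)
  assume "\<not> ?thesis"
  then have "L (q * map_poly cnj q) = 0" by (intro q_orth) (simp add: degree_map_cnj)
  then show False using cmod2_poly_eq_0[of q] q_nonzero by (simp add: L_mult_cnj)
qed

text \<open>Testing \<open>q\<close> against the conjugate of the cofactor \<open>s\<close> gives
  the square norm of \<open>(X - z) s\<close>, which is positive. Nonreal \<open>z\<close> then
  yields real roots, and real \<open>z\<close> yields simple ones.\<close>

lemma no_conjugate_factors: "\<not> [:- z, 1:] * [:- cnj z, 1:] dvd q"
proof
  assume "[:- z, 1:] * [:- cnj z, 1:] dvd q"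
  then obtain s where s: "q = [:- z, 1:] * [:- cnj z, 1:] * s" by (elim dvdE)
  have "s \<noteq> 0" using s q_nonzero by auto
  have "degree q = degree [:- z, 1:] + degree [:- cnj z, 1:] + degree s"
    unfolding s using \<open>s \<noteq> 0\<close> by (subst degree_mult_eq, simp, simp)+ simp
  then have "degree s + 2 \<le> N" using degree_q_le by simp
  then have 0: "L (q * map_poly cnj s) = 0" by (intro q_orth) (simp add: degree_map_cnj)
  have "poly (q * map_poly cnj s) (complex_of_real x)
    = poly (([:- z, 1:] * s) * map_poly cnj ([:- z, 1:] * s)) (complex_of_real x)" for x
    unfolding s by (simp add: algebra_simps)
  then have "L (q * map_poly cnj s) = L (([:- z, 1:] * s) * map_poly cnj ([:- z, 1:] * s))"
    unfolding L_def by (simp only:)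
  then have "[:- z, 1:] * s = 0" using 0 cmod2_poly_eq_0[of "[:- z, 1:] * s"] by (simp only: L_mult_cnj) simp
  then show False using \<open>s \<noteq> 0\<close> by (simp only: mult_eq_0_iff) simp
qed

lemma roots_real:
  assumes "poly q z = 0" shows "z \<in> \<real>"
proof (rule ccontr)
  assume z: "z \<notin> \<real>"
  have "poly q (cnj z) = 0" using q_real[of z] assms by simp
  obtain s where s: "q = [:- z, 1:] * s" using assms by (auto simp: poly_eq_0_iff_dvd elim: dvdE)
  have "cnj z \<noteq> z" using z by (simp add: Reals_cnj_iff)
  then have "poly s (cnj z) = 0" using \<open>poly q (cnj z) = 0\<close> unfolding s by simp
  then have "[:- cnj z, 1:] dvd s" by (simp add: poly_eq_0_iff_dvd)
  then have "[:- z, 1:] * [:- cnj z, 1:] dvd q" unfolding s by (intro mult_dvd_mono) auto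
  then show False using no_conjugate_factors by blast
qed

lemma q_nonreal: "z \<notin> \<real> \<Longrightarrow> poly q z \<noteq> 0"
  using roots_real by blast

lemma rsquarefree_q: "rsquarefree q"
  unfolding rsquarefree_def
proof (intro conjI allI)
  fix a
  show "order a q = 0 \<or> order a q = 1"
  proof (rule ccontr)
    assume "\<not> ?thesis"
    then have o: "2 \<le> order a q" by linarith
    then have "poly q a = 0" using order_root[of q a] by auto
    then have "cnj a = a" using roots_real by (simp add: Reals_cnj_iff)
    moreover have "[:- a, 1:] ^ 2 dvd q" using o by (simp add: order_divides)
    ultimately have "[:- a, 1:] * [:- cnj a, 1:] dvd q" by (simp only: power2_eq_square)
    then show False using no_conjugate_factors by blast
  qed
qed (rule q_nonzero)

definition Z :: "real set" where "Z = {x. poly q (complex_of_real x) = 0}"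

lemma roots_Z: "{z. poly q z = 0} = complex_of_real ` Z"
  unfolding Z_def using roots_real by (auto simp: image_iff elim!: Reals_cases)

lemma finite_Z [simp]: "finite Z"
proof -
  have "finite (complex_of_real ` Z)" using poly_roots_finite[OF q_nonzero] by (simp add: roots_Z)
  then show ?thesis by (rule finite_imageD) (simp add: inj_on_def)
qed

lemma card_Z: "card Z = degree q"
proof -
  have "degree q = degree (smult (lead_coeff q) (\<Prod>z | poly q z = 0. [:- z, 1:]))"
    using complex_poly_decompose_rsquarefree[OF rsquarefree_q] by simp
  also have "\<dots> = degree (\<Prod>z | poly q z = 0. [:- z, 1:])" using q_nonzero by simp
  also have "\<dots> = (\<Sum>z | poly q z = 0. degree [:- z, 1:])"
    by (rule degree_prod_eq_sum_degree) simp
  also have "\<dots> = card (complex_of_real ` Z)" by (simp add: roots_Z)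
  also have "\<dots> = card Z" by (rule card_image) (simp add: inj_on_def)
  finally show ?thesis ..
qed

definition lagrange :: "real \<Rightarrow> complex poly" where
  "lagrange x = (\<Prod>t\<in>Z - {x}. smult (1 / complex_of_real (x - t)) [:- complex_of_real t, 1:])"

lemma degree_lagrange: "x \<in> Z \<Longrightarrow> degree (lagrange x) < degree q"
proof -
  assume x: "x \<in> Z"
  have "degree (lagrange x) \<le> (\<Sum>t\<in>Z - {x}. degree (smult (1 / complex_of_real (x - t)) [:- complex_of_real t, 1:]))"
    unfolding lagrange_def using degree_prod_sum_le[of "Z - {x}" "\<lambda>t. smult (1 / complex_of_real (x - t)) [:- complex_of_real t, 1:]"]
    by (simp only: o_def finite_Diff finite_Z simp_thms)
  also have "\<dots> \<le> (\<Sum>t\<in>Z - {x}. 1)" by (intro sum_mono) simp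
  also have "\<dots> = card Z - 1" using x by simp
  also have "\<dots> < card Z" using x card_gt_0_iff[of Z] by auto
  finally show ?thesis by (simp add: card_Z)
qed

lemma poly_lagrange:
  assumes "x \<in> Z" "t \<in> Z"
  shows "poly (lagrange x) (complex_of_real t) = (if t = x then 1 else 0)"
proof (cases "t = x")
  case True
  have "poly (lagrange x) (complex_of_real x) = (\<Prod>s\<in>Z - {x}. 1)"
    unfolding lagrange_def poly_prod by (intro prod.cong refl) (auto simp: diff_divide_distrib[symmetric])
  then show ?thesis using True by simp
next
  case False
  then have "poly (lagrange x) (complex_of_real t) = 0"
    unfolding lagrange_def poly_prod using assms by (intro prod_zero) auto
  then show ?thesis using False by simp
qed

definition w :: "real \<Rightarrow> complex" where "w x = L (lagrange x)"

lemma lagrange_interpolation: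
  assumes "degree r < degree q"
  shows "r = (\<Sum>x\<in>Z. smult (poly r (complex_of_real x)) (lagrange x))"
proof (rule poly_eqI_degree[of "complex_of_real ` Z"])
  have card: "card (complex_of_real ` Z) = degree q"
    unfolding card_Z[symmetric] by (rule card_image) (simp add: inj_on_def)
  show "degree r < card (complex_of_real ` Z)" using assms card by simp
  have "degree (\<Sum>x\<in>Z. smult (poly r (complex_of_real x)) (lagrange x)) < degree q"
    using assms degree_lagrange by (intro degree_sum_less) (auto intro: le_less_trans[OF degree_smult_le])
  then show "degree (\<Sum>x\<in>Z. smult (poly r (complex_of_real x)) (lagrange x)) < card (complex_of_real ` Z)"
    using card by simp
  fix z assume "z \<in> complex_of_real ` Z"
  then obtain t where t: "t \<in> Z" "z = complex_of_real t" by blast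
  have "poly (\<Sum>x\<in>Z. smult (poly r (complex_of_real x)) (lagrange x)) z
    = (\<Sum>x\<in>Z. if t = x then poly r (complex_of_real x) else 0)"
    unfolding poly_sum poly_smult t(2) using t(1) by (intro sum.cong refl) (simp add: poly_lagrange)
  also have "\<dots> = poly r z" using t by simp
  finally show "poly r z = poly (\<Sum>x\<in>Z. smult (poly r (complex_of_real x)) (lagrange x)) z" ..
qed

text \<open>Division by \<open>q\<close>: the quotient has degree at most \<open>N - 2\<close> and
  is annihilated, while the remainder has degree below the number of nodes and is interpolated
  exactly.\<close>

lemma quadrature_exact:
  assumes "degree p + 2 \<le> degree q + N"
  shows "L p = (\<Sum>x\<in>Z. w x * poly p (complex_of_real x))"
proof -
  have q1: "degree q \<ge> 1" using degree_q_ge N by linarith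
  let ?g = "p div q" and ?r = "p mod q"
  have p: "p = q * ?g + ?r" by simp
  have r: "degree ?r < degree q" using degree_mod_less'[of q p] q1 q_nonzero by (cases "?r = 0") auto
  have "L (q * ?g) = 0"
  proof (cases "?g = 0")
    case False
    then have d: "degree (q * ?g) = degree q + degree ?g" using q_nonzero by (simp add: degree_mult_eq)
    then have "degree ?r < degree (q * ?g)" using r by linarith
    then have "degree (q * ?g + ?r) = degree (q * ?g)" by (rule degree_add_eq_left)
    then have "degree p = degree q + degree ?g" using p d by simp
    then show ?thesis using assms by (intro q_orth) linarith
  qed simp
  then have "L p = L ?r" using p L_add[of "q * ?g" ?r] by simp
  also have "\<dots> = (\<Sum>x\<in>Z. poly ?r (complex_of_real x) * w x)"
    by (subst lagrange_interpolation[OF r]) (simp add: L_sum L_smult w_def)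
  also have "\<dots> = (\<Sum>x\<in>Z. w x * poly p (complex_of_real x))"
  proof (intro sum.cong refl)
    fix x assume "x \<in> Z"
    then have "poly p (complex_of_real x) = poly ?r (complex_of_real x)"
      by (subst p) (simp only: poly_add poly_mult, simp add: Z_def)
    then show "poly ?r (complex_of_real x) * w x = w x * poly p (complex_of_real x)" by (simp add: mult.commute)
  qed
  finally show ?thesis .
qed

text \<open>The weight is the square norm of the Lagrange polynomial. The squared modulus has degree
  at most \<open>2 * (degree q - 1)\<close>, within the range of exactness because
  \<open>degree q \<le> N\<close>.\<close>

lemma w_nonneg:
  assumes "x \<in> Z" shows "w x = complex_of_real (Re (w x))" "0 \<le> Re (w x)"
proof -
  let ?l = "lagrange x"
  have "degree (?l * map_poly cnj ?l) \<le> degree ?l + degree ?l"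
    using degree_mult_le[of ?l "map_poly cnj ?l"] by (simp add: degree_map_cnj)
  then have "degree (?l * map_poly cnj ?l) + 2 \<le> degree q + N"
    using degree_lagrange[OF assms] degree_q_le by linarith
  then have "L (?l * map_poly cnj ?l) = (\<Sum>t\<in>Z. w t * poly (?l * map_poly cnj ?l) (complex_of_real t))"
    by (rule quadrature_exact)
  also have "\<dots> = (\<Sum>t\<in>Z. if t = x then w t else 0)"
    using assms by (intro sum.cong refl) (simp add: poly_lagrange)
  also have "\<dots> = w x" using assms by simp
  finally have w: "w x = complex_of_real (LINT x|\<mu>. (cmod (poly ?l (complex_of_real x)))\<^sup>2)"
    unfolding L_mult_cnj ..
  show "w x = complex_of_real (Re (w x))" unfolding w by simp
  show "0 \<le> Re (w x)" unfolding w by (simp add: integral_nonneg_AE)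
qed

text \<open>Pushed forward to \<open>borel\<close> because the point measure itself lives on the
  space \<open>Z\<close> with all its subsets.\<close>

definition quadrature :: "real measure" where
  "quadrature = distr (point_measure Z (\<lambda>x. ennreal (Re (w x)))) borel (\<lambda>x. x)"

lemma integral_quadrature:
  fixes f :: "real \<Rightarrow> 'b::{banach, second_countable_topology}"
  assumes f: "f \<in> borel_measurable borel"
  shows "integrable quadrature f" "(LINT x|quadrature. f x) = (\<Sum>x\<in>Z. Re (w x) *\<^sub>R f x)"
proof -
  have m: "(\<lambda>x. x) \<in> measurable (point_measure Z (\<lambda>x. ennreal (Re (w x)))) borel" by simp
  have "integrable (point_measure Z (\<lambda>x. ennreal (Re (w x)))) f"
    by (rule integrable_point_measure_finite) simp
  then show "integrable quadrature f"
    unfolding quadrature_def using m f by (simp add: integrable_distr_eq)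
  show "(LINT x|quadrature. f x) = (\<Sum>x\<in>Z. Re (w x) *\<^sub>R f x)"
    unfolding quadrature_def integral_distr[OF m f]
    by (rule lebesgue_integral_point_measure_finite) (auto simp: w_nonneg(2))
qed

lemma integral_quadrature_complex:
  assumes "f \<in> borel_measurable borel"
  shows "(LINT x|quadrature. f x) = (\<Sum>x\<in>Z. w x * (f x :: complex))"
  unfolding integral_quadrature(2)[OF assms] scaleR_conv_of_real
  by (intro sum.cong refl) (simp only: w_nonneg(1)[symmetric])

lemma quadrature_poly:
  assumes "degree p + 2 \<le> degree q + N"
  shows "(LINT x|quadrature. poly p (complex_of_real x)) = L p"
  unfolding quadrature_exact[OF assms]
  by (rule integral_quadrature_complex) (intro borel_measurable_continuous_onI continuous_intros)

lemma real_distribution_quadrature: "real_distribution quadrature"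
proof -
  have "degree (1::complex poly) + 2 \<le> degree q + N" using N by simp
  from quadrature_exact[OF this] have "(\<Sum>x\<in>Z. w x) = 1" by (simp add: L_def mass1)
  then have "(\<Sum>x\<in>Z. Re (w x)) = 1" by (metis Re_sum one_complex.sel(1))
  then have "emeasure (point_measure Z (\<lambda>x. ennreal (Re (w x)))) Z = 1"
    by (simp add: emeasure_point_measure_finite sum_ennreal w_nonneg(2))
  then have "prob_space (point_measure Z (\<lambda>x. ennreal (Re (w x))))"
    by (intro prob_spaceI) (simp add: space_point_measure)
  then have "prob_space quadrature" unfolding quadrature_def
    by (rule prob_space.prob_space_distr) simp
  then show ?thesis
    by (simp add: real_distribution_def real_distribution_axioms_def quadrature_def)
qed

text \<open>At a node \<open>x\<close> the quotient of \<open>q\<close> takes the value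
  \<open>- poly q z / (x - z)\<close>, so exactness for this quotient evaluates the
  transform.\<close>

lemma stieltjes_quadrature:
  assumes z: "z \<notin> \<real>"
  shows "stieltjes_transform quadrature z = - L (synthetic_div q z) / poly q z"
proof -
  have q1: "degree q \<ge> 1" using degree_q_ge N by linarith
  have s: "(complex_of_real x - z) * poly (synthetic_div q z) (complex_of_real x) = - poly q z" if "x \<in> Z" for x
  proof -
    have "0 = poly ([:- z, 1:] * synthetic_div q z + [:poly q z:]) (complex_of_real x)"
      unfolding synthetic_div_correct' using that by (simp add: Z_def)
    then show ?thesis by (simp add: algebra_simps eq_neg_iff_add_eq_0)
  qed
  have "L (synthetic_div q z) = (\<Sum>x\<in>Z. w x * poly (synthetic_div q z) (complex_of_real x))"
    using q1 N by (intro quadrature_exact) (simp add: degree_synthetic_div)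
  also have "\<dots> = (\<Sum>x\<in>Z. - poly q z * (w x * (1 / (complex_of_real x - z))))"
  proof (intro sum.cong refl)
    fix x assume "x \<in> Z"
    then have "poly (synthetic_div q z) (complex_of_real x) = - poly q z / (complex_of_real x - z)"
      using s[of x] nonreal_neq[OF z, of x] by (metis nonzero_eq_divide_eq mult.commute)
    then show "w x * poly (synthetic_div q z) (complex_of_real x) = - poly q z * (w x * (1 / (complex_of_real x - z)))"
      by simp
  qed
  also have "\<dots> = - poly q z * stieltjes_transform quadrature z"
    unfolding stieltjes_transform_def sum_distrib_left[symmetric]
    by (subst integral_quadrature_complex) auto
  finally show ?thesis using q_nonreal[OF z] by simp
qed

end

section \<open>The partial sums of B and D are quasi-orthogonal\<close>

context mstar
begin

definition qD :: "nat \<Rightarrow> complex poly" where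
  "qD N = [:0, 1:] * (\<Sum>k<N. smult (Pf k 0) (P k))"

definition qB :: "nat \<Rightarrow> complex poly" where
  "qB N = [:0, 1:] * (\<Sum>k<N. smult (Qf k 0) (P k)) + [:- 1:]"

lemma poly_qD: "poly (qD N) z = Dn N z"
  by (simp add: qD_def Dn_def poly_sum Pf_eq)

lemma poly_qB: "poly (qB N) z = Bn N z"
  by (simp add: qB_def Bn_def poly_sum Pf_eq)

lemma degree_P_sum: "N > 0 \<Longrightarrow> degree ([:0, 1:] * (\<Sum>k<N. smult (c k) (P k))) \<le> N"
proof -
  assume "N > 0"
  then have "degree (\<Sum>k<N. smult (c k) (P k)) < N"
    by (intro degree_sum_less) (auto intro: le_less_trans[OF degree_smult_le])
  then show ?thesis using degree_mult_le[of "[:0, 1:]" "\<Sum>k<N. smult (c k) (P k)"] by simp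
qed

lemma sum_L_P:
  assumes "N > 0" shows "(\<Sum>k<N. c k * L (P k)) = c 0 * L (P 0)"
proof -
  have "L (P k) = 0" if "k \<noteq> 0" for k using L_P[of k 0] Pf_0_nonzero[of 0] that by simp
  then have "(\<Sum>k<N. c k * L (P k)) = (\<Sum>k<N. if k = 0 then c 0 * L (P 0) else 0)"
    by (intro sum.cong) auto
  then show ?thesis using assms by simp
qed

text \<open>Identifies \<open>Cn\<close> as the second-kind companion of \<open>Dn\<close>. Only
  \<open>k = 0\<close> contributes to the sum of the \<open>L (P k)\<close>, and it yields the
  constant \<open>1\<close> of \<open>Cn\<close>.\<close>

lemma L_synthetic_div_qD:
  assumes "N > 0" shows "L (synthetic_div (qD N) z) = Cn N z"
proof -
  let ?T = "\<Sum>k<N. smult (Pf k 0) (P k)"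
  have "synthetic_div (qD N) z = ?T + smult z (synthetic_div ?T z)"
    using synthetic_div_linear_mult[of 0 ?T 0 z] by (simp add: qD_def)
  then have "L (synthetic_div (qD N) z) = (\<Sum>k<N. Pf k 0 * L (P k)) + z * (\<Sum>k<N. Pf k 0 * Qf k z)"
    by (simp only: L_add L_smult L_sum synthetic_div_sum synthetic_div_smult Qf_eq)
  then show ?thesis using L_P[of 0 0] by (simp add: sum_L_P[OF assms] Cn_def mult.commute)
qed

text \<open>The constant \<open>- 1\<close> in \<open>qB\<close> does not affect the quotient, and
  the term \<open>k = 0\<close> vanishes because \<open>Qf 0 z = 0\<close>.\<close>

lemma L_synthetic_div_qB:
  assumes "N > 0" shows "L (synthetic_div (qB N) z) = An N z"
proof -
  let ?T = "\<Sum>k<N. smult (Qf k 0) (P k)"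
  have "synthetic_div (qB N) z = ?T + smult z (synthetic_div ?T z)"
    using synthetic_div_linear_mult[of 0 ?T "- 1" z] by (simp add: qB_def)
  then have "L (synthetic_div (qB N) z) = (\<Sum>k<N. Qf k 0 * L (P k)) + z * (\<Sum>k<N. Qf k 0 * Qf k z)"
    by (simp only: L_add L_smult L_sum synthetic_div_sum synthetic_div_smult Qf_eq)
  then show ?thesis by (simp add: sum_L_P[OF assms] An_def)
qed

lemma shifted_expansion:
  assumes "degree p + 2 \<le> N"
  shows "[:0, 1:] * p = (\<Sum>k<N. smult (L ([:0, 1:] * p * P k)) (P k))"
proof (rule P_expansion)
  fix i assume "N \<le> i"
  moreover have "degree ([:0, 1:] * p) \<le> degree p + 1" using degree_mult_le[of "[:0, 1:]" p] by simp
  ultimately show "coeff ([:0, 1:] * p) i = 0" using assms by (intro coeff_eq_0) linarith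
qed

text \<open>The sum of \<open>Pf k 0\<close> times \<open>P k\<close> reproduces evaluation at
  \<open>0\<close> on degrees below \<open>N\<close>, and \<open>[:0, 1:] * p\<close> vanishes at
  \<open>0\<close>.\<close>

lemma qD_orth:
  assumes "degree p + 2 \<le> N" shows "L (qD N * p) = 0"
proof -
  have "L (qD N * p) = L ((\<Sum>k<N. smult (Pf k 0) (P k)) * ([:0, 1:] * p))"
    unfolding qD_def by (simp only: ac_simps)
  also have "\<dots> = (\<Sum>k<N. Pf k 0 * L ([:0, 1:] * p * P k))"
    by (simp only: sum_distrib_right L_sum mult_smult_left L_smult mult.commute[of "P _"])
  also have "\<dots> = poly (\<Sum>k<N. smult (L ([:0, 1:] * p * P k)) (P k)) 0"
    by (simp add: poly_sum Pf_eq mult.commute)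
  also have "\<dots> = 0" unfolding shifted_expansion[OF assms, symmetric] by simp
  finally show ?thesis .
qed

text \<open>The sum of \<open>Qf k 0\<close> times \<open>P k\<close> represents the functional that
  divides by the variable and then applies \<open>L\<close>. On \<open>[:0, 1:] * p\<close> it gives
  \<open>L p\<close>, which the constant \<open>- 1\<close> in \<open>qB\<close> cancels.\<close>

lemma qB_orth:
  assumes "degree p + 2 \<le> N" shows "L (qB N * p) = 0"
proof -
  have "qB N * p = (\<Sum>k<N. smult (Qf k 0) (P k)) * ([:0, 1:] * p) - p"
    unfolding qB_def by (simp add: algebra_simps)
  then have "L (qB N * p) = L ((\<Sum>k<N. smult (Qf k 0) (P k)) * ([:0, 1:] * p)) - L p"
    by (simp only: L_diff)
  also have "L ((\<Sum>k<N. smult (Qf k 0) (P k)) * ([:0, 1:] * p)) = (\<Sum>k<N. Qf k 0 * L ([:0, 1:] * p * P k))"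
    by (simp only: sum_distrib_right L_sum mult_smult_left L_smult mult.commute[of "P _"])
  also have "\<dots> = L (synthetic_div (\<Sum>k<N. smult (L ([:0, 1:] * p * P k)) (P k)) 0)"
    by (simp only: synthetic_div_sum synthetic_div_smult L_sum L_smult Qf_eq mult.commute)
  also have "\<dots> = L p"
    unfolding shifted_expansion[OF assms, symmetric]
    using synthetic_div_linear_mult[of 0 p 0 0] by simp
  finally show ?thesis by simp
qed

lemma qD_nonzero:
  assumes "N > 0" shows "qD N \<noteq> 0"
proof
  assume "qD N = 0"
  then have "(\<Sum>k<N. smult (Pf k 0) (P k)) = 0" unfolding qD_def by (simp only: mult_eq_0_iff) simp
  then have "(\<Sum>k<N. Pf k 0 * L (P k)) = 0"
    using L_sum[of "\<lambda>k. smult (Pf k 0) (P k)" "{..<N}"] by (simp only: L_smult L_0)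
  then show False using L_P[of 0 0] by (auto simp: sum_L_P[OF assms] mult.commute)
qed

lemma qB_nonzero: "qB N \<noteq> 0"
  using poly_qB[of N 0] by (auto simp: Bn_def)

lemma quasi_orthogonal_qD:
  assumes "2 \<le> N" "measure \<mu> UNIV = 1" shows "quasi_orthogonal \<mu> (qD N) N"
proof unfold_locales
  show "degree (qD N) \<le> N" unfolding qD_def using assms(1) by (intro degree_P_sum) simp
  show "cnj (poly (qD N) z) = poly (qD N) (cnj z)" for z
    by (simp add: poly_qD Dn_def cnj_Pf cnj_Pf_0)
qed (use assms qD_orth qD_nonzero in auto)

lemma quasi_orthogonal_qB:
  assumes "2 \<le> N" "measure \<mu> UNIV = 1" shows "quasi_orthogonal \<mu> (qB N) N"
proof unfold_locales
  show "degree (qB N) \<le> N" unfolding qB_def using assms(1) degree_P_sum[of N "\<lambda>k. Qf k 0"]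
    by (intro degree_add_le) auto
  show "cnj (poly (qB N) z) = poly (qB N) (cnj z)" for z
    by (simp add: poly_qB Bn_def cnj_Pf cnj_Qf_0)
qed (use assms qB_orth qB_nonzero in auto)

end

section \<open>Weak limits of quadratures and determinacy\<close>

text \<open>The complement is a union of possibly uncountably many open null sets; Lindelof reduces
  it to a countable union.\<close>

lemma measure_support_compl_null:
  fixes M :: "real measure"
  assumes "sets M = sets borel"
  shows "emeasure M (- measure_support M) = 0"
proof -
  define \<F> where "\<F> = {U. open U \<and> emeasure M U = 0}"
  have U: "- measure_support M = \<Union>\<F>"
    by (auto simp: measure_support_def \<F>_def zero_less_iff_neq_zero)
  obtain \<G> where G: "\<G> \<subseteq> \<F>" "countable \<G>" "\<Union>\<G> = \<Union>\<F>"
    by (rule Lindelof[of \<F>]) (auto simp: \<F>_def)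
  have "\<Union>\<G> \<in> null_sets M"
  proof -
    have "(\<Union>U\<in>\<G>. U) \<in> null_sets M"
      using G(1,2) assms by (intro null_sets_UN') (auto simp: \<F>_def null_sets_def)
    then show ?thesis by simp
  qed
  then show ?thesis unfolding U G(3)[symmetric] by auto
qed

text \<open>If the support were finite, the square of a polynomial vanishing on it would have
  integral \<open>0\<close>, but the moments give it the positive integral it has for
  \<open>\<sigma>\<close>.\<close>

lemma Mstar_if_same_moments:
  assumes \<sigma>: "\<sigma> \<in> Mstar" and M: "sets M = sets borel" and int: "\<And>n. integrable M (\<lambda>x. x ^ n)"
    and mom: "\<And>n. moment M n = moment \<sigma> n"
  shows "M \<in> Mstar"
proof -
  interpret mstar \<sigma> by standard fact
  have "infinite (measure_support M)"
  proof
    assume fin: "finite (measure_support M)"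
    define p :: "real poly" where "p = (\<Prod>s\<in>measure_support M. [:- s, 1:])"
    have "p \<noteq> 0" using fin by (simp add: p_def)
    then have "0 < ip p p" by (rule ip_self_pos)
    have lin: "(LINT x|R. poly q x) = (\<Sum>i\<le>degree q. coeff q i * moment R i)"
      if "\<And>n. integrable R (\<lambda>x. x ^ n)" for R and q :: "real poly"
      unfolding poly_altdef moment_def using that by (subst Bochner_Integration.integral_sum) auto
    have "(LINT x|M. poly (p * p) x) = (LINT x|\<sigma>. poly (p * p) x)"
      using lin[of M "p * p"] lin[of \<sigma> "p * p"] int integrable_power mom by simp
    also have "\<dots> = ip p p" by (simp add: ip_def)
    finally have "0 < (LINT x|M. poly (p * p) x)" using \<open>0 < ip p p\<close> by simp
    moreover have "AE x in M. poly (p * p) x = 0"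
    proof (rule AE_I)
      show "emeasure M (- measure_support M) = 0" by (rule measure_support_compl_null[OF M])
      show "- measure_support M \<in> sets M" using fin M by (simp add: borel_open finite_imp_closed)
      show "{x \<in> space M. poly (p * p) x \<noteq> 0} \<subseteq> - measure_support M"
        using fin by (auto simp: p_def poly_prod)
    qed
    then have "(LINT x|M. poly (p * p) x) = 0" by (rule integral_eq_zero_AE)
    ultimately show False by simp
  qed
  then show ?thesis using M int by (simp add: Mstar_def)
qed

section \<open>Tightness and convergence of moments\<close>

lemma tight_if_second_moment_bounded:
  assumes rd: "\<And>k. real_distribution (\<rho> k)" and int: "\<And>k. integrable (\<rho> k) (\<lambda>x. x\<^sup>2)"
    and bound: "\<And>k. (LINT x|\<rho> k. x\<^sup>2) \<le> B"
  shows "tight \<rho>"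
  unfolding tight_def
proof (intro conjI allI impI rd)
  fix e :: real assume e: "e > 0"
  have "0 \<le> (LINT x|\<rho> 0. x\<^sup>2)" by (intro integral_nonneg_AE) simp
  then have B: "0 \<le> B" using bound[of 0] by linarith
  \<comment> \<open>Chebyshev needs \<open>B / a^2 < e\<close>; the \<open>+ 1\<close> keeps this
    strict and \<open>a\<close> positive when \<open>B = 0\<close>.\<close>
  define a where "a = sqrt ((B + 1) / e)"
  have a: "a > 0" "a\<^sup>2 = (B + 1) / e" using B e by (auto simp: a_def)
  have a2: "0 < a\<^sup>2" using a(1) by (rule zero_less_power)
  have "1 - e < measure (\<rho> k) {- a<..a}" for k
  proof -
    interpret real_distribution "\<rho> k" by (rule rd)
    have "prob {x \<in> space (\<rho> k). a\<^sup>2 \<le> x\<^sup>2} \<le> (LINT x|\<rho> k. x\<^sup>2) / a\<^sup>2"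
      by (rule integral_Markov_inequality_measure[OF int, of "{}"]) (use a2 in auto)
    also have "\<dots> \<le> B / a\<^sup>2" using bound[of k] by (intro divide_right_mono) auto
    also have "\<dots> < e" unfolding a(2) using B e by (simp add: field_simps)
    finally have lt: "prob {x. a\<^sup>2 \<le> x\<^sup>2} < e" by simp
    have "{x. a\<^sup>2 \<le> x\<^sup>2} \<in> events" by measurable
    then have "prob (UNIV - {x. a\<^sup>2 \<le> x\<^sup>2}) = 1 - prob {x. a\<^sup>2 \<le> x\<^sup>2}"
      using prob_compl[of "{x. a\<^sup>2 \<le> x\<^sup>2}"] by simp
    moreover have "prob (UNIV - {x. a\<^sup>2 \<le> x\<^sup>2}) \<le> prob {- a<..a}"
    proof (rule finite_measure_mono)
      show "UNIV - {x. a\<^sup>2 \<le> x\<^sup>2} \<subseteq> {- a<..a}"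
      proof
        fix x assume "x \<in> UNIV - {x. a\<^sup>2 \<le> x\<^sup>2}"
        then have "\<bar>x\<bar> < \<bar>a\<bar>" by (simp add: abs_le_square_iff[symmetric] not_le)
        then show "x \<in> {- a<..a}" using a(1) by auto
      qed
    qed simp
    ultimately show ?thesis using lt by linarith
  qed
  then show "\<exists>a b. a < b \<and> (\<forall>n. 1 - e < measure (\<rho> n) {a<..b})"
    using a(1) by (intro exI[of _ "- a"] exI[of _ a]) auto
qed

lemma abs_power_le_even: "\<bar>x ^ n\<bar> \<le> 1 + x ^ (2 * n)" for x :: real
proof -
  have "2 * \<bar>x ^ n\<bar> \<le> 1 + \<bar>x ^ n\<bar>\<^sup>2" using zero_le_power2[of "1 - \<bar>x ^ n\<bar>"] by (simp add: power2_diff)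
  moreover have "\<bar>x ^ n\<bar>\<^sup>2 = x ^ (2 * n)" by (simp add: power_mult[symmetric] mult.commute)
  ultimately show ?thesis using abs_ge_zero[of "x ^ n"] by linarith
qed

text \<open>Weak convergence sees only bounded continuous functions. Truncation at level
  \<open>K\<close> costs at most the moment of order \<open>2 * n\<close> divided by
  \<open>K\<close>, for all large \<open>k\<close> alike, so \<open>K\<close> can tend to infinity
  after \<open>k\<close>.\<close>

lemma weak_limit_moments:
  fixes s :: "nat \<Rightarrow> real"
  assumes rd: "\<And>k. real_distribution (\<rho> k)" and int: "\<And>k n. integrable (\<rho> k) (\<lambda>x. x ^ n)"
    and mom: "\<And>n. \<forall>\<^sub>F k in sequentially. (LINT x|\<rho> k. x ^ n) = s n"
    and M: "real_distribution M" and conv: "weak_conv_m \<rho> M"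
  shows "integrable M (\<lambda>x. x ^ n)" and "(LINT x|M. x ^ n) = s n"
proof -
  interpret M: real_distribution M by fact
  have wc: "(\<lambda>k. LINT x|\<rho> k. f x) \<longlonglongrightarrow> (LINT x|M. f x)"
    if "\<And>x. isCont f x" "\<And>x. norm (f x) \<le> B" for f :: "real \<Rightarrow> real" and B
    using weak_conv_imp_integral_bdd_continuous_conv[OF rd M conv, of f B] that by blast
  have even: "integrable M (\<lambda>x. x ^ (2 * n))" for n
  proof -
    \<comment> \<open>Integrability of even powers comes first: the integrals of the truncations
      stay below \<open>s (2 * n)\<close>, and monotone convergence applies.\<close>
    define h where "h K x = min (x ^ (2 * n)) (real K)" for K x
    have h0: "0 \<le> h K x" "h K x \<le> real K" "h K x \<le> x ^ (2 * n)" for K x by (auto simp: h_def)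
    have hc: "isCont (h K) x" for K x unfolding h_def[abs_def] by (intro continuous_intros)
    have [measurable]: "h K \<in> borel_measurable borel" for K unfolding h_def[abs_def] by measurable
    have hint: "integrable M (h K)" for K
      by (rule M.integrable_const_bound[of _ "real K"]) (auto simp: h0)
    have le: "(LINT x|M. h K x) \<le> s (2 * n)" for K
    proof (rule tendsto_upperbound[OF wc[OF hc, of K "real K"]])
      show "\<forall>\<^sub>F k in sequentially. (LINT x|\<rho> k. h K x) \<le> s (2 * n)"
        using mom[of "2 * n"]
      proof eventually_elim
        case (elim k)
        interpret R: real_distribution "\<rho> k" by (rule rd)
        have "(LINT x|\<rho> k. h K x) \<le> (LINT x|\<rho> k. x ^ (2 * n))"
          by (intro integral_mono int R.integrable_const_bound[of _ "real K"]) (auto simp: h0)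
        then show ?case using elim by simp
      qed
    qed (auto simp: h0)
    have mono: "incseq (\<lambda>K. LINT x|M. h K x)"
      by (intro incseq_SucI integral_mono hint) (auto simp: h_def)
    obtain l where l: "(\<lambda>K. LINT x|M. h K x) \<longlonglongrightarrow> l"
      using incseq_convergent[OF mono, of "s (2 * n)"] le by blast
    show ?thesis
    proof (rule integrable_monotone_convergence[where f=h])
      show "AE x in M. mono (\<lambda>K. h K x)" by (auto simp: h_def mono_def)
      show "AE x in M. (\<lambda>K. h K x) \<longlonglongrightarrow> x ^ (2 * n)"
      proof (intro AE_I2)
        fix x :: real
        show "(\<lambda>K. h K x) \<longlonglongrightarrow> x ^ (2 * n)"
        proof (rule tendsto_eventually, rule eventually_sequentiallyI)
          fix K assume "nat \<lceil>x ^ (2 * n)\<rceil> \<le> K"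
          then have "x ^ (2 * n) \<le> real K" by linarith
          then show "h K x = x ^ (2 * n)" by (simp add: h_def)
        qed
      qed
      show "(\<lambda>K. LINT x|M. h K x) \<longlonglongrightarrow> l" by (rule l)
    qed (use hint in auto)
  qed
  show intn: "integrable M (\<lambda>x. x ^ n)" for n
  proof (rule Bochner_Integration.integrable_bound)
    show "integrable M (\<lambda>x. 1 + x ^ (2 * n))" using even by auto
    show "AE x in M. norm (x ^ n) \<le> norm (1 + x ^ (2 * n))"
      using abs_power_le_even[of _ n] by (auto intro!: AE_I2 order.trans[OF _ abs_ge_self])
  qed simp
  define m where "m = (LINT x|M. x ^ (2 * n))"
  have main: "\<bar>s n - (LINT x|M. x ^ n)\<bar> \<le> (s (2 * n) + m) / K" if K: "K > 0" for K :: real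
  proof -
    define g where "g x = max (- K) (min K (x ^ n))" for x
    have gc: "isCont g x" for x unfolding g_def[abs_def] by (intro continuous_intros)
    have gb: "norm (g x) \<le> K" for x using K by (auto simp: g_def)
    have [measurable]: "g \<in> borel_measurable borel" unfolding g_def[abs_def] by measurable
    \<comment> \<open>Where the cutoff is active, \<open>|x^n| > K\<close>, so an extra factor
      \<open>|x^n| / K\<close> only enlarges the bound.\<close>
    have diff: "\<bar>x ^ n - g x\<bar> \<le> x ^ (2 * n) / K" for x
    proof (cases "\<bar>x ^ n\<bar> \<le> K")
      case True
      then have "g x = x ^ n" by (auto simp: g_def)
      then show ?thesis using K by simp
    next
      case False
      then have "\<bar>x ^ n - g x\<bar> \<le> \<bar>x ^ n\<bar>" using K by (auto simp: g_def)
      also have "\<dots> \<le> \<bar>x ^ n\<bar> * \<bar>x ^ n\<bar> / K"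
        using False K mult_right_mono[of K "\<bar>x ^ n\<bar>" "\<bar>x ^ n\<bar>"] by (simp add: field_simps)
      also have "\<dots> = x ^ (2 * n) / K" by (simp add: abs_mult[symmetric] power_add[symmetric] mult_2)
      finally show ?thesis .
    qed
    have trunc: "\<bar>(LINT x|R. x ^ n) - (LINT x|R. g x)\<bar> \<le> (LINT x|R. x ^ (2 * n)) / K"
      if R: "real_distribution R" "\<And>n. integrable R (\<lambda>x. x ^ n)" for R
    proof -
      interpret R: real_distribution R by fact
      have gi: "integrable R g" by (rule R.integrable_const_bound[of _ K]) (use gb in auto)
      have "\<bar>(LINT x|R. x ^ n) - (LINT x|R. g x)\<bar> = \<bar>LINT x|R. x ^ n - g x\<bar>"
        using gi R(2) by simp
      also have "\<dots> \<le> (LINT x|R. \<bar>x ^ n - g x\<bar>)" by (rule integral_abs_bound)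
      also have "\<dots> \<le> (LINT x|R. x ^ (2 * n) / K)"
        using gi R(2) diff by (intro integral_mono) auto
      finally show ?thesis by simp
    qed
    have "(\<lambda>k. s n - (LINT x|\<rho> k. g x)) \<longlonglongrightarrow> s n - (LINT x|M. g x)"
      by (intro tendsto_intros wc[OF gc gb])
    then have "(\<lambda>k. \<bar>s n - (LINT x|\<rho> k. g x)\<bar>) \<longlonglongrightarrow> \<bar>s n - (LINT x|M. g x)\<bar>"
      by (rule tendsto_rabs)
    then have "\<bar>s n - (LINT x|M. g x)\<bar> \<le> s (2 * n) / K"
    proof (rule tendsto_upperbound)
      show "\<forall>\<^sub>F k in sequentially. \<bar>s n - (LINT x|\<rho> k. g x)\<bar> \<le> s (2 * n) / K"
        using mom[of n] mom[of "2 * n"]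
      proof eventually_elim
        case (elim k)
        then show ?case using trunc[OF rd int, of k] by simp
      qed
    qed simp
    moreover have "\<bar>(LINT x|M. x ^ n) - (LINT x|M. g x)\<bar> \<le> m / K"
      using trunc[OF M intn] by (simp add: m_def)
    ultimately show ?thesis by (simp add: add_divide_distrib)
  qed
  have "((\<lambda>K. (s (2 * n) + m) / K) \<longlongrightarrow> 0) at_top"
    by (intro real_tendsto_divide_at_top[OF tendsto_const] filterlim_ident)
  then have "\<bar>s n - (LINT x|M. x ^ n)\<bar> \<le> 0"
    by (rule tendsto_lowerbound) (auto intro!: eventually_mono[OF eventually_gt_at_top[of 0]] main)
  then show "(LINT x|M. x ^ n) = s n" by simp
qed

text \<open>The bound \<open>k + 2\<close> in \<open>mom\<close> makes the second moment exact from
  \<open>k = 0\<close> on, as tightness of the whole sequence requires.\<close>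

lemma moment_solution_subsequence:
  assumes \<sigma>: "\<sigma> \<in> Mstar"
    and rd: "\<And>k. real_distribution (\<rho> k)" and int: "\<And>k n. integrable (\<rho> k) (\<lambda>x. x ^ n)"
    and mom: "\<And>k n. n \<le> k + 2 \<Longrightarrow> (LINT x|\<rho> k. x ^ n) = moment \<sigma> n"
  obtains r M where "strict_mono r" "M \<in> Mstar" "\<And>n. moment M n = moment \<sigma> n"
    "\<And>z. z \<notin> \<real> \<Longrightarrow> (\<lambda>k. stieltjes_transform (\<rho> (r k)) z) \<longlonglongrightarrow> stieltjes_transform M z"
proof -
  have "tight \<rho>" by (rule tight_if_second_moment_bounded[OF rd int, where B = "moment \<sigma> 2"]) (simp add: mom)
  then obtain r M where r: "strict_mono r" and M: "real_distribution M" and conv: "weak_conv_m (\<rho> \<circ> id \<circ> r) M"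
    using tight_imp_convergent_subsubsequence[of \<rho> id] by (auto simp: strict_mono_def)
  have conv: "weak_conv_m (\<lambda>k. \<rho> (r k)) M" using conv by (simp add: o_def)
  have mom': "\<forall>\<^sub>F k in sequentially. (LINT x|\<rho> (r k). x ^ n) = moment \<sigma> n" for n
    using eventually_ge_at_top[of n]
  proof eventually_elim
    case (elim k)
    then show ?case using seq_suble[OF r, of k] by (intro mom) linarith
  qed
  note lim = weak_limit_moments[of "\<lambda>k. \<rho> (r k)" "moment \<sigma>" M, OF rd int mom' M conv]
  have sets: "sets M = sets borel"
    using M by (simp add: real_distribution_def real_distribution_axioms_def)
  have eq: "moment M n = moment \<sigma> n" for n using lim(2)[of n] by (simp add: moment_def)
  have "M \<in> Mstar" by (rule Mstar_if_same_moments[OF \<sigma> sets lim(1) eq])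
  moreover have "(\<lambda>k. stieltjes_transform (\<rho> (r k)) z) \<longlonglongrightarrow> stieltjes_transform M z" if z: "z \<notin> \<real>" for z
    unfolding stieltjes_transform_def
  proof (rule weak_conv_imp_integral_bdd_continuous_conv[OF rd M conv])
    show "isCont (\<lambda>x. 1 / (complex_of_real x - z)) x" for x
      using nonreal_neq[OF z, of x] by (intro continuous_intros) auto
    show "norm (1 / (complex_of_real x - z)) \<le> 1 / \<bar>Im z\<bar>" for x
      using nonreal_dist_ge[of z x] nonreal_Im[OF z] by (simp add: norm_divide frac_le)
  qed
  ultimately show ?thesis using that[OF r] eq by blast
qed

text \<open>The \<open>3\<close> instead of \<open>2\<close> allows for
  \<open>degree q = N - 1\<close>.\<close>

lemma (in quasi_orthogonal) quadrature_moments: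
  assumes "n + 3 \<le> 2 * N"
  shows "integrable quadrature (\<lambda>x. x ^ n')" "(LINT x|quadrature. x ^ n) = moment \<mu> n"
proof -
  show "integrable quadrature (\<lambda>x. x ^ n')" by (rule integral_quadrature) simp
  let ?p = "monom 1 n :: complex poly"
  have "degree ?p + 2 \<le> degree q + N" using assms degree_q_ge by (simp add: degree_monom_eq)
  from quadrature_poly[OF this]
  have "(LINT x|quadrature. complex_of_real (x ^ n)) = (LINT x|\<mu>. complex_of_real (x ^ n))"
    by (simp add: L_def poly_monom)
  then show "(LINT x|quadrature. x ^ n) = moment \<mu> n"
    unfolding integral_complex_of_real moment_def by (simp only: of_real_eq_iff)
qed

text \<open>The quadrature measures at the zeros of \<open>B\<^sub>N\<close> and \<open>D\<^sub>N\<close> have Stieltjes transforms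
  \<open>- A\<^sub>N / B\<^sub>N\<close> and \<open>- C\<^sub>N / D\<^sub>N\<close>, whose difference \<open>1 / (B\<^sub>N D\<^sub>N)\<close> stays away from \<open>0\<close>.\<close>

lemma (in mstar_l2) two_solutions:
  assumes mass1: "measure \<mu> UNIV = 1"
  obtains M M' where "M \<in> Mstar" "M' \<in> Mstar" "M \<noteq> M'"
    "\<And>n. moment M n = moment \<mu> n" "\<And>n. moment M' n = moment \<mu> n"
proof -
  \<comment> \<open>Order \<open>k + 3\<close> is at least \<open>2\<close> and makes the quadrature
    exact for all moments up to \<open>k + 2\<close>, also for \<open>k = 0\<close>.\<close>
  define \<rho>D where "\<rho>D k = quasi_orthogonal.quadrature \<mu> (qD (k + 3))" for k
  define \<rho>B where "\<rho>B k = quasi_orthogonal.quadrature \<mu> (qB (k + 3))" for k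
  have oD: "quasi_orthogonal \<mu> (qD (k + 3)) (k + 3)" for k
    by (rule quasi_orthogonal_qD[OF _ mass1]) simp
  have oB: "quasi_orthogonal \<mu> (qB (k + 3)) (k + 3)" for k
    by (rule quasi_orthogonal_qB[OF _ mass1]) simp
  have D: "real_distribution (\<rho>D k)" "integrable (\<rho>D k) (\<lambda>x. x ^ n)"
    "n \<le> k + 2 \<Longrightarrow> (LINT x|\<rho>D k. x ^ n) = moment \<mu> n"
    "z \<notin> \<real> \<Longrightarrow> stieltjes_transform (\<rho>D k) z = - Cn (k + 3) z / Dn (k + 3) z"
    "z \<notin> \<real> \<Longrightarrow> Dn (k + 3) z \<noteq> 0" for k n z
  proof -
    interpret quasi_orthogonal \<mu> "qD (k + 3)" "k + 3" by (rule oD)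
    show "real_distribution (\<rho>D k)" "integrable (\<rho>D k) (\<lambda>x. x ^ n)"
      "n \<le> k + 2 \<Longrightarrow> (LINT x|\<rho>D k. x ^ n) = moment \<mu> n"
      "z \<notin> \<real> \<Longrightarrow> stieltjes_transform (\<rho>D k) z = - Cn (k + 3) z / Dn (k + 3) z"
      "z \<notin> \<real> \<Longrightarrow> Dn (k + 3) z \<noteq> 0"
      unfolding \<rho>D_def using real_distribution_quadrature quadrature_moments(1)[of 0 n] quadrature_moments(2)[of n]
        stieltjes_quadrature[of z] q_nonreal[of z] L_synthetic_div_qD[of "k + 3" z] poly_qD[of "k + 3" z]
      by simp_all
  qed
  have B: "real_distribution (\<rho>B k)" "integrable (\<rho>B k) (\<lambda>x. x ^ n)"
    "n \<le> k + 2 \<Longrightarrow> (LINT x|\<rho>B k. x ^ n) = moment \<mu> n"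
    "z \<notin> \<real> \<Longrightarrow> stieltjes_transform (\<rho>B k) z = - An (k + 3) z / Bn (k + 3) z"
    "z \<notin> \<real> \<Longrightarrow> Bn (k + 3) z \<noteq> 0" for k n z
  proof -
    interpret quasi_orthogonal \<mu> "qB (k + 3)" "k + 3" by (rule oB)
    show "real_distribution (\<rho>B k)" "integrable (\<rho>B k) (\<lambda>x. x ^ n)"
      "n \<le> k + 2 \<Longrightarrow> (LINT x|\<rho>B k. x ^ n) = moment \<mu> n"
      "z \<notin> \<real> \<Longrightarrow> stieltjes_transform (\<rho>B k) z = - An (k + 3) z / Bn (k + 3) z"
      "z \<notin> \<real> \<Longrightarrow> Bn (k + 3) z \<noteq> 0"
      unfolding \<rho>B_def using real_distribution_quadrature quadrature_moments(1)[of 0 n] quadrature_moments(2)[of n]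
        stieltjes_quadrature[of z] q_nonreal[of z] L_synthetic_div_qB[of "k + 3" z] poly_qB[of "k + 3" z]
      by simp_all
  qed
  obtain r M where r: "strict_mono r" and M: "M \<in> Mstar" "\<And>n. moment M n = moment \<mu> n"
    and MF: "\<And>z. z \<notin> \<real> \<Longrightarrow> (\<lambda>k. stieltjes_transform (\<rho>D (r k)) z) \<longlonglongrightarrow> stieltjes_transform M z"
    by (rule moment_solution_subsequence[of \<mu> \<rho>D, OF Mstar D(1,2,3)], assumption, rule that)
  \<comment> \<open>The second extraction starts from the first subsequence, so that both transforms
    converge along common indices.\<close>
  have Br: "(LINT x|\<rho>B (r k). x ^ n) = moment \<mu> n" if "n \<le> k + 2" for k n
    using that seq_suble[OF r, of k] by (intro B(3)) linarith
  obtain r' M' where r': "strict_mono r'" and M': "M' \<in> Mstar" "\<And>n. moment M' n = moment \<mu> n"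
    and M'F: "\<And>z. z \<notin> \<real> \<Longrightarrow> (\<lambda>k. stieltjes_transform (\<rho>B (r (r' k))) z) \<longlonglongrightarrow> stieltjes_transform M' z"
    by (rule moment_solution_subsequence[of \<mu> "\<lambda>k. \<rho>B (r k)", OF Mstar B(1,2) Br], assumption, rule that)
  have i: "\<i> \<notin> \<real>" by (simp add: complex_is_Real_iff)
  define d where "d = (\<lambda>k. stieltjes_transform (\<rho>D (r (r' k))) \<i> - stieltjes_transform (\<rho>B (r (r' k))) \<i>)"
  have "(\<lambda>k. stieltjes_transform (\<rho>D (r (r' k))) \<i>) \<longlonglongrightarrow> stieltjes_transform M \<i>"
    using LIMSEQ_subseq_LIMSEQ[OF MF[OF i] r'] by (simp add: o_def)
  then have dlim: "d \<longlonglongrightarrow> stieltjes_transform M \<i> - stieltjes_transform M' \<i>"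
    unfolding d_def using M'F[OF i] by (rule tendsto_diff)
  define N where "N k = r (r' k) + 3" for k
  have d: "d k * (Bn (N k) \<i> * Dn (N k) \<i>) = 1" for k
  proof -
    have "d k = - Cn (N k) \<i> / Dn (N k) \<i> + An (N k) \<i> / Bn (N k) \<i>"
      unfolding d_def N_def using D(4)[OF i] B(4)[OF i] by simp
    then have "d k * (Bn (N k) \<i> * Dn (N k) \<i>) = An (N k) \<i> * Dn (N k) \<i> - Bn (N k) \<i> * Cn (N k) \<i>"
      using D(5)[OF i, of "r (r' k)"] B(5)[OF i, of "r (r' k)"] unfolding N_def by (simp add: field_simps)
    then show ?thesis by (simp add: det_n)
  qed
  have "strict_mono N" using r r' unfolding N_def strict_mono_def by simp
  then have "(\<lambda>k. Bn (N k) \<i>) \<longlonglongrightarrow> NB \<i>" "(\<lambda>k. Dn (N k) \<i>) \<longlonglongrightarrow> ND \<i>"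
    using LIMSEQ_subseq_LIMSEQ[OF ABCD_lims(2)[of \<i>], of N] LIMSEQ_subseq_LIMSEQ[OF ABCD_lims(4)[of \<i>], of N]
    by (simp_all add: o_def)
  then have "(\<lambda>k. d k * (Bn (N k) \<i> * Dn (N k) \<i>))
      \<longlonglongrightarrow> (stieltjes_transform M \<i> - stieltjes_transform M' \<i>) * (NB \<i> * ND \<i>)"
    by (intro tendsto_mult dlim)
  \<comment> \<open>The product along the sequence is constantly \<open>1\<close>, so the limit of
    \<open>d\<close> cannot be \<open>0\<close>.\<close>
  then have "(stieltjes_transform M \<i> - stieltjes_transform M' \<i>) * (NB \<i> * ND \<i>) = 1"
    unfolding d by (simp add: LIMSEQ_const_iff)
  then have "M \<noteq> M'" by auto
  then show ?thesis using that M M' by blast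
qed

theorem christoffel_zero_if_determinate:
  assumes "\<mu> \<in> Mstar_d" "z \<notin> \<real>"
  shows "christoffel_zero \<mu> z"
proof (rule ccontr)
  assume nc: "\<not> christoffel_zero \<mu> z"
  have \<mu>: "\<mu> \<in> Mstar" using assms(1) by (simp add: Mstar_d_def)
  interpret mstar \<mu> by standard fact
  define c where "c = 1 / measure \<mu> UNIV"
  have c: "c > 0" using mass_pos by (simp add: c_def)
  define \<sigma> where "\<sigma> = density \<mu> (\<lambda>_. ennreal c)"
  have \<sigma>: "\<sigma> \<in> Mstar" "\<sigma> \<in> Mstar_d"
    using density_const_Mstar[OF \<mu> c] Mstar_d_density_const_iff[OF \<mu> c] assms(1) by (auto simp: \<sigma>_def)
  have "\<not> christoffel_zero \<sigma> z" using nc by (simp add: \<sigma>_def christoffel_zero_density_const[OF c])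
  then interpret S: mstar_l2 \<sigma> using \<sigma>(1) assms(2) by (intro mstar_l2I)
  have "measure \<sigma> UNIV = moment \<sigma> 0" by (simp add: moment_def)
  also have "\<dots> = c * moment \<mu> 0" unfolding \<sigma>_def by (rule moment_density_const[OF c])
  also have "\<dots> = 1" using mass_pos by (simp add: c_def moment_def)
  finally obtain M M' where M: "M \<in> Mstar" "M' \<in> Mstar" "M \<noteq> M'"
    "\<And>n. moment M n = moment \<sigma> n" "\<And>n. moment M' n = moment \<sigma> n"
    using S.two_solutions by blast
  then have "M = \<sigma>" "M' = \<sigma>" using \<sigma>(2) by (auto simp: Mstar_d_def)
  then show False using M(3) by simp
qed

section \<open>Weighted measures, the index and the two equivalences\<close>

lemma determinate_weighted:
  assumes "\<mu> \<in> Mstar_d" "\<delta> \<ge> 0"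
  shows "weighted (- \<delta>) \<mu> \<in> Mstar_d"
proof -
  have \<mu>: "\<mu> \<in> Mstar" using assms(1) by (simp add: Mstar_d_def)
  interpret mstar \<mu> by standard fact
  show ?thesis
    using weighted_Mstar christoffel_zero_weighted[OF christoffel_zero_if_determinate[OF assms(1)] assms(2)]
    by (rule determinate_if_christoffel_zero)
qed

text \<open>Approximability for \<open>\<mu>\<close> is the Christoffel condition for
  \<open>weighted (- 1) \<mu>\<close>, because \<open>\<mu>\<close> is the latter weighted by
  \<open>1 + x^2\<close>. This settles the exponents beyond \<open>1\<close>, which the index does
  not see.\<close>

lemma N_extremal_weighted_determinate:
  assumes "\<mu> \<in> Mstar_i0"
  shows "weighted (- 1) \<mu> \<in> Mstar_d"
proof -
  have \<mu>: "\<mu> \<in> Mstar_i" "\<mu> \<in> Mstar" using assms by (auto simp: Mstar_i0_def Mstar_i_def)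
  interpret mstar \<mu> by standard fact
  interpret W: mstar "weighted (- 1) \<mu>" using weighted_Mstar by unfold_locales
  have "resolvent_approx (weighted 1 (weighted (- 1) \<mu>)) z" if "z \<notin> \<real>" for z
    using N_extremal_iff_resolvent_approx[OF \<mu>(1)] assms that
    by (simp add: Mstar_i0_def weighted_weighted weighted_0)
  then show ?thesis
    using W.resolvent_approx_iff_christoffel_zero W.Mstar by (intro determinate_if_christoffel_zero) auto
qed

lemma N_extremal_weighted:
  assumes "\<mu> \<in> Mstar_i0" "a \<ge> 0" "weighted (- a) \<mu> \<in> Mstar_i"
  shows "weighted (- a) \<mu> \<in> Mstar_i0"
proof -
  have \<mu>: "\<mu> \<in> Mstar_i" "\<mu> \<in> Mstar" "N_extremal \<mu>" using assms(1) by (auto simp: Mstar_i0_def Mstar_i_def)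
  interpret mstar \<mu> by standard fact
  show ?thesis
    using assms(2,3) \<mu>(3) resolvent_approx_weighted
    by (simp add: Mstar_i0_def N_extremal_iff_resolvent_approx \<mu>(1))
qed

lemma determinate_weighted_N_extremal:
  assumes "\<nu> \<in> Mstar_d" "weighted 1 \<nu> \<in> Mstar_i"
  shows "weighted 1 \<nu> \<in> Mstar_i0"
proof -
  interpret mstar \<nu> using assms(1) by unfold_locales (simp add: Mstar_d_def)
  show ?thesis
    using assms christoffel_zero_if_determinate
    by (simp add: Mstar_i0_def N_extremal_iff_resolvent_approx resolvent_approx_iff_christoffel_zero)
qed

text \<open>Nonempty and bounded: without these the real \<open>Sup\<close> in
  \<open>a_index\<close> would carry no information.\<close>

lemma a_index_set:
  assumes "\<mu> \<in> Mstar_i"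
  shows "0 \<in> {\<alpha> \<in> {0..1}. \<mu> \<in> A_at \<alpha>}" "bdd_above {\<alpha> \<in> {0..1}. \<mu> \<in> A_at \<alpha>}"
    "0 \<le> a_index \<mu>"
proof -
  interpret mstar \<mu> using assms by unfold_locales (simp add: Mstar_i_def)
  show 0: "0 \<in> {\<alpha> \<in> {0..1}. \<mu> \<in> A_at \<alpha>}" using assms by (simp add: A_at_def weighted_0)
  show bdd: "bdd_above {\<alpha> \<in> {0..1}. \<mu> \<in> A_at \<alpha>}" by (intro bdd_aboveI[of _ 1]) auto
  show "0 \<le> a_index \<mu>" unfolding a_index_def by (rule cSup_upper[OF 0 bdd])
qed

lemma A_set_imp_ex:
  assumes "\<mu> \<in> A_set"
  shows "\<exists>\<nu> \<in> Mstar_i0. \<forall>\<delta>>0. weighted (- \<delta>) \<nu> \<in> Mstar_d"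
proof -
  have \<mu>: "\<mu> \<in> Mstar_i0" "\<mu> \<in> Mstar_i" "\<mu> \<in> Mstar" using assms by (auto simp: A_set_def Mstar_i0_def Mstar_i_def)
  interpret mstar \<mu> by standard fact
  let ?a = "a_index \<mu>"
  have "weighted (- \<delta>) (weighted (- ?a) \<mu>) \<in> Mstar_d" if "\<delta> > 0" for \<delta>
  proof -
    have eq: "weighted (- \<delta>) (weighted (- ?a) \<mu>) = weighted (- (?a + \<delta>)) \<mu>"
      by (simp add: weighted_weighted algebra_simps)
    show ?thesis
    \<comment> \<open>Up to exponent \<open>1\<close>, exceeding the supremum excludes
      indeterminacy; past \<open>1\<close>, determinacy is inherited from the exponent
      \<open>1\<close>.\<close>
    proof (cases "?a + \<delta> \<le> 1")
      case True
      have "\<not> \<mu> \<in> A_at (?a + \<delta>)"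
      proof
        assume "\<mu> \<in> A_at (?a + \<delta>)"
        then have "?a + \<delta> \<in> {\<alpha> \<in> {0..1}. \<mu> \<in> A_at \<alpha>}"
          using True a_index_set(3)[OF \<mu>(2)] that by simp
        from cSup_upper[OF this a_index_set(2)[OF \<mu>(2)]] show False
          unfolding a_index_def[symmetric] using that by simp
      qed
      then show ?thesis unfolding eq using \<mu>(2) weighted_Mstar by (auto simp: A_at_def Mstar_i_def)
    next
      case False
      interpret W: mstar "weighted (- 1) \<mu>" using weighted_Mstar by unfold_locales
      have "weighted (- (?a + \<delta> - 1)) (weighted (- 1) \<mu>) \<in> Mstar_d"
        using False by (intro determinate_weighted N_extremal_weighted_determinate \<mu>(1)) simp
      then show ?thesis unfolding eq by (simp add: weighted_weighted)
    qed
  qed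
  moreover have "weighted (- ?a) \<mu> \<in> Mstar_i0"
    using assms a_index_set(3)[OF \<mu>(2)] \<mu>(1) by (intro N_extremal_weighted) (auto simp: A_set_def)
  ultimately show ?thesis by blast
qed

lemma ex_imp_A_set:
  assumes \<nu>: "\<nu> \<in> Mstar_i0" and d: "\<And>\<delta>. \<delta> > 0 \<Longrightarrow> weighted (- \<delta>) \<nu> \<in> Mstar_d"
  shows "\<nu> \<in> A_set"
proof -
  have i: "\<nu> \<in> Mstar_i" using \<nu> by (simp add: Mstar_i0_def)
  interpret mstar \<nu> using i by unfold_locales (simp add: Mstar_i_def)
  have "{\<alpha> \<in> {0..1}. \<nu> \<in> A_at \<alpha>} = {0}"
  proof (intro set_eqI iffI)
    fix \<alpha> assume \<alpha>: "\<alpha> \<in> {\<alpha> \<in> {0..1}. \<nu> \<in> A_at \<alpha>}"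
    then have "\<not> \<alpha> > 0" using d[of \<alpha>] by (auto simp: A_at_def Mstar_i_def)
    then show "\<alpha> \<in> {0}" using \<alpha> by auto
  qed (use a_index_set(1)[OF i] in simp)
  then have "a_index \<nu> = 0" by (simp add: a_index_def)
  then show ?thesis using \<nu> i by (simp add: A_set_def weighted_0)
qed

lemma B_set_imp_ex:
  assumes "\<mu> \<in> B_set"
  shows "\<exists>\<nu> \<in> Mstar_d. \<forall>\<delta>>0. weighted \<delta> \<nu> \<in> Mstar_i"
proof -
  have \<mu>: "\<mu> \<in> Mstar_i" "\<mu> \<in> Mstar" and B: "weighted (- a_index \<mu>) \<mu> \<in> Mstar_d"
    using assms by (auto simp: B_set_def Mstar_i0_def Mstar_i_def)
  interpret mstar \<mu> by standard fact
  let ?a = "a_index \<mu>"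
  have "weighted \<delta> (weighted (- ?a) \<mu>) \<in> Mstar_i" if "\<delta> > 0" for \<delta>
  proof (rule ccontr)
    assume "\<not> ?thesis"
    then have d: "weighted (\<delta> - ?a) \<mu> \<in> Mstar_d"
      using weighted_Mstar by (simp add: weighted_weighted Mstar_i_def)
    \<comment> \<open>Some indeterminate exponent \<open>\<alpha>\<close> lies above
      \<open>?a - \<delta>\<close>, yet determinacy at \<open>?a - \<delta>\<close> would be
      inherited by every larger exponent.\<close>
    have "?a - \<delta> < Sup {\<alpha> \<in> {0..1}. \<mu> \<in> A_at \<alpha>}" using that by (simp add: a_index_def)
    then obtain \<alpha> where \<alpha>: "\<mu> \<in> A_at \<alpha>" "?a - \<delta> < \<alpha>"
      using less_cSupE a_index_set(1)[OF \<mu>(1)] by (metis (no_types, lifting) empty_iff mem_Collect_eq)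
    have "weighted (- (\<alpha> - ?a + \<delta>)) (weighted (\<delta> - ?a) \<mu>) \<in> Mstar_d"
      using \<alpha>(2) by (intro determinate_weighted d) simp
    then have "weighted (- \<alpha>) \<mu> \<in> Mstar_d" by (simp add: weighted_weighted)
    then show False using \<alpha>(1) by (simp add: A_at_def Mstar_i_def)
  qed
  then show ?thesis using B by blast
qed

lemma ex_imp_B_set:
  assumes \<nu>: "\<nu> \<in> Mstar_d" and d: "\<And>\<delta>. \<delta> > 0 \<Longrightarrow> weighted \<delta> \<nu> \<in> Mstar_i"
  shows "weighted 1 \<nu> \<in> B_set"
proof -
  interpret mstar \<nu> using \<nu> by unfold_locales (simp add: Mstar_d_def)
  have i: "weighted 1 \<nu> \<in> Mstar_i" using d by simp
  have w: "weighted (- \<alpha>) (weighted 1 \<nu>) = weighted (1 - \<alpha>) \<nu>" for \<alpha>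
    by (simp add: weighted_weighted)
  \<comment> \<open>The exponent relative to \<open>\<nu>\<close> is \<open>1 - \<alpha>\<close>,
    positive exactly for \<open>\<alpha> < 1\<close>; the supremum \<open>1\<close> is not
    attained.\<close>
  have "{\<alpha> \<in> {0..1}. weighted 1 \<nu> \<in> A_at \<alpha>} = {0..<1}"
  proof (intro set_eqI iffI)
    fix \<alpha> assume "\<alpha> \<in> {\<alpha> \<in> {0..1}. weighted 1 \<nu> \<in> A_at \<alpha>}"
    moreover have "weighted 1 \<nu> \<notin> A_at 1" using \<nu> by (simp add: A_at_def w weighted_0 Mstar_i_def)
    ultimately show "\<alpha> \<in> {0..<1}" by (cases "\<alpha> = 1") auto
  qed (use i d in \<open>auto simp: A_at_def w\<close>)
  then have "a_index (weighted 1 \<nu>) = 1" by (simp add: a_index_def)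
  then show ?thesis
    using determinate_weighted_N_extremal[OF \<nu> i] \<nu> by (simp add: B_set_def w weighted_0)
qed

theorem proposition1p7:
  shows "(A_set \<noteq> {} \<longleftrightarrow>
            (\<exists>\<nu> \<in> Mstar_i0. \<forall>\<delta>::real. \<delta> > 0 \<longrightarrow> weighted (- \<delta>) \<nu> \<in> Mstar_d)) \<and>
         (B_set \<noteq> {} \<longleftrightarrow>
            (\<exists>\<nu> \<in> Mstar_d. \<forall>\<delta>::real. \<delta> > 0 \<longrightarrow> weighted \<delta> \<nu> \<in> Mstar_i))"
  using A_set_imp_ex ex_imp_A_set B_set_imp_ex ex_imp_B_set by blast

end
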